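(* Let $k$ be a field and let $R$ be a standard graded Koszul $k$-algebra with the Backelin-Roos property. Let $c$ be the codimension of $R$ and $h_R(z)$ its $h$-polynomial. Then the formal power series \[ 1-\frac{h_R(-z)}{(1-z)^c} \] has non-negative coefficients.
   Context: A standard graded $k$-algebra is a commutative graded ring $R=\bigoplus_{i\ge 0}R_i$ with $R_0=k$, generated as a $k$-algebra by $R_1$, with $\dim_k R_1<\infty$; morphisms are homomorphisms of graded $k$-algebras. The codimension of $R$ is $\dim_kR_1-\dim R$. The $h$-polynomial $h_R(z)\in\mathbb Z[z]$ is defined by $\sum_{i\ge0}(\dim_kR_i)z^i=h_R(z)/(1-z)^{\dim R}$. For a finitely generated graded $R$-module $M$ let $\beta^R_{i,j}(M)=\dim_k \operatorname{Tor}^R_i(k,M)_j$ and $P^R_M(s,z)=\sum_{i,j}\beta^R_{i,j}(M)s^jz^i$. $R$ is Koszul if $\beta^R_{i,j}(k)=0$ for all $i\ne j$. Golod morphisms: let $\varphi\colon Q\to R$ be a surjective morphism of standard graded $k$-algebras with $\operatorname{Ker}\varphi\subseteq (Q_{\ge 1})^2$. There is always a coefficientwise inequality $P^R_k(s,z)\preccurlyeq \frac{P^Q_k(s,z)}{1-z(P^Q_R(s,z)-1)}$; $\varphi$ is Golod if equality holds. $R$ has the Backelin-Roos property if there is a surjective Golod morphism $Q\to R$ with $Q$ a standard graded complete intersection ring (a quotient of a standard graded polynomial ring by an ideal generated by a homogeneous regular sequence). *)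

theory Defs
  imports
    "HOL-Library.Poly_Mapping"
    "HOL-Computational_Algebra.Computational_Algebra"
begin

section \<open>Standard graded algebras\<close>

text \<open>
  A \<open>k\<close>-algebra is a commutative ring \<open>'r\<close> together with its scalar multiplication by the field
  \<open>'k\<close>; a grading is the family \<open>G\<close> of its homogeneous components. Since \<open>(*)\<close> makes a
  commutative ring into a module over itself, \<open>module.subspace (*)\<close> and \<open>module.span (*)\<close>
  are the ideals of \<open>'r\<close> and the ideal generated by a set.
\<close>

locale graded_algebra = vector_space scale
  for scale :: "'k::field \<Rightarrow> 'r::comm_ring_1 \<Rightarrow> 'r" +
  fixes G :: "nat \<Rightarrow> 'r set"
  assumes scale_mult_left: "scale a (x * y) = scale a x * y"
    and subspace_G: "subspace (G i)"
    and G_mult: "x \<in> G i \<Longrightarrow> y \<in> G j \<Longrightarrow> x * y \<in> G (i + j)"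
    and direct_sum_G:
      "\<exists>!f. (\<forall>i. f i \<in> G i) \<and> finite {i. f i \<noteq> 0} \<and> x = (\<Sum>i | f i \<noteq> 0. f i)"

definition subalgebra :: "('k::field \<Rightarrow> 'r::comm_ring_1 \<Rightarrow> 'r) \<Rightarrow> 'r set \<Rightarrow> bool" where
  "subalgebra scale A \<longleftrightarrow>
     module.subspace scale A \<and> 1 \<in> A \<and> (\<forall>x\<in>A. \<forall>y\<in>A. x * y \<in> A)"

locale std_graded_algebra = graded_algebra scale G
  for scale :: "'k::field \<Rightarrow> 'r::comm_ring_1 \<Rightarrow> 'r" and G :: "nat \<Rightarrow> 'r set" +
  assumes G_0: "G 0 = range (\<lambda>a. scale a 1)"
    and generated_by_G_1: "subalgebra scale hull G 1 = UNIV"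
    and finite_dim_G_1: "\<exists>B. finite B \<and> span B = G 1"

definition irrelevant :: "(nat \<Rightarrow> 'r::comm_ring_1 set) \<Rightarrow> 'r set" where
  "irrelevant G = module.span (*) (\<Union>i\<in>{1..}. G i)"

text \<open>The canonical map \<open>R \<rightarrow> R / R\<^bsub>\<ge>1\<^esub> = k\<close>.\<close>

definition residue ::
  "('k::field \<Rightarrow> 'r::comm_ring_1 \<Rightarrow> 'r) \<Rightarrow> (nat \<Rightarrow> 'r set) \<Rightarrow> 'r \<Rightarrow> 'k" where
  "residue scale G x = (THE a. x - scale a 1 \<in> irrelevant G)"

definition graded_algebra_hom ::
  "('k::field \<Rightarrow> 'q::comm_ring_1 \<Rightarrow> 'q) \<Rightarrow> (nat \<Rightarrow> 'q set) \<Rightarrow>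
   ('k \<Rightarrow> 'r::comm_ring_1 \<Rightarrow> 'r) \<Rightarrow> (nat \<Rightarrow> 'r set) \<Rightarrow> ('q \<Rightarrow> 'r) \<Rightarrow> bool" where
  "graded_algebra_hom sQ GQ sR GR \<phi> \<longleftrightarrow>
     Vector_Spaces.linear sQ sR \<phi> \<and> \<phi> 1 = 1 \<and>
     (\<forall>x y. \<phi> (x * y) = \<phi> x * \<phi> y) \<and> (\<forall>i. \<phi> ` GQ i \<subseteq> GR i)"


section \<open>Dimension, codimension, h-polynomial\<close>

definition prime_ideal :: "'r::comm_ring_1 set \<Rightarrow> bool" where
  "prime_ideal P \<longleftrightarrow>
     module.subspace (*) P \<and> 1 \<notin> P \<and> (\<forall>x y. x * y \<in> P \<longrightarrow> x \<in> P \<or> y \<in> P)"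

text \<open>
  The Krull dimension, as the supremum in \<open>nat\<close> of the lengths of chains of primes. It is
  meaningful when these lengths are bounded, as they are for a standard graded algebra \<open>R\<close>,
  where \<open>dim R \<le> dim\<^sub>k R\<^sub>1\<close>; the subtraction in \<open>codim\<close> is then not truncated either.
\<close>

definition krull_dim :: "'r::comm_ring_1 itself \<Rightarrow> nat" where
  "krull_dim _ =
     Sup {n. \<exists>P :: nat \<Rightarrow> 'r set. (\<forall>i\<le>n. prime_ideal (P i)) \<and> (\<forall>i<n. P i \<subset> P (Suc i))}"

definition codim ::
  "('k::field \<Rightarrow> 'r::comm_ring_1 \<Rightarrow> 'r) \<Rightarrow> (nat \<Rightarrow> 'r set) \<Rightarrow> nat" where
  "codim scale G = vector_space.dim scale (G 1) - krull_dim TYPE('r)"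

definition hilbert_series ::
  "('k::field \<Rightarrow> 'r::comm_ring_1 \<Rightarrow> 'r) \<Rightarrow> (nat \<Rightarrow> 'r set) \<Rightarrow> int fps" where
  "hilbert_series scale G = Abs_fps (\<lambda>i. int (vector_space.dim scale (G i)))"

definition h_polynomial ::
  "('k::field \<Rightarrow> 'r::comm_ring_1 \<Rightarrow> 'r) \<Rightarrow> (nat \<Rightarrow> 'r set) \<Rightarrow> int poly" where
  "h_polynomial scale G =
     (THE h. hilbert_series scale G * (1 - fps_X) ^ krull_dim TYPE('r) = fps_of_poly h)"


section \<open>Graded free resolutions and Tor\<close>

text \<open>
  For \<open>r :: nat \<Rightarrow> nat\<close>, the elements of the graded free module
  \<open>\<Oplus>\<^sub>j R(-j)\<^bsup>r j\<^esup>\<close> are finitely supported functions on basis elements \<open>(j, t)\<close> with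
  \<open>t < r j\<close>, where \<open>(j, t)\<close> has degree \<open>j\<close>.
\<close>

definition free_module :: "(nat \<Rightarrow> nat) \<Rightarrow> (nat \<times> nat \<Rightarrow>\<^sub>0 'r::comm_ring_1) set" where
  "free_module r = {v. \<forall>(j, t)\<in>Poly_Mapping.keys v. t < r j}"

definition free_component ::
  "(nat \<Rightarrow> 'r::comm_ring_1 set) \<Rightarrow> (nat \<Rightarrow> nat) \<Rightarrow> nat \<Rightarrow> (nat \<times> nat \<Rightarrow>\<^sub>0 'r) set" where
  "free_component G r j =
     {v \<in> free_module r. \<forall>(l, t)\<in>Poly_Mapping.keys v.
        l \<le> j \<and> Poly_Mapping.lookup v (l, t) \<in> G (j - l)}"

definition free_scale :: "'r::comm_ring_1 \<Rightarrow> ('b \<Rightarrow>\<^sub>0 'r) \<Rightarrow> ('b \<Rightarrow>\<^sub>0 'r)" where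
  "free_scale c = Poly_Mapping.map (\<lambda>x. c * x)"

text \<open>The linear map that takes the values \<open>e b\<close> on the basis elements \<open>b\<close>.\<close>

definition linear_extension ::
  "('r \<Rightarrow> 'm \<Rightarrow> 'm) \<Rightarrow> ('b \<Rightarrow> 'm) \<Rightarrow> ('b \<Rightarrow>\<^sub>0 'r::comm_ring_1) \<Rightarrow> 'm::ab_group_add" where
  "linear_extension smul e v =
     (\<Sum>b\<in>Poly_Mapping.keys v. smul (Poly_Mapping.lookup v b) (e b))"

text \<open>
  An exact sequence \<open>\<dots> \<rightarrow> F\<^sub>2 \<rightarrow> F\<^sub>1 \<rightarrow> F\<^sub>0 \<rightarrow> M \<rightarrow> 0\<close> of homogeneous maps of degree 0, where
  \<open>F\<^sub>i\<close> is the graded free module \<open>free_module (r i)\<close>, the map \<open>F\<^sub>0 \<rightarrow> M\<close> is given on the basis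
  by \<open>\<epsilon>\<close>, and \<open>F\<^bsub>i+1\<^esub> \<rightarrow> F\<^sub>i\<close> by \<open>d i\<close>. The \<open>R\<close>-module \<open>M\<close> is the type \<open>'m\<close> with the action
  \<open>smul\<close> and homogeneous components \<open>GM\<close>; only gradings in degrees \<open>\<ge> 0\<close> are considered.
\<close>

definition free_resolution ::
  "(nat \<Rightarrow> 'r::comm_ring_1 set) \<Rightarrow> ('r \<Rightarrow> 'm::ab_group_add \<Rightarrow> 'm) \<Rightarrow> (nat \<Rightarrow> 'm set) \<Rightarrow>
   (nat \<Rightarrow> nat \<Rightarrow> nat) \<Rightarrow> (nat \<Rightarrow> nat \<times> nat \<Rightarrow> (nat \<times> nat \<Rightarrow>\<^sub>0 'r)) \<Rightarrow> (nat \<times> nat \<Rightarrow> 'm) \<Rightarrow> bool"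
  where
  "free_resolution G smul GM r d \<epsilon> \<longleftrightarrow>
     (\<forall>j. \<forall>t<r 0 j. \<epsilon> (j, t) \<in> GM j) \<and>
     (\<forall>i j. \<forall>t<r (Suc i) j. d i (j, t) \<in> free_component G (r i) j) \<and>
     linear_extension smul \<epsilon> ` free_module (r 0) = UNIV \<and>
     {v \<in> free_module (r 0). linear_extension smul \<epsilon> v = 0}
       = linear_extension free_scale (d 0) ` free_module (r 1) \<and>
     (\<forall>i. {v \<in> free_module (r (Suc i)). linear_extension free_scale (d i) v = 0}
       = linear_extension free_scale (d (Suc i)) ` free_module (r (Suc (Suc i))))"

text \<open>
  The complex \<open>k \<otimes>\<^sub>R F\<close> of \<open>k\<close>-vector spaces: it has the same bases as \<open>F\<close>, and the entries of
  the matrices of its differentials are the images in \<open>k = R / R\<^bsub>\<ge>1\<^esub>\<close> of those of \<open>F\<close>.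
\<close>

definition tensor_component :: "(nat \<Rightarrow> nat) \<Rightarrow> nat \<Rightarrow> (nat \<times> nat \<Rightarrow>\<^sub>0 'k::field) set" where
  "tensor_component r j = {v \<in> free_module r. \<forall>(l, t)\<in>Poly_Mapping.keys v. l = j}"

definition tensor_differential ::
  "('k::field \<Rightarrow> 'r::comm_ring_1 \<Rightarrow> 'r) \<Rightarrow> (nat \<Rightarrow> 'r set) \<Rightarrow>
   (nat \<times> nat \<Rightarrow> (nat \<times> nat \<Rightarrow>\<^sub>0 'r)) \<Rightarrow> (nat \<times> nat \<Rightarrow>\<^sub>0 'k) \<Rightarrow> (nat \<times> nat \<Rightarrow>\<^sub>0 'k)" where
  "tensor_differential scale G d =
     linear_extension free_scale (\<lambda>b. Poly_Mapping.map (residue scale G) (d b))"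

definition tor_cycles ::
  "('k::field \<Rightarrow> 'r::comm_ring_1 \<Rightarrow> 'r) \<Rightarrow> (nat \<Rightarrow> 'r set) \<Rightarrow> (nat \<Rightarrow> nat \<Rightarrow> nat) \<Rightarrow>
   (nat \<Rightarrow> nat \<times> nat \<Rightarrow> (nat \<times> nat \<Rightarrow>\<^sub>0 'r)) \<Rightarrow> nat \<Rightarrow> nat \<Rightarrow> (nat \<times> nat \<Rightarrow>\<^sub>0 'k) set" where
  "tor_cycles scale G r d i j =
     (case i of 0 \<Rightarrow> tensor_component (r 0) j
      | Suc i' \<Rightarrow> {v \<in> tensor_component (r i) j. tensor_differential scale G (d i') v = 0})"

definition tor_boundaries ::
  "('k::field \<Rightarrow> 'r::comm_ring_1 \<Rightarrow> 'r) \<Rightarrow> (nat \<Rightarrow> 'r set) \<Rightarrow> (nat \<Rightarrow> nat \<Rightarrow> nat) \<Rightarrow>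
   (nat \<Rightarrow> nat \<times> nat \<Rightarrow> (nat \<times> nat \<Rightarrow>\<^sub>0 'r)) \<Rightarrow> nat \<Rightarrow> nat \<Rightarrow> (nat \<times> nat \<Rightarrow>\<^sub>0 'k) set" where
  "tor_boundaries scale G r d i j =
     tensor_differential scale G (d i) ` tensor_component (r (Suc i)) j"

text \<open>
  \<open>dim\<^sub>k Tor\<^sub>i(k, M)\<^sub>j\<close>, computed from an arbitrarily chosen graded free resolution. The subtraction
  is the dimension of the quotient: boundaries are cycles, and both are finite-dimensional.
\<close>

definition betti ::
  "('k::field \<Rightarrow> 'r::comm_ring_1 \<Rightarrow> 'r) \<Rightarrow> (nat \<Rightarrow> 'r set) \<Rightarrow>
   ('r \<Rightarrow> 'm::ab_group_add \<Rightarrow> 'm) \<Rightarrow> (nat \<Rightarrow> 'm set) \<Rightarrow> nat \<Rightarrow> nat \<Rightarrow> nat" where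
  "betti scale G smul GM i j =
     (let (r, d) = (SOME (r, d). \<exists>\<epsilon>. free_resolution G smul GM r d \<epsilon>)
      in vector_space.dim free_scale (tor_cycles scale G r d i j)
         - vector_space.dim free_scale (tor_boundaries scale G r d i j))"

text \<open>
  \<open>P(s, z)\<close> as a power series in \<open>z\<close> (the outer variable) whose coefficients are power series
  in \<open>s\<close>.
\<close>

definition poincare_series ::
  "('k::field \<Rightarrow> 'r::comm_ring_1 \<Rightarrow> 'r) \<Rightarrow> (nat \<Rightarrow> 'r set) \<Rightarrow>
   ('r \<Rightarrow> 'm::ab_group_add \<Rightarrow> 'm) \<Rightarrow> (nat \<Rightarrow> 'm set) \<Rightarrow> rat fps fps" where
  "poincare_series scale G smul GM =
     Abs_fps (\<lambda>i. Abs_fps (\<lambda>j. of_nat (betti scale G smul GM i j)))"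

text \<open>The residue field as a graded \<open>R\<close>-module, concentrated in degree 0.\<close>

definition residue_smul ::
  "('k::field \<Rightarrow> 'r::comm_ring_1 \<Rightarrow> 'r) \<Rightarrow> (nat \<Rightarrow> 'r set) \<Rightarrow> 'r \<Rightarrow> 'k \<Rightarrow> 'k" where
  "residue_smul scale G x a = residue scale G x * a"

definition residue_grading :: "nat \<Rightarrow> 'k::field set" where
  "residue_grading i = (if i = 0 then UNIV else {0})"

definition koszul ::
  "('k::field \<Rightarrow> 'r::comm_ring_1 \<Rightarrow> 'r) \<Rightarrow> (nat \<Rightarrow> 'r set) \<Rightarrow> bool" where
  "koszul scale G \<longleftrightarrow>
     (\<forall>i j. i \<noteq> j \<longrightarrow> betti scale G (residue_smul scale G) residue_grading i j = 0)"


section \<open>Golod morphisms\<close>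

text \<open>
  The denominator below has constant term 1 with respect to \<open>z\<close>, so that the division of power
  series over the non-field \<open>rat fps\<close> is by a unit; see \<open>golod_equation_iff\<close>. In \<open>P\<^sup>Q\<^sub>R\<close>, the
  ring \<open>'r\<close> is a \<open>'q\<close>-module via \<open>\<phi>\<close>.
\<close>

definition golod_equation :: "rat fps fps \<Rightarrow> rat fps fps \<Rightarrow> rat fps fps \<Rightarrow> bool" where
  "golod_equation PRk PQk PQR \<longleftrightarrow> PRk = PQk / (1 - fps_X * (PQR - 1))"

lemma golod_equation_iff:
  "golod_equation PRk PQk PQR \<longleftrightarrow> PRk * (1 - fps_X * (PQR - 1)) = PQk"
proof -
  define g where "g = 1 - fps_X * (PQR - 1)"
  have g0: "fps_nth g 0 = 1"
    by (simp add: g_def)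
  have sub: "subdegree g = 0"
    by (rule subdegreeI) (simp_all add: g0)
  have div: "PQk / g = PQk * inverse g"
    by (simp add: fps_divide_def sub fps_unit_factor_def)
  have "inverse g = fps_right_inverse g (inverse (1 :: rat fps))"
    unfolding fps_inverse_def[of g] g0 ..
  hence eq: "inverse g = fps_right_inverse g 1"
    by (simp only: fps_inverse_one)
  have inv: "g * inverse g = 1"
    unfolding eq by (rule fps_right_inverse) (simp add: g0)
  have "PRk = PQk * inverse g \<longleftrightarrow> PRk * g = PQk"
  proof
    assume "PRk = PQk * inverse g"
    hence "PRk * g = PQk * (g * inverse g)"
      by (simp only: mult_ac)
    thus "PRk * g = PQk"
      by (simp only: inv mult_1_right)
  next
    assume "PRk * g = PQk"
    hence "PQk * inverse g = PRk * (g * inverse g)"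
      by (simp only: mult.assoc[symmetric])
    thus "PRk = PQk * inverse g"
      by (simp only: inv mult_1_right)
  qed
  thus ?thesis
    unfolding golod_equation_def g_def[symmetric] div .
qed

definition surjective_golod ::
  "('k::field \<Rightarrow> 'q::comm_ring_1 \<Rightarrow> 'q) \<Rightarrow> (nat \<Rightarrow> 'q set) \<Rightarrow>
   ('k \<Rightarrow> 'r::comm_ring_1 \<Rightarrow> 'r) \<Rightarrow> (nat \<Rightarrow> 'r set) \<Rightarrow> ('q \<Rightarrow> 'r) \<Rightarrow> bool" where
  "surjective_golod sQ GQ sR GR \<phi> \<longleftrightarrow>
     graded_algebra_hom sQ GQ sR GR \<phi> \<and> surj \<phi> \<and>
     {x. \<phi> x = 0} \<subseteq> module.span (*) {x * y | x y. x \<in> irrelevant GQ \<and> y \<in> irrelevant GQ} \<and>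
     golod_equation
       (poincare_series sR GR (residue_smul sR GR) residue_grading)
       (poincare_series sQ GQ (residue_smul sQ GQ) residue_grading)
       (poincare_series sQ GQ (\<lambda>x y. \<phi> x * y) GR)"


section \<open>Complete intersections and the Backelin-Roos property\<close>

text \<open>The polynomial ring \<open>k[X\<^sub>0, \<dots>, X\<^bsub>n-1\<^esub>]\<close> inside the polynomials in countably many variables.\<close>

type_synonym 'k mpoly = "(nat \<Rightarrow>\<^sub>0 nat) \<Rightarrow>\<^sub>0 'k"

definition mpoly_ring :: "nat \<Rightarrow> 'k::field mpoly set" where
  "mpoly_ring n = {p. \<forall>m\<in>Poly_Mapping.keys p. Poly_Mapping.keys m \<subseteq> {..<n}}"

definition homogeneous :: "'k::field mpoly \<Rightarrow> bool" where
  "homogeneous p \<longleftrightarrow>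
     (\<exists>d. \<forall>m\<in>Poly_Mapping.keys p. (\<Sum>i\<in>Poly_Mapping.keys m. Poly_Mapping.lookup m i) = d)"

definition mpoly_ideal :: "nat \<Rightarrow> 'k::field mpoly list \<Rightarrow> 'k mpoly set" where
  "mpoly_ideal n fs =
     {\<Sum>i<length fs. g i * fs ! i | g. \<forall>i<length fs. g i \<in> mpoly_ring n}"

definition regular_sequence :: "nat \<Rightarrow> 'k::field mpoly list \<Rightarrow> bool" where
  "regular_sequence n fs \<longleftrightarrow>
     set fs \<subseteq> mpoly_ring n \<and> 1 \<notin> mpoly_ideal n fs \<and>
     (\<forall>i<length fs. \<forall>g\<in>mpoly_ring n.
        g * fs ! i \<in> mpoly_ideal n (take i fs) \<longrightarrow> g \<in> mpoly_ideal n (take i fs))"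

definition mpoly_eval ::
  "('k::field \<Rightarrow> 'q::comm_ring_1 \<Rightarrow> 'q) \<Rightarrow> (nat \<Rightarrow> 'q) \<Rightarrow> 'k mpoly \<Rightarrow> 'q" where
  "mpoly_eval scale x p =
     (\<Sum>m\<in>Poly_Mapping.keys p. scale (Poly_Mapping.lookup p m)
        (\<Prod>i\<in>Poly_Mapping.keys m. x i ^ Poly_Mapping.lookup m i))"

text \<open>
  \<open>Q \<cong> k[X\<^sub>0, \<dots>, X\<^bsub>n-1\<^esub>] / (fs)\<close> as graded algebras: a morphism of graded \<open>k\<close>-algebras from the
  polynomial ring to \<open>Q\<close> is evaluation at elements of \<open>Q\<^sub>1\<close>.
\<close>

definition complete_intersection ::
  "('k::field \<Rightarrow> 'q::comm_ring_1 \<Rightarrow> 'q) \<Rightarrow> (nat \<Rightarrow> 'q set) \<Rightarrow> bool" where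
  "complete_intersection scale G \<longleftrightarrow>
     std_graded_algebra scale G \<and>
     (\<exists>n x fs. (\<forall>i<n. x i \<in> G 1) \<and>
        (\<forall>f\<in>set fs. homogeneous f) \<and> regular_sequence n fs \<and>
        mpoly_eval scale x ` mpoly_ring n = UNIV \<and>
        {p \<in> mpoly_ring n. mpoly_eval scale x p = 0} = mpoly_ideal n fs)"

text \<open>
  HOL has no quantifier over types, so the underlying type \<open>'q\<close> of \<open>Q\<close> is a parameter. In a
  hypothesis, a type variable in this position is universally quantified over the whole
  theorem, which amounts to \<open>Q\<close> existing on some type.
\<close>

definition backelin_roos ::
  "'q::comm_ring_1 itself \<Rightarrow>
   ('k::field \<Rightarrow> 'r::comm_ring_1 \<Rightarrow> 'r) \<Rightarrow> (nat \<Rightarrow> 'r set) \<Rightarrow> bool" where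
  "backelin_roos _ scale G \<longleftrightarrow>
     (\<exists>(sQ :: 'k \<Rightarrow> 'q \<Rightarrow> 'q) GQ \<phi>.
        complete_intersection sQ GQ \<and> surjective_golod sQ GQ scale G \<phi>)"

end

theory Submission
  imports Defs
begin

text \<open>
  Let \<open>Q \<rightarrow> R\<close> be the Golod morphism, \<open>n\<close> the embedding dimension of \<open>R\<close>, \<open>D\<close> its Krull dimension,
  \<open>c = n - D\<close>, and let \<open>H\<^sub>R\<close> and \<open>B\<^sub>R\<close> be the Hilbert series of \<open>R\<close> and the generating series of
  the numbers \<open>dim Tor\<^sub>i(k, k)\<^sub>i\<close>; similarly for \<open>Q\<close>.

  For a Koszul algebra \<open>B\<^sub>R(z) H\<^sub>R(-z) = 1\<close> (\<open>koszul_hilbert_series\<close>). The Golod equation bounds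
  the Poincare series of \<open>k\<close> over \<open>Q\<close> by that over \<open>R\<close>, so \<open>Q\<close> is Koszul too, and the equation
  becomes \<open>B\<^sub>R (1 - E) = B\<^sub>Q\<close> with nonnegative \<open>E\<close> (\<open>golod_koszul\<close>). A Koszul complete
  intersection is defined by quadrics (\<open>koszul_complete_intersection\<close>), so that
  \<open>H\<^sub>Q = (1 - z\<^sup>2)\<^sup>m / (1 - z)\<^sup>n\<close>. Hence
  \<open>h\<^sub>R(-z) / (1 - z)\<^sup>c = (1 - E) / (1 - z\<^sup>2)\<^sup>e\<close> with \<open>e = c - m\<close>,
  and \<open>e \<ge> 0\<close> since \<open>dim R \<le> dim Q\<close>.

  That \<open>E\<close> is nonnegative does not settle the sign, because \<open>1 / (1 - z\<^sup>2)\<^sup>e\<close> has positive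
  coefficients. But the coefficient \<open>E\<^sub>2\<close> of \<open>z\<^sup>2\<close> is the number of quadrics in the kernel of
  \<open>Q \<rightarrow> R\<close>. Koszul algebras are quadratic, so these and the \<open>m\<close> quadrics of \<open>Q\<close> generate the
  relations of \<open>R\<close>, and Krull's height theorem gives \<open>c \<le> m + E\<^sub>2\<close>, that is \<open>E\<^sub>2 \<ge> e\<close>. This is
  enough, since \<open>1 - (1 - e z\<^sup>2) / (1 - z\<^sup>2)\<^sup>e\<close> has nonnegative coefficients
  (\<open>one_minus_quotient_nonneg\<close>).

  Betti numbers are defined by an unspecified resolution, possibly not minimal. The identity for
  \<open>B\<^sub>R\<close> comes from a count of dimensions in such a resolution, whose error terms are nonnegative
  and therefore vanish where a Betti number does (\<open>betti_excess\<close>); that Koszul algebras are quadratic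
  comes from comparing such a resolution with the first steps of a minimal one
  (\<open>koszul_syzygies\<close>). The Krull dimension is tied to the order of the pole of the Hilbert series at
  \<open>1\<close> from both sides: \<open>hilbert_serre\<close> bounds the order of the pole by the lengths of chains of
  primes through noetherian induction on homogeneous ideals, and \<open>prime_chain_bound\<close> bounds these
  lengths by the growth of the algebra. The height theorem is only used for quadrics and in
  terms of poles (\<open>koszul_pole_order\<close>): adjoining a quadric to an ideal multiplies the Hilbert
  series of the quotient at least by \<open>1 - z\<^sup>2\<close>.
\<close>


section \<open>Finite-dimensional subspaces\<close>

context vector_space
begin

text \<open>
  The function \<open>dim\<close> counts a basis and is therefore \<open>0\<close> on infinite-dimensional subspaces;
  it is monotone and satisfies the dimension formulas only below the following predicate.
\<close>

definition fin_dim :: "'b set \<Rightarrow> bool" where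
  "fin_dim V \<longleftrightarrow> (\<exists>B. finite B \<and> V \<subseteq> span B)"

lemma fin_dim_subset: "local.fin_dim W \<Longrightarrow> V \<subseteq> W \<Longrightarrow> local.fin_dim V"
  unfolding fin_dim_def by blast

lemma fin_dim_basis:
  assumes "local.fin_dim V"
  obtains B where "finite B" "B \<subseteq> V" "independent B" "V \<subseteq> span B" "card B = local.dim V"
proof -
  obtain B where B: "B \<subseteq> V" "independent B" "V \<subseteq> span B" "card B = local.dim V"
    using basis_exists by blast
  obtain C where C: "finite C" "V \<subseteq> span C"
    using assms unfolding fin_dim_def by blast
  have "finite B"
    using independent_span_bound[OF C(1) B(2) subset_trans[OF B(1) C(2)]] by blast
  with B that show ?thesis by blast
qed

lemma fin_dim_enum:
  assumes "local.fin_dim V"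
  obtains b where "\<forall>i<local.dim V. b i \<in> V" "V \<subseteq> span (b ` {..<local.dim V})"
    "independent (b ` {..<local.dim V})" "inj_on b {..<local.dim V}"
proof -
  obtain B where B: "finite B" "B \<subseteq> V" "independent B" "V \<subseteq> span B" "card B = local.dim V"
    by (rule fin_dim_basis[OF assms])
  obtain b where b: "bij_betw b {..<local.dim V} B"
    using ex_bij_betw_nat_finite[OF B(1)] B(5) by (auto simp: atLeast0LessThan)
  then have "b ` {..<local.dim V} = B" "inj_on b {..<local.dim V}"
    by (auto simp: bij_betw_def)
  with B that show ?thesis by blast
qed

lemma fin_dim_dim_mono:
  assumes "local.fin_dim W" "V \<subseteq> span W"
  shows "local.dim V \<le> local.dim W"
proof -
  obtain B where B: "finite B" "B \<subseteq> W" "independent B" "W \<subseteq> span B" "card B = local.dim W"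
    by (rule fin_dim_basis[OF assms(1)])
  then have "V \<subseteq> span B"
    using assms(2) span_minimal[OF B(4) subspace_span] by (rule_tac subset_trans)
  then show ?thesis
    using dim_le_card[OF _ B(1)] B(5) by simp
qed

lemma fin_dim_dim_subset: "local.fin_dim W \<Longrightarrow> V \<subseteq> W \<Longrightarrow> local.dim V \<le> local.dim W"
  using fin_dim_dim_mono span_superset by blast

lemma fin_dim_dim_insert:
  assumes "local.fin_dim W" "x \<notin> span W"
  shows "local.dim (insert x W) = Suc (local.dim W)"
proof -
  obtain B where B: "finite B" "B \<subseteq> W" "independent B" "W \<subseteq> span B" "card B = local.dim W"
    by (rule fin_dim_basis[OF assms(1)])
  have sp: "span B = span W"
    by (intro subset_antisym span_mono B(2) span_minimal[OF B(4)] subspace_span)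
  have x: "x \<notin> B"
    using assms(2) B(2) span_base by blast
  have "independent (insert x B)"
    using assms(2) B(3) sp by (simp add: independent_insertI)
  moreover have "span (insert x B) = span (insert x W)"
    by (simp add: span_insert sp)
  ultimately have "local.dim (insert x W) = card (insert x B)"
    by (metis dim_eq_card)
  then show ?thesis
    using B x by simp
qed

lemma fin_dim_finite_span: "finite B \<Longrightarrow> V \<subseteq> span B \<Longrightarrow> local.fin_dim V"
  unfolding fin_dim_def by blast

lemma fin_dim_span: "local.fin_dim V \<Longrightarrow> local.fin_dim (span V)"
  unfolding fin_dim_def using span_minimal[OF _ subspace_span] by blast

lemma fin_dim_Un: "local.fin_dim V \<Longrightarrow> local.fin_dim W \<Longrightarrow> local.fin_dim (V \<union> W)"
  unfolding fin_dim_def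
proof -
  assume "\<exists>B. finite B \<and> V \<subseteq> span B" "\<exists>B. finite B \<and> W \<subseteq> span B"
  then obtain B C where "finite B" "V \<subseteq> span B" "finite C" "W \<subseteq> span C"
    by blast
  moreover have "span B \<subseteq> span (B \<union> C)" "span C \<subseteq> span (B \<union> C)"
    by (auto intro!: span_mono)
  ultimately show "\<exists>B. finite B \<and> V \<union> W \<subseteq> span B"
    by (intro exI[of _ "B \<union> C"]) auto
qed

lemma fin_dim_sums:
  assumes "local.fin_dim V" "local.fin_dim W"
  shows "local.fin_dim {x + y | x y. x \<in> V \<and> y \<in> W}"
  by (rule fin_dim_subset[OF fin_dim_span[OF fin_dim_Un[OF assms]]])
    (auto intro!: span_add intro: span_base)

lemma fin_dim_subspace_eq:
  assumes "subspace V" "V \<subseteq> W" "local.fin_dim W" "local.dim W \<le> local.dim V"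
  shows "V = W"
proof (rule ccontr)
  assume "V \<noteq> W"
  then obtain x where x: "x \<in> W" "x \<notin> V"
    using assms(2) by blast
  then have "x \<notin> span V"
    using assms(1) by (metis span_eq_iff)
  then have "local.dim (insert x V) = Suc (local.dim V)"
    using fin_dim_dim_insert fin_dim_subset assms(2,3) by blast
  moreover have "local.dim (insert x V) \<le> local.dim W"
    using fin_dim_dim_subset assms(2,3) x(1) by simp
  ultimately show False
    using assms(4) by simp
qed

end

context vector_space_pair
begin

lemma fin_dim_image:
  assumes "Vector_Spaces.linear s1 s2 f" "vs1.fin_dim V"
  shows "vs2.fin_dim (f ` V)"
proof -
  obtain B where "finite B" "V \<subseteq> vs1.span B"
    using assms(2) unfolding vs1.fin_dim_def by blast
  then show ?thesis
    unfolding vs2.fin_dim_def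
    by (intro exI[of _ "f ` B"])
      (metis assms(1) finite_imageI image_mono linear_span_image)
qed

text \<open>
  Rank and nullity of the map \<open>V \<rightarrow> W / U\<close> induced by \<open>f\<close>. With \<open>U = 0\<close> it is the usual
  formula; with \<open>f\<close> the multiplication by a ring element and \<open>U\<close> a graded piece of an ideal
  it is the count that controls how a Hilbert function changes under adjoining an element.
\<close>

lemma dim_sum_image:
  assumes f: "Vector_Spaces.linear s1 s2 f" and V: "vs1.subspace V" "vs1.fin_dim V"
    and U: "vs2.subspace U" "vs2.fin_dim U"
  shows "vs2.dim {u + f v | u v. u \<in> U \<and> v \<in> V} + vs1.dim {v \<in> V. f v \<in> U}
    = vs2.dim U + vs1.dim V"
proof -
  define K where "K = {v \<in> V. f v \<in> U}"
  have K: "vs1.subspace K"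
    unfolding K_def vs1.subspace_def using V(1) U(1)
    by (auto simp: vs1.subspace_def vs2.subspace_def linear_0[OF f] linear_add[OF f] linear_scale[OF f])
  have KV: "K \<subseteq> V" by (auto simp: K_def)
  obtain BK where BK: "finite BK" "BK \<subseteq> K" "vs1.independent BK" "K \<subseteq> vs1.span BK" "card BK = vs1.dim K"
    by (rule vs1.fin_dim_basis[OF vs1.fin_dim_subset[OF V(2) KV]])
  have sBK: "vs1.span BK = K"
    by (intro subset_antisym vs1.span_minimal BK K)
  obtain B where B: "BK \<subseteq> B" "B \<subseteq> V" "vs1.independent B" "V \<subseteq> vs1.span B"
    using vs1.maximal_independent_subset_extend[of BK V] BK KV by blast
  have finB: "finite B"
    using V(2) vs1.independent_span_bound[OF _ B(3)] B(2) unfolding vs1.fin_dim_def by blast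
  have key: "vs2.dim (U \<union> f ` E) = vs2.dim U + card E"
    if "finite E" "E \<subseteq> B - BK" for E
    using that
  proof (induction E)
    case empty
    then show ?case by simp
  next
    case (insert x E)
    have E: "E \<subseteq> B - BK" and x: "x \<in> B" "x \<notin> BK" "x \<notin> E"
      using insert by auto
    have "f x \<notin> vs2.span (U \<union> f ` E)"
    proof
      assume "f x \<in> vs2.span (U \<union> f ` E)"
      then obtain u w where uw: "f x = u + w" "u \<in> vs2.span U" "w \<in> vs2.span (f ` E)"
        unfolding vs2.span_Un by auto
      obtain v where v: "w = f v" "v \<in> vs1.span E"
        using uw(3) linear_span_image[OF f, of E] by auto
      have EV: "vs1.span E \<subseteq> V"
        using E B(2) by (intro vs1.span_minimal V(1)) blast
      have "f (x - v) = u"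
        using uw v by (simp add: linear_diff[OF f])
      moreover have "u \<in> U"
        using uw(2) U(1) by (metis vs2.span_eq_iff)
      moreover have "x - v \<in> V"
        using x(1) B(2) EV v(2) by (intro vs1.subspace_diff[OF V(1)]) blast+
      ultimately have "x - v \<in> K"
        by (simp add: K_def)
      then have "(x - v) + v \<in> vs1.span (BK \<union> E)"
        using sBK v(2) vs1.span_mono[of BK "BK \<union> E"] vs1.span_mono[of E "BK \<union> E"]
        by (intro vs1.span_add) blast+
      then have "x \<in> vs1.span (BK \<union> E)" by simp
      moreover have "BK \<union> E \<subseteq> B - {x}"
        using B(1) E x by auto
      ultimately have "x \<in> vs1.span (B - {x})"
        using vs1.span_mono by blast
      then show False
        using B(3) x(1) unfolding vs1.dependent_def by blast
    qed
    moreover have "vs2.fin_dim (U \<union> f ` E)"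
      using insert.hyps(1)
      by (intro vs2.fin_dim_Un U(2) vs2.fin_dim_finite_span[OF _ vs2.span_superset]) simp
    ultimately have "vs2.dim (insert (f x) (U \<union> f ` E)) = Suc (vs2.dim (U \<union> f ` E))"
      by (intro vs2.fin_dim_dim_insert)
    then show ?case
      using insert.IH[OF E] insert.hyps by simp
  qed
  have V_eq: "V = vs1.span (BK \<union> (B - BK))"
    using subset_antisym[OF B(4) vs1.span_minimal[OF B(2) V(1)]] B(1) by (simp add: Un_absorb1)
  have fK: "f ` K \<subseteq> U" by (auto simp: K_def)
  have "{u + f v | u v. u \<in> U \<and> v \<in> V} = vs2.span (U \<union> f ` (B - BK))"
  proof
    show "{u + f v | u v. u \<in> U \<and> v \<in> V} \<subseteq> vs2.span (U \<union> f ` (B - BK))"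
    proof clarify
      fix u v assume u: "u \<in> U" "v \<in> V"
      then obtain a b where ab: "v = a + b" "a \<in> K" "b \<in> vs1.span (B - BK)"
        unfolding V_eq vs1.span_Un sBK by auto
      have "f b \<in> vs2.span (f ` (B - BK))"
        using ab(3) unfolding linear_span_image[OF f] by (rule imageI)
      then have "f b \<in> vs2.span (U \<union> f ` (B - BK))"
        using vs2.span_mono[of "f ` (B - BK)" "U \<union> f ` (B - BK)"] by blast
      moreover have "u + f a \<in> vs2.span (U \<union> f ` (B - BK))"
        using u fK ab(2) by (auto intro!: vs2.span_add intro: vs2.span_base)
      ultimately have "(u + f a) + f b \<in> vs2.span (U \<union> f ` (B - BK))"
        by (rule vs2.span_add[rotated])
      then show "u + f v \<in> vs2.span (U \<union> f ` (B - BK))"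
        using ab by (simp add: linear_add[OF f] add_ac)
    qed
    have "vs2.subspace {u + f v | u v. u \<in> U \<and> v \<in> V}"
    proof -
      have "{u + f v | u v. u \<in> U \<and> v \<in> V} = {x + y | x y. x \<in> U \<and> y \<in> f ` V}"
        by blast
      then show ?thesis
        using vs2.subspace_sums[OF U(1)] linear_subspace_image[OF f V(1)] by simp
    qed
    moreover have "u \<in> {u + f v | u v. u \<in> U \<and> v \<in> V}" if "u \<in> U" for u
      using that vs1.subspace_0[OF V(1)] linear_0[OF f] by force
    moreover have "f v \<in> {u + f v | u v. u \<in> U \<and> v \<in> V}" if "v \<in> B" for v
      using that B(2) vs2.subspace_0[OF U(1)] by force
    ultimately show "vs2.span (U \<union> f ` (B - BK)) \<subseteq> {u + f v | u v. u \<in> U \<and> v \<in> V}"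
      by (intro vs2.span_minimal) auto
  qed
  then have "vs2.dim {u + f v | u v. u \<in> U \<and> v \<in> V} = vs2.dim U + card (B - BK)"
    using key[of "B - BK"] finB by simp
  moreover have "vs1.dim V = card B"
    using vs1.basis_card_eq_dim[OF B(2,4,3)] by simp
  moreover have "card B = card BK + card (B - BK)"
    using card_Diff_subset[OF BK(1) B(1)] card_mono[OF finB B(1)] by simp
  ultimately show ?thesis
    using BK(5) unfolding K_def by simp
qed

lemma rank_nullity:
  assumes f: "Vector_Spaces.linear s1 s2 f" and V: "vs1.subspace V" "vs1.fin_dim V"
  shows "vs2.dim (f ` V) + vs1.dim {v \<in> V. f v = 0} = vs1.dim V"
proof -
  have "vs2.dim {0} = 0"
    using vs2.dim_le_card[of "{0}" "{}"] by simp
  moreover have "{u + f v |u v. u \<in> {0} \<and> v \<in> V} = f ` V"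
    by auto
  ultimately show ?thesis
    using dim_sum_image[OF f V, of "{0}"] by (simp add: vs2.fin_dim_finite_span[of "{}"])
qed

end


section \<open>Homogeneous parts and the residue map\<close>

lemma module_mult: "module ((*) :: 'r::comm_ring_1 \<Rightarrow> 'r \<Rightarrow> 'r)"
  by standard (simp_all add: algebra_simps)

lemma ideal_iff:
  "module.subspace (*) (I :: 'r::comm_ring_1 set) \<longleftrightarrow>
     0 \<in> I \<and> (\<forall>x\<in>I. \<forall>y\<in>I. x + y \<in> I) \<and> (\<forall>a. \<forall>x\<in>I. a * x \<in> I)"
  unfolding module.subspace_def[OF module_mult] by blast

lemma ideal_sum:
  assumes "module.subspace (*) (I :: 'r::comm_ring_1 set)" "\<And>i. i \<in> A \<Longrightarrow> f i \<in> I"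
  shows "sum f A \<in> I"
  using assms(2) by (induction A rule: infinite_finite_induct) (use assms(1) in \<open>auto simp: ideal_iff\<close>)

lemma ideal_diff:
  assumes "module.subspace (*) (I :: 'r::comm_ring_1 set)" "x \<in> I" "y \<in> I"
  shows "x - y \<in> I"
proof -
  have "x + (-1) * y \<in> I"
    using assms unfolding ideal_iff by blast
  then show ?thesis by simp
qed

context graded_algebra
begin

definition hom_part :: "nat \<Rightarrow> 'r \<Rightarrow> 'r" where
  "hom_part i x =
     (THE f. (\<forall>i. f i \<in> G i) \<and> finite {i. f i \<noteq> 0} \<and> x = (\<Sum>i | f i \<noteq> 0. f i)) i"

lemma hom_part_props:
  "(\<forall>i. hom_part i x \<in> G i) \<and> finite {i. hom_part i x \<noteq> 0} \<and>
   x = (\<Sum>i | hom_part i x \<noteq> 0. hom_part i x)"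
  using theI'[OF direct_sum_G[of x]] unfolding hom_part_def .

lemma hom_part_in [simp, intro]: "hom_part i x \<in> G i"
  using hom_part_props by blast

lemma finite_hom_part [simp]: "finite {i. hom_part i x \<noteq> 0}"
  using hom_part_props by blast

lemma hom_part_unique:
  assumes "\<And>i. f i \<in> G i" "finite A" "\<And>i. i \<notin> A \<Longrightarrow> f i = 0" "x = sum f A"
  shows "hom_part i x = f i"
proof -
  have sub: "{i. f i \<noteq> 0} \<subseteq> A" using assms(3) by blast
  have "sum f {i. f i \<noteq> 0} = sum f A"
    by (rule sum.mono_neutral_left) (use assms(2) sub in auto)
  then have P: "(\<forall>i. f i \<in> G i) \<and> finite {i. f i \<noteq> 0} \<and> x = (\<Sum>i | f i \<noteq> 0. f i)"
    using assms sub finite_subset by auto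
  have "(THE f. (\<forall>i. f i \<in> G i) \<and> finite {i. f i \<noteq> 0} \<and> x = (\<Sum>i | f i \<noteq> 0. f i)) = f"
    by (rule the1_equality, rule direct_sum_G, rule P)
  then show ?thesis
    unfolding hom_part_def by (rule fun_cong)
qed

lemma sum_hom_part:
  assumes "finite A" "\<And>i. i \<notin> A \<Longrightarrow> hom_part i x = 0"
  shows "(\<Sum>i\<in>A. hom_part i x) = x"
proof -
  have "(\<Sum>i\<in>A. hom_part i x) = (\<Sum>i | hom_part i x \<noteq> 0. hom_part i x)"
    by (rule sum.mono_neutral_right) (use assms in auto)
  then show ?thesis using hom_part_props by metis
qed

lemma hom_part_bound: "\<exists>N. (\<forall>i>N. hom_part i x = 0) \<and> (\<Sum>i\<le>N. hom_part i x) = x"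
proof -
  obtain N where "\<forall>i\<in>{i. hom_part i x \<noteq> 0}. i \<le> N"
    using finite_hom_part[of x] unfolding finite_nat_set_iff_bounded_le by (rule exE)
  then have N: "hom_part i x = 0" if "i > N" for i
    using that by fastforce
  have "(\<Sum>i\<le>N. hom_part i x) = x"
    by (rule sum_hom_part) (use N in auto)
  with N show ?thesis by blast
qed

lemma zero_in_G [simp, intro]: "0 \<in> G i"
  using subspace_0[OF subspace_G] .

lemma sum_in_G: "(\<And>i. i \<in> A \<Longrightarrow> f i \<in> G j) \<Longrightarrow> sum f A \<in> G j"
  by (rule subspace_sum[OF subspace_G])

lemma hom_part_eqI: "x \<in> G j \<Longrightarrow> hom_part i x = (if i = j then x else 0)"
  by (rule hom_part_unique[of "\<lambda>i. if i = j then x else 0" "{j}"]) auto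

lemma hom_part_add: "hom_part i (x + y) = hom_part i x + hom_part i y"
proof -
  let ?A = "{i. hom_part i x \<noteq> 0} \<union> {i. hom_part i y \<noteq> 0}"
  show ?thesis
  proof (rule hom_part_unique[of "\<lambda>i. hom_part i x + hom_part i y" ?A])
    have "x = (\<Sum>i\<in>?A. hom_part i x)" "y = (\<Sum>i\<in>?A. hom_part i y)"
      by (auto intro!: sum_hom_part[symmetric])
    then show "x + y = (\<Sum>i\<in>?A. hom_part i x + hom_part i y)"
      by (simp add: sum.distrib)
  qed (auto intro: subspace_add[OF subspace_G])
qed

lemma hom_part_0_arg [simp]: "hom_part i 0 = 0"
  using hom_part_eqI[OF zero_in_G[of i], of i] by simp

lemma hom_part_sum: "hom_part i (sum f A) = (\<Sum>a\<in>A. hom_part i (f a))"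
  by (induction A rule: infinite_finite_induct) (auto simp: hom_part_add)

lemma hom_part_scale: "hom_part i (scale a x) = scale a (hom_part i x)"
proof (rule hom_part_unique[of "\<lambda>i. scale a (hom_part i x)" "{i. hom_part i x \<noteq> 0}"])
  show "scale a x = (\<Sum>i | hom_part i x \<noteq> 0. scale a (hom_part i x))"
    by (subst scale_sum_right[symmetric], subst sum_hom_part) auto
qed (auto intro: subspace_scale[OF subspace_G])

lemma hom_part_uminus: "hom_part i (- x) = - hom_part i x"
  using hom_part_add[of i x "- x"] by (simp add: eq_neg_iff_add_eq_0 add.commute)

lemma hom_part_diff: "hom_part i (x - y) = hom_part i x - hom_part i y"
  using hom_part_add[of i x "- y"] by (simp add: hom_part_uminus)

lemma hom_part_mult_hom:
  assumes "a \<in> G k"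
  shows "hom_part j (a * x) = (if k \<le> j then a * hom_part (j - k) x else 0)"
proof -
  obtain N where N: "\<And>i. i > N \<Longrightarrow> hom_part i x = 0" "(\<Sum>i\<le>N. hom_part i x) = x"
    using hom_part_bound[of x] by blast
  have "hom_part j (a * x) = (\<Sum>i\<le>N. hom_part j (a * hom_part i x))"
    by (subst N(2)[symmetric]) (simp add: sum_distrib_left hom_part_sum)
  also have "\<dots> = (\<Sum>i\<le>N. if i + k = j then a * hom_part i x else 0)"
    using hom_part_eqI[OF G_mult[OF assms hom_part_in]] by (intro sum.cong) auto
  also have "\<dots> = (if k \<le> j then a * hom_part (j - k) x else 0)"
  proof (cases "k \<le> j")
    case True
    have "(\<Sum>i\<le>N. if i + k = j then a * hom_part i x else 0)
      = (\<Sum>i\<le>N. if i = j - k then a * hom_part i x else 0)"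
      using True by (intro sum.cong) auto
    then show ?thesis
      using True N(1)[of "j - k"] by (auto simp: sum.delta)
  qed auto
  finally show ?thesis .
qed

lemma hom_part_0_mult: "hom_part 0 (x * y) = hom_part 0 x * hom_part 0 y"
proof -
  obtain N where "\<And>i. i > N \<Longrightarrow> hom_part i x = 0" and N: "(\<Sum>i\<le>N. hom_part i x) = x"
    using hom_part_bound[of x] by blast
  have "hom_part 0 (x * y) = (\<Sum>i\<le>N. hom_part 0 (hom_part i x * y))"
    by (subst N[symmetric]) (simp add: sum_distrib_right hom_part_sum)
  also have "\<dots> = (\<Sum>i\<le>N. if i = 0 then hom_part i x * hom_part 0 y else 0)"
    by (intro sum.cong) (auto simp: hom_part_mult_hom[OF hom_part_in])
  finally show ?thesis by (simp add: sum.delta)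
qed

lemma scale_1_mult: "scale a 1 * x = scale a x"
  by (metis mult_1_left scale_mult_left)

lemma scale_mult_right: "scale a (x * y) = x * scale a y"
  by (metis mult.commute scale_mult_left)

lemma linear_mult: "Vector_Spaces.linear scale scale (\<lambda>x. a * x)"
  using vector_space_axioms by (simp add: Vector_Spaces.linear_iff distrib_left scale_mult_right)

lemma linear_mult_right: "Vector_Spaces.linear scale scale (\<lambda>x. x * a)"
  using linear_mult[of a] by (simp add: mult.commute)

end

context std_graded_algebra
begin

lemma one_in_G0 [simp, intro]: "1 \<in> G 0"
  unfolding G_0 by (rule range_eqI[of _ _ 1]) simp

lemma irrelevant_iff: "x \<in> irrelevant G \<longleftrightarrow> hom_part 0 x = 0"
proof
  have "module.subspace (*) {x. hom_part 0 x = 0}"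
    by (auto simp: ideal_iff hom_part_add hom_part_0_mult)
  moreover have "(\<Union>i\<in>{1..}. G i) \<subseteq> {x. hom_part 0 x = 0}"
    by (auto simp: hom_part_eqI)
  ultimately show "hom_part 0 x = 0" if "x \<in> irrelevant G"
    using that module.span_minimal[OF module_mult] unfolding irrelevant_def by blast
next
  assume x: "hom_part 0 x = 0"
  obtain N where "\<And>i. i > N \<Longrightarrow> hom_part i x = 0" and N: "(\<Sum>i\<le>N. hom_part i x) = x"
    using hom_part_bound[of x] by blast
  have "hom_part i x \<in> irrelevant G" for i
  proof (cases "i = 0")
    case True
    then show ?thesis
      using x module.span_zero[OF module_mult] unfolding irrelevant_def by simp
  next
    case False
    then have "hom_part i x \<in> (\<Union>i\<in>{1..}. G i)"
      using hom_part_in by (metis UN_iff atLeast_iff less_one not_le)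
    then show ?thesis
      unfolding irrelevant_def by (rule module.span_base[OF module_mult])
  qed
  then have "(\<Sum>i\<le>N. hom_part i x) \<in> irrelevant G"
    unfolding irrelevant_def by (intro module.span_sum[OF module_mult])
  then show "x \<in> irrelevant G" by (simp add: N)
qed

lemma hom_part_0_eq_residue: "hom_part 0 x = scale (residue scale G x) 1"
proof -
  obtain a where a: "hom_part 0 x = scale a 1"
    using hom_part_in[of 0 x] G_0 by auto
  have "residue scale G x = a"
    unfolding residue_def irrelevant_iff hom_part_diff a
    by (intro the_equality) (auto simp: hom_part_scale hom_part_eqI[OF one_in_G0])
  then show ?thesis using a by simp
qed

abbreviation "res \<equiv> residue scale G"

lemma residue_eqI: "hom_part 0 x = scale a 1 \<Longrightarrow> res x = a"
  using hom_part_0_eq_residue[of x] by simp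

lemma residue_eq_0_iff: "res x = 0 \<longleftrightarrow> hom_part 0 x = 0"
  by (simp add: hom_part_0_eq_residue)

lemma residue_add: "res (x + y) = res x + res y"
  by (rule residue_eqI) (simp add: hom_part_add hom_part_0_eq_residue scale_left_distrib)

lemma residue_0 [simp]: "res 0 = 0"
  by (simp add: residue_eq_0_iff)

lemma residue_1 [simp]: "res 1 = 1"
  by (rule residue_eqI) (simp add: hom_part_eqI[OF one_in_G0])

lemma residue_mult: "res (x * y) = res x * res y"
  by (rule residue_eqI, simp only: hom_part_0_mult, simp add: hom_part_0_eq_residue scale_1_mult)

lemma residue_scale: "res (scale a x) = a * res x"
  by (rule residue_eqI) (simp add: hom_part_scale hom_part_0_eq_residue)

lemma residue_sum: "res (sum f A) = (\<Sum>a\<in>A. res (f a))"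
  by (induction A rule: infinite_finite_induct) (auto simp: residue_add)

lemma residue_diff: "res (x - y) = res x - res y"
  by (rule residue_eqI) (simp add: hom_part_diff hom_part_0_eq_residue scale_left_diff_distrib)

lemma residue_G: "x \<in> G i \<Longrightarrow> i > 0 \<Longrightarrow> res x = 0"
  by (simp add: residue_eq_0_iff hom_part_eqI)

lemma G_0_eq_residue: "x \<in> G 0 \<Longrightarrow> x = scale (res x) 1"
  using hom_part_0_eq_residue[of x] by (simp add: hom_part_eqI)


section \<open>Generators in degree one\<close>

text \<open>The embedding dimension: the number of variables of a minimal presentation.\<close>

definition edim :: nat where "edim = vector_space.dim scale (G 1)"

definition var :: "nat \<Rightarrow> 'r" where
  "var = (SOME b. (\<forall>i<edim. b i \<in> G 1) \<and> G 1 \<subseteq> span (b ` {..<edim}) \<and>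
     independent (b ` {..<edim}) \<and> inj_on b {..<edim})"

lemma fin_dim_G_1: "local.fin_dim (G 1)"
  using finite_dim_G_1 unfolding fin_dim_def by blast

lemma var_props:
  "(\<forall>i<edim. var i \<in> G 1) \<and> G 1 \<subseteq> span (var ` {..<edim}) \<and>
     independent (var ` {..<edim}) \<and> inj_on var {..<edim}"
proof -
  obtain b where "\<forall>i<local.dim (G 1). b i \<in> G 1" "G 1 \<subseteq> span (b ` {..<local.dim (G 1)})"
    "independent (b ` {..<local.dim (G 1)})" "inj_on b {..<local.dim (G 1)}"
    by (rule fin_dim_enum[OF fin_dim_G_1])
  then have "\<exists>b. (\<forall>i<edim. b i \<in> G 1) \<and> G 1 \<subseteq> span (b ` {..<edim}) \<and>
     independent (b ` {..<edim}) \<and> inj_on b {..<edim}"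
    unfolding edim_def by blast
  from someI_ex[OF this] show ?thesis
    unfolding var_def[symmetric] .
qed

lemma var_in_G1: "i < edim \<Longrightarrow> var i \<in> G 1"
  using var_props by blast

lemma G_1_span:
  assumes "x \<in> G 1"
  obtains c where "x = (\<Sum>i<edim. scale (c i) (var i))"
proof -
  have "x \<in> span (var ` {..<edim})"
    using assms var_props by blast
  then obtain u where "x = (\<Sum>v\<in>var ` {..<edim}. scale (u v) v)"
    unfolding span_finite[OF finite_imageI[OF finite_lessThan]] by auto
  then have "x = (\<Sum>i<edim. scale (u (var i)) (var i))"
    using var_props by (simp add: sum.reindex)
  then show thesis using that[of "\<lambda>i. u (var i)"] by blast
qed

lemma var_independent:
  assumes "(\<Sum>i<edim. scale (c i) (var i)) = 0" "i < edim"
  shows "c i = 0"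
proof -
  have inj: "inj_on var {..<edim}" using var_props by blast
  have "(\<Sum>v\<in>var ` {..<edim}. scale (c (the_inv_into {..<edim} var v)) v) = 0"
    using assms(1) by (simp add: sum.reindex[OF inj] the_inv_into_f_f[OF inj])
  moreover have "independent (var ` {..<edim})" using var_props by blast
  ultimately have "c (the_inv_into {..<edim} var (var i)) = 0"
    using assms(2) independentD[of "var ` {..<edim}" "var ` {..<edim}" "\<lambda>v. c (the_inv_into {..<edim} var v)" "var i"]
    by auto
  then show ?thesis using assms(2) by (simp add: the_inv_into_f_f[OF inj])
qed

text \<open>
  The scalars together with the ideal generated by the \<open>var i\<close> form a subalgebra that contains
  the part of degree one, hence they are everything.
\<close>

lemma irrelevant_eq_var_combination:
  assumes "res x = 0"
  obtains a where "x = (\<Sum>i<edim. var i * a i)"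
proof -
  define I where "I = {\<Sum>i<edim. var i * a i | a. True}"
  have I_add: "x + y \<in> I" if "x \<in> I" "y \<in> I" for x y
    using that unfolding I_def
    by clarify (rule_tac x = "\<lambda>i. a i + aa i" in exI, simp add: distrib_left sum.distrib)
  have I_mult: "c * x \<in> I" if "x \<in> I" for c x
    using that unfolding I_def
    by clarify (rule_tac x = "\<lambda>i. c * a i" in exI, simp add: sum_distrib_left mult_ac)
  have I_0: "0 \<in> I"
    unfolding I_def by (auto intro!: exI[of _ "\<lambda>_. 0"])
  have I_var: "var i * a \<in> I" if "i < edim" for i a
    unfolding I_def using that
    by (auto intro!: exI[of _ "\<lambda>j. if j = i then a else 0"] simp: if_distrib cong: if_cong)
  have I_sum: "sum f A \<in> I" if "\<And>i. i \<in> A \<Longrightarrow> f i \<in> I" for f and A :: "nat set"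
    using that by (induction A rule: infinite_finite_induct) (auto intro: I_add I_0)
  define W where "W = {scale a 1 + y | a y. y \<in> I}"
  have "subalgebra scale W"
    unfolding subalgebra_def
  proof (intro conjI ballI)
    show "subspace W"
      unfolding subspace_def
    proof (intro conjI ballI allI)
      have "0 = scale 0 1 + (0 :: 'r)" by simp
      then show "0 \<in> W" unfolding W_def using I_0 by blast
    next
      fix u v assume "u \<in> W" "v \<in> W"
      then obtain a b x y where "u = scale a 1 + x" "v = scale b 1 + y" "x \<in> I" "y \<in> I"
        unfolding W_def by blast
      then show "u + v \<in> W"
        unfolding W_def using I_add[of x y]
        by (auto intro!: exI[of _ "a + b"] exI[of _ "x + y"] simp: scale_left_distrib)
    next
      fix c v assume "v \<in> W"
      then obtain a x where "v = scale a 1 + x" "x \<in> I"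
        unfolding W_def by blast
      then show "scale c v \<in> W"
        unfolding W_def using I_mult[of x "scale c 1"]
        by (auto intro!: exI[of _ "c * a"] exI[of _ "scale c x"] simp: scale_right_distrib scale_1_mult)
    qed
    have "1 = scale 1 1 + (0 :: 'r)" by simp
    then show "1 \<in> W" unfolding W_def using I_0 by blast
    fix u v assume "u \<in> W" "v \<in> W"
    then obtain a b x y where *: "u = scale a 1 + x" "v = scale b 1 + y" "x \<in> I" "y \<in> I"
      unfolding W_def by blast
    have "u * v = scale (a * b) 1 + (scale a 1 * y + scale b 1 * x + x * y)"
      unfolding * by (simp add: algebra_simps scale_1_mult)
    moreover have "scale a 1 * y + scale b 1 * x + x * y \<in> I"
      using * by (intro I_add I_mult)
    ultimately show "u * v \<in> W" unfolding W_def by blast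
  qed
  moreover have "G 1 \<subseteq> W"
  proof
    fix x assume "x \<in> G 1"
    then obtain c where "x = (\<Sum>i<edim. scale (c i) (var i))"
      by (rule G_1_span)
    then have "x = scale 0 1 + (\<Sum>i<edim. var i * scale (c i) 1)"
      by (simp add: scale_1_mult mult.commute[of _ "scale _ 1"])
    moreover have "(\<Sum>i<edim. var i * scale (c i) 1) \<in> I"
      by (intro I_sum I_var) auto
    ultimately show "x \<in> W" unfolding W_def by blast
  qed
  ultimately have "subalgebra scale hull G 1 \<subseteq> W"
    by (intro hull_minimal)
  then obtain a y where x: "x = scale a 1 + y" "y \<in> I"
    unfolding generated_by_G_1 W_def by blast
  have "res y = 0"
    using x(2) unfolding I_def
    by (auto simp: residue_sum residue_mult residue_G[OF var_in_G1] intro!: sum.neutral)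
  then have "a = 0"
    using assms x(1) by (simp add: residue_add residue_scale)
  then show thesis using x that unfolding I_def by auto
qed

lemma G_Suc_eq_var_combination:
  assumes "x \<in> G (Suc j)"
  obtains a where "\<forall>i. a i \<in> G j" "x = (\<Sum>i<edim. var i * a i)"
proof -
  have "res x = 0" using residue_G[OF assms] by simp
  then obtain a where a: "x = (\<Sum>i<edim. var i * a i)"
    using irrelevant_eq_var_combination by blast
  have "x = hom_part (Suc j) x"
    using assms by (simp add: hom_part_eqI)
  also have "\<dots> = (\<Sum>i<edim. var i * hom_part j (a i))"
    unfolding a hom_part_sum
    by (intro sum.cong) (auto simp: hom_part_mult_hom[OF var_in_G1])
  finally show thesis using that[of "\<lambda>i. hom_part j (a i)"] by blast
qed

lemma fin_dim_G: "local.fin_dim (G j)"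
proof (induction j)
  case 0
  have "G 0 \<subseteq> span {1}"
    unfolding G_0 by (auto simp: span_singleton)
  then show ?case by (intro fin_dim_finite_span[of "{1}"]) auto
next
  case (Suc j)
  obtain B where B: "finite B" "G j \<subseteq> span B"
    using Suc unfolding fin_dim_def by blast
  have "G (Suc j) \<subseteq> span (\<Union>i<edim. (*) (var i) ` B)"
  proof
    fix x assume "x \<in> G (Suc j)"
    then obtain a where a: "\<forall>i. a i \<in> G j" "x = (\<Sum>i<edim. var i * a i)"
      by (rule G_Suc_eq_var_combination)
    interpret vector_space_pair scale scale ..
    have "var i * a i \<in> span (\<Union>i<edim. (*) (var i) ` B)" if "i < edim" for i
    proof -
      have "var i * a i \<in> span ((*) (var i) ` B)"
        using linear_span_image[OF linear_mult[of "var i"], of B] a(1) B(2) by blast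
      then show ?thesis
        using that span_mono[of "(*) (var i) ` B" "\<Union>i<edim. (*) (var i) ` B"] by blast
    qed
    then show "x \<in> span (\<Union>i<edim. (*) (var i) ` B)"
      unfolding a(2) by (intro span_sum) auto
  qed
  then show ?case using B(1) by (intro fin_dim_finite_span) auto
qed

lemma dim_G_0: "local.dim (G 0) = 1"
proof -
  have "G 0 = span {1}"
    unfolding G_0 by (auto simp: span_singleton)
  then show ?thesis
    by (simp add: dim_eq_card_independent)
qed

end


section \<open>Spaces of finitely supported functions\<close>

lemma lookup_map_zero:
  "f 0 = 0 \<Longrightarrow> Poly_Mapping.lookup (Poly_Mapping.map f v) b = f (Poly_Mapping.lookup v b)"
  by (auto simp: Poly_Mapping.map.rep_eq when_def)

lemma lookup_free_scale:
  "Poly_Mapping.lookup (free_scale c v) b = c * Poly_Mapping.lookup v b"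
  unfolding free_scale_def by (rule lookup_map_zero) simp

lemma keys_map_subset: "f 0 = 0 \<Longrightarrow> Poly_Mapping.keys (Poly_Mapping.map f v) \<subseteq> Poly_Mapping.keys v"
  by (auto simp: in_keys_iff lookup_map_zero)

lemma module_free_scale: "module (free_scale :: 'r::comm_ring_1 \<Rightarrow> ('b \<Rightarrow>\<^sub>0 'r) \<Rightarrow> _)"
  by standard (auto intro!: poly_mapping_eqI simp: lookup_free_scale lookup_add algebra_simps)

lemma vector_space_free_scale: "vector_space (free_scale :: 'k::field \<Rightarrow> ('b \<Rightarrow>\<^sub>0 'k) \<Rightarrow> _)"
  unfolding module_iff_vector_space[symmetric] by (rule module_free_scale)

lemma free_scale_0 [simp]: "free_scale 0 v = 0"
  by (rule poly_mapping_eqI) (simp add: lookup_free_scale)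

text \<open>
  A common shape of the graded pieces of free modules, of their reductions to \<open>k\<close>, and of
  polynomials of a fixed degree; one count, \<open>dim_supported\<close>, gives the dimensions of all three.
\<close>

definition supported :: "'b set \<Rightarrow> ('b \<Rightarrow> 'r::zero set) \<Rightarrow> ('b \<Rightarrow>\<^sub>0 'r) set" where
  "supported S H = {v. Poly_Mapping.keys v \<subseteq> S \<and> (\<forall>b\<in>S. Poly_Mapping.lookup v b \<in> H b)}"

lemma linear_extension_superset:
  assumes "finite A" "Poly_Mapping.keys v \<subseteq> A" "\<And>m. smul 0 m = 0"
  shows "linear_extension smul e v = (\<Sum>b\<in>A. smul (Poly_Mapping.lookup v b) (e b))"
  unfolding linear_extension_def
  by (rule sum.mono_neutral_left) (use assms in \<open>auto simp: in_keys_iff\<close>)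

lemma poly_mapping_sum_single:
  assumes "finite A" "Poly_Mapping.keys v \<subseteq> A"
  shows "v = (\<Sum>b\<in>A. Poly_Mapping.single b (Poly_Mapping.lookup v b))"
proof (rule poly_mapping_eqI)
  fix c
  have "(\<Sum>b\<in>A. Poly_Mapping.lookup (Poly_Mapping.single b (Poly_Mapping.lookup v b)) c)
    = (\<Sum>b\<in>A. if b = c then Poly_Mapping.lookup v c else 0)"
    by (intro sum.cong) (auto simp: lookup_single when_def)
  also have "\<dots> = Poly_Mapping.lookup v c"
    using assms by (auto simp: sum.delta in_keys_iff)
  finally show "Poly_Mapping.lookup v c
    = Poly_Mapping.lookup (\<Sum>b\<in>A. Poly_Mapping.single b (Poly_Mapping.lookup v b)) c"
    by (simp add: lookup_sum)
qed

context module
begin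

lemma linear_extension_add:
  "linear_extension scale e (v + w) = linear_extension scale e v + linear_extension scale e w"
proof -
  let ?A = "Poly_Mapping.keys v \<union> Poly_Mapping.keys w"
  have "linear_extension scale e x = (\<Sum>b\<in>?A. scale (Poly_Mapping.lookup x b) (e b))"
    if "x = v \<or> x = w \<or> x = v + w" for x
    using that by (intro linear_extension_superset) (auto simp: in_keys_iff lookup_add)
  then show ?thesis
    by (simp add: lookup_add scale_left_distrib sum.distrib)
qed

lemma linear_extension_free_scale:
  "linear_extension scale e (free_scale c v) = scale c (linear_extension scale e v)"
proof -
  have "linear_extension scale e (free_scale c v)
    = (\<Sum>b\<in>Poly_Mapping.keys v. scale (Poly_Mapping.lookup (free_scale c v) b) (e b))"
    by (intro linear_extension_superset) (auto simp: in_keys_iff lookup_free_scale)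
  then show ?thesis
    by (simp add: linear_extension_def lookup_free_scale scale_sum_right)
qed

lemma linear_extension_0 [simp]: "linear_extension scale e 0 = 0"
  by (simp add: linear_extension_def)

lemma linear_extension_uminus: "linear_extension scale e (- v) = - linear_extension scale e v"
  using linear_extension_add[of e v "- v"] by (simp add: eq_neg_iff_add_eq_0 add.commute)

lemma linear_extension_diff:
  "linear_extension scale e (v - w) = linear_extension scale e v - linear_extension scale e w"
  using linear_extension_add[of e v "- w"] by (simp add: linear_extension_uminus)

lemma linear_extension_sum:
  "linear_extension scale e (sum f A) = (\<Sum>a\<in>A. linear_extension scale e (f a))"
  by (induction A rule: infinite_finite_induct) (auto simp: linear_extension_add)

lemma linear_extension_single:
  "linear_extension scale e (Poly_Mapping.single b c) = scale c (e b)"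
  by (simp add: linear_extension_def)

end

lemma lookup_linear_extension_free:
  assumes "finite A" "Poly_Mapping.keys v \<subseteq> A"
  shows "Poly_Mapping.lookup (linear_extension free_scale d v) c =
    (\<Sum>b\<in>A. Poly_Mapping.lookup v b * Poly_Mapping.lookup (d b) c)"
  by (subst linear_extension_superset[OF assms]) (simp_all add: lookup_sum lookup_free_scale)

context vector_space
begin

lemma vector_space_map_scale:
  "vector_space (\<lambda>a. Poly_Mapping.map (scale a) :: ('i \<Rightarrow>\<^sub>0 'b) \<Rightarrow> _)"
  by standard
    (auto intro!: poly_mapping_eqI simp: lookup_map_zero lookup_add scale_right_distrib scale_left_distrib)

lemma subspace_supported:
  fixes S :: "'i set"
  assumes "\<And>b. b \<in> S \<Longrightarrow> subspace (H b)"
  shows "module.subspace (\<lambda>a. Poly_Mapping.map (scale a)) (supported S H)"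
proof -
  interpret P: vector_space "\<lambda>a. Poly_Mapping.map (scale a) :: ('i \<Rightarrow>\<^sub>0 'b) \<Rightarrow> _"
    by (rule vector_space_map_scale)
  show ?thesis
    unfolding P.subspace_def supported_def using assms
    by (auto simp: lookup_add lookup_map_zero dest: subsetD[OF keys_add] subsetD[OF keys_map_subset, rotated]
      intro: subspace_0 subspace_add subspace_scale)
qed

lemma supported_insert:
  assumes "b \<notin> S" "\<And>c. c \<in> insert b S \<Longrightarrow> subspace (H c)"
  shows "supported (insert b S) H =
    {u + Poly_Mapping.single b x | u x. u \<in> supported S H \<and> x \<in> H b}"
proof (intro subset_antisym subsetI)
  fix v assume v: "v \<in> supported (insert b S) H"
  let ?x = "Poly_Mapping.lookup v b"
  let ?u = "v - Poly_Mapping.single b ?x"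
  have "?u \<in> supported S H"
    using v assms(1) unfolding supported_def
    by (auto simp: in_keys_iff lookup_minus lookup_single when_def split: if_splits)
  moreover have "?x \<in> H b" using v by (auto simp: supported_def)
  moreover have "v = ?u + Poly_Mapping.single b ?x" by simp
  ultimately show "v \<in> {u + Poly_Mapping.single b x | u x. u \<in> supported S H \<and> x \<in> H b}"
    by blast
next
  fix v assume "v \<in> {u + Poly_Mapping.single b x | u x. u \<in> supported S H \<and> x \<in> H b}"
  then obtain u x where ux: "v = u + Poly_Mapping.single b x" "u \<in> supported S H" "x \<in> H b"
    by blast
  have "Poly_Mapping.lookup u b = 0"
    using ux(2) assms(1) by (auto simp: supported_def in_keys_iff)
  then show "v \<in> supported (insert b S) H"
    using ux assms(1) unfolding supported_def
    by (auto simp: in_keys_iff lookup_add lookup_single when_def split: if_splits)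
qed

lemma dim_supported:
  fixes S :: "'i set"
  assumes "finite S" "\<And>b. b \<in> S \<Longrightarrow> subspace (H b)" "\<And>b. b \<in> S \<Longrightarrow> local.fin_dim (H b)"
  shows "vector_space.fin_dim (\<lambda>a. Poly_Mapping.map (scale a)) (supported S H) \<and>
    vector_space.dim (\<lambda>a. Poly_Mapping.map (scale a)) (supported S H) = (\<Sum>b\<in>S. local.dim (H b))"
  using assms
proof (induction S)
  interpret P: vector_space "\<lambda>a. Poly_Mapping.map (scale a) :: ('i \<Rightarrow>\<^sub>0 'b) \<Rightarrow> _"
    by (rule vector_space_map_scale)
  interpret SP: vector_space_pair scale "\<lambda>a. Poly_Mapping.map (scale a) :: ('i \<Rightarrow>\<^sub>0 'b) \<Rightarrow> _" ..
  case empty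
  have "supported {} H = {0}"
    by (auto simp: supported_def)
  then show ?case
    using P.dim_le_card[of "{0}" "{}"] P.fin_dim_finite_span[of "{}" "{0}"] by simp
next
  interpret P: vector_space "\<lambda>a. Poly_Mapping.map (scale a) :: ('i \<Rightarrow>\<^sub>0 'b) \<Rightarrow> _"
    by (rule vector_space_map_scale)
  interpret SP: vector_space_pair scale "\<lambda>a. Poly_Mapping.map (scale a) :: ('i \<Rightarrow>\<^sub>0 'b) \<Rightarrow> _" ..
  case (insert b S)
  have lin: "Vector_Spaces.linear scale (\<lambda>a. Poly_Mapping.map (scale a)) (Poly_Mapping.single b)"
    unfolding Vector_Spaces.linear_iff
    using vector_space_axioms P.vector_space_axioms by (simp add: single_add)
  have U: "P.subspace (supported S H)" "P.fin_dim (supported S H)"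
    using insert by (auto intro: subspace_supported)
  have V: "subspace (H b)" "local.fin_dim (H b)" using insert.prems by auto
  have eq: "supported (insert b S) H =
    {u + Poly_Mapping.single b x | u x. u \<in> supported S H \<and> x \<in> H b}"
    using insert.hyps insert.prems by (intro supported_insert) auto
  have "{x \<in> H b. Poly_Mapping.single b x \<in> supported S H} = {0}"
    using insert.hyps(2) subspace_0[OF V(1)] by (auto simp: supported_def subspace_0 insert.prems)
  then have "local.dim {x \<in> H b. Poly_Mapping.single b x \<in> supported S H} = 0"
    using dim_le_card[of "{0}" "{}"] by simp
  then have "P.dim (supported (insert b S) H) = P.dim (supported S H) + local.dim (H b)"
    using SP.dim_sum_image[OF lin V U] unfolding eq by simp
  moreover have "P.fin_dim (supported (insert b S) H)"
  proof -
    have "supported (insert b S) H = {u + y | u y. u \<in> supported S H \<and> y \<in> Poly_Mapping.single b ` H b}"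
      unfolding eq by blast
    then show ?thesis
      using P.fin_dim_sums[OF U(2) SP.fin_dim_image[OF lin V(2)]] by simp
  qed
  ultimately show ?case
    using insert by simp
qed

lemma complement_enum:
  assumes "subspace U" "U \<subseteq> V" "local.fin_dim V" "subspace V"
  obtains b where "\<forall>i<local.dim V - local.dim U. b i \<in> V"
    "\<forall>v\<in>V. \<exists>x\<in>U. \<exists>c. v = x + (\<Sum>i<local.dim V - local.dim U. scale (c i) (b i))"
proof -
  obtain B0 where B0: "finite B0" "B0 \<subseteq> U" "independent B0" "U \<subseteq> span B0" "card B0 = local.dim U"
    by (rule fin_dim_basis[OF fin_dim_subset[OF assms(3,2)]])
  obtain B where B: "B0 \<subseteq> B" "B \<subseteq> V" "independent B" "V \<subseteq> span B"
    using maximal_independent_subset_extend[OF subset_trans[OF B0(2) assms(2)] B0(3)] by blast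
  obtain C where "finite C" "V \<subseteq> span C"
    using assms(3) unfolding fin_dim_def by blast
  then have finB: "finite B"
    using independent_span_bound[OF _ B(3)] B(2) by (meson subset_trans)
  have cB: "card B = local.dim V"
    by (rule basis_card_eq_dim[OF B(2,4,3)])
  let ?n = "local.dim V - local.dim U"
  have "card (B - B0) = ?n"
    using card_Diff_subset[OF B0(1) B(1)] cB B0(5) by simp
  then obtain b where b: "bij_betw b {..<?n} (B - B0)"
    using ex_bij_betw_nat_finite[of "B - B0"] finB by (auto simp: atLeast0LessThan)
  then have bim: "b ` {..<?n} = B - B0" and binj: "inj_on b {..<?n}"
    by (auto simp: bij_betw_def)
  show thesis
  proof (rule that[of b])
    show "\<forall>i<?n. b i \<in> V" using bim B(2) by auto
    show "\<forall>v\<in>V. \<exists>x\<in>U. \<exists>c. v = x + (\<Sum>i<?n. scale (c i) (b i))"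
    proof
      fix v assume "v \<in> V"
      then have "v \<in> span (B0 \<union> b ` {..<?n})"
        using B(1,4) bim by (auto simp: Un_absorb1)
      then obtain x y where xy: "v = x + y" "x \<in> span B0" "y \<in> span (b ` {..<?n})"
        unfolding span_Un by blast
      have "x \<in> U" using xy(2) span_minimal[OF B0(2) assms(1)] by blast
      moreover obtain u where "y = (\<Sum>w\<in>b ` {..<?n}. scale (u w) w)"
        using xy(3) unfolding span_finite[OF finite_imageI[OF finite_lessThan]] by auto
      then have "y = (\<Sum>i<?n. scale (u (b i)) (b i))"
        using binj by (simp add: sum.reindex)
      ultimately show "\<exists>x\<in>U. \<exists>c. v = x + (\<Sum>i<?n. scale (c i) (b i))"
        using xy(1) by (intro bexI[of _ x] exI[of _ "\<lambda>i. u (b i)"]) auto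
    qed
  qed
qed

end


section \<open>Graded free modules\<close>

lemma free_component_eq_supported:
  "free_component G r j = supported {(l, t). l \<le> j \<and> t < r l} (\<lambda>(l, t). G (j - l))"
  if "\<And>i. 0 \<in> G i"
  using that unfolding free_component_def free_module_def supported_def
  by (fastforce simp: in_keys_iff)

lemma finite_free_index: "finite {(l, t). l \<le> j \<and> t < r (l::nat) \<and> P l}" for r :: "nat \<Rightarrow> nat"
proof (rule finite_subset)
  show "{(l, t). l \<le> j \<and> t < r l \<and> P l} \<subseteq> (SIGMA l:{..j}. {..<r l})" by auto
qed auto

lemma tensor_component_eq_supported:
  "tensor_component r j = supported {(l, t). l = j \<and> t < r l} (\<lambda>_. UNIV)"
  unfolding tensor_component_def free_module_def supported_def by auto

lemma free_index_sum:
  "(\<Sum>(l, t)\<in>{(l, t). l \<le> j \<and> t < r (l::nat)}. g l) = (\<Sum>l\<le>j. r l * g l)" for r g :: "nat \<Rightarrow> nat"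
proof -
  have "{(l, t). l \<le> j \<and> t < r l} = (SIGMA l:{..j}. {..<r l})" by auto
  then show ?thesis by (simp add: sum.Sigma[symmetric])
qed

lemma free_module_add: "v \<in> free_module r \<Longrightarrow> w \<in> free_module r \<Longrightarrow> v + w \<in> free_module r"
  unfolding free_module_def using keys_add[of v w] by blast

lemma free_module_0 [simp]: "0 \<in> free_module r"
  by (simp add: free_module_def)

lemma free_module_scale: "v \<in> free_module r \<Longrightarrow> free_scale c v \<in> free_module r"
  unfolding free_module_def by (fastforce simp: in_keys_iff lookup_free_scale)

lemma free_module_sum: "(\<And>a. a \<in> A \<Longrightarrow> f a \<in> free_module r) \<Longrightarrow> sum f A \<in> free_module r"
  by (induction A rule: infinite_finite_induct) (auto intro: free_module_add)

lemma free_component_subset: "free_component G r j \<subseteq> free_module r"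
  by (auto simp: free_component_def)

context graded_algebra
begin

abbreviation "fscale \<equiv> (\<lambda>a. Poly_Mapping.map (scale a)) :: _ \<Rightarrow> (nat \<times> nat \<Rightarrow>\<^sub>0 'r) \<Rightarrow> _"

lemma free_scale_scale_1: "free_scale (scale a 1) v = Poly_Mapping.map (scale a) v"
  by (rule poly_mapping_eqI) (simp add: lookup_free_scale lookup_map_zero scale_1_mult)

lemma mem_free_component:
  "v \<in> free_component G r j \<longleftrightarrow> v \<in> free_module r \<and>
     (\<forall>l t. if l \<le> j then Poly_Mapping.lookup v (l, t) \<in> G (j - l)
       else Poly_Mapping.lookup v (l, t) = 0)"
proof -
  have "(\<forall>(l, t)\<in>Poly_Mapping.keys v. l \<le> j \<and> Poly_Mapping.lookup v (l, t) \<in> G (j - l)) \<longleftrightarrow>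
    (\<forall>l t. if l \<le> j then Poly_Mapping.lookup v (l, t) \<in> G (j - l)
       else Poly_Mapping.lookup v (l, t) = 0)" (is "?L \<longleftrightarrow> ?R")
  proof
    assume L: ?L
    show ?R
    proof (intro allI)
      fix l t
      show "if l \<le> j then Poly_Mapping.lookup v (l, t) \<in> G (j - l) else Poly_Mapping.lookup v (l, t) = 0"
        using L by (cases "(l, t) \<in> Poly_Mapping.keys v") (auto simp: in_keys_iff)
    qed
  next
    assume R: ?R
    show ?L
    proof (clarify)
      fix l t assume "(l, t) \<in> Poly_Mapping.keys v"
      then show "l \<le> j \<and> Poly_Mapping.lookup v (l, t) \<in> G (j - l)"
        using R[rule_format, of l t] by (auto simp: in_keys_iff split: if_splits)
    qed
  qed
  then show ?thesis by (simp add: free_component_def)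
qed

lemma subspace_free_component: "module.subspace fscale (free_component G r j)"
  unfolding free_component_eq_supported[of G, OF zero_in_G]
  by (rule subspace_supported) (auto simp: subspace_G)

lemma free_component_free_scale:
  assumes "c \<in> G i" "v \<in> free_component G r j"
  shows "free_scale c v \<in> free_component G r (i + j)"
  unfolding mem_free_component
proof (intro conjI allI)
  show "free_scale c v \<in> free_module r"
    using assms(2) free_module_scale by (auto simp: mem_free_component)
  fix l t
  have "(if l \<le> j then Poly_Mapping.lookup v (l, t) \<in> G (j - l) else Poly_Mapping.lookup v (l, t) = 0)"
    using assms(2) by (simp add: mem_free_component)
  moreover have "i + (j - l) = i + j - l" if "l \<le> j" using that by simp
  ultimately show "if l \<le> i + j then Poly_Mapping.lookup (free_scale c v) (l, t) \<in> G (i + j - l)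
    else Poly_Mapping.lookup (free_scale c v) (l, t) = 0"
    using G_mult[OF assms(1), of "Poly_Mapping.lookup v (l, t)" "j - l"]
    by (auto simp: lookup_free_scale split: if_splits)
qed

lemma free_component_add:
  "v \<in> free_component G r j \<Longrightarrow> w \<in> free_component G r j \<Longrightarrow> v + w \<in> free_component G r j"
proof -
  interpret P: vector_space fscale by (rule vector_space_map_scale)
  show "v \<in> free_component G r j \<Longrightarrow> w \<in> free_component G r j \<Longrightarrow> v + w \<in> free_component G r j"
    using P.subspace_add[OF subspace_free_component] .
qed

lemma free_component_0 [simp]: "0 \<in> free_component G r j"
  by (simp add: mem_free_component)

lemma free_component_sum:
  "(\<And>a. a \<in> A \<Longrightarrow> f a \<in> free_component G r j) \<Longrightarrow> sum f A \<in> free_component G r j"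
  by (induction A rule: infinite_finite_induct)
    (auto intro: free_component_add free_component_0)

lemma linear_extension_free_component:
  assumes "\<forall>l. \<forall>t<r l. d (l, t) \<in> free_component G r' l" "v \<in> free_component G r j"
  shows "linear_extension free_scale d v \<in> free_component G r' j"
  unfolding linear_extension_def
proof (rule free_component_sum)
  fix b assume b: "b \<in> Poly_Mapping.keys v"
  obtain l t where lt: "b = (l, t)" by force
  have "l \<le> j" "t < r l" "Poly_Mapping.lookup v b \<in> G (j - l)"
    using assms(2) b by (auto simp: free_component_def free_module_def lt)
  then show "free_scale (Poly_Mapping.lookup v b) (d b) \<in> free_component G r' j"
    using free_component_free_scale[of "Poly_Mapping.lookup v b" "j - l" "d b" r' l] assms(1)
    by (simp add: lt)
qed

text \<open>
  The component in degree \<open>j\<close>: a basis element \<open>(l, t)\<close> has degree \<open>l\<close>, so its coefficient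
  contributes its part of degree \<open>j - l\<close>.
\<close>

definition free_part :: "nat \<Rightarrow> (nat \<times> nat \<Rightarrow>\<^sub>0 'r) \<Rightarrow> (nat \<times> nat \<Rightarrow>\<^sub>0 'r)" where
  "free_part j = Poly_Mapping.mapp (\<lambda>b x. if fst b \<le> j then hom_part (j - fst b) x else 0)"

lemma lookup_free_part: "Poly_Mapping.lookup (free_part j v) (l, t) =
  (if l \<le> j then hom_part (j - l) (Poly_Mapping.lookup v (l, t)) else 0)"
  unfolding free_part_def by (auto simp: lookup_mapp when_def in_keys_iff)

lemma keys_free_part: "Poly_Mapping.keys (free_part j v) \<subseteq> Poly_Mapping.keys v"
  unfolding free_part_def by (rule keys_mapp_subset)

lemma free_part_in: "v \<in> free_module r \<Longrightarrow> free_part j v \<in> free_component G r j"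
  unfolding mem_free_component using keys_free_part[of j v]
  by (auto simp: free_module_def lookup_free_part)

lemma free_part_id: "v \<in> free_component G r j \<Longrightarrow> free_part j v = v"
proof (rule poly_mapping_eqI)
  fix b :: "nat \<times> nat" assume v: "v \<in> free_component G r j"
  obtain l t where "b = (l, t)" by force
  moreover have "if l \<le> j then Poly_Mapping.lookup v (l, t) \<in> G (j - l) else Poly_Mapping.lookup v (l, t) = 0"
    using v unfolding mem_free_component by blast
  ultimately show "Poly_Mapping.lookup (free_part j v) b = Poly_Mapping.lookup v b"
    by (auto simp: lookup_free_part hom_part_eqI split: if_splits)
qed

text \<open>
  A homogeneous map commutes with taking components. This turns exactness of whole modules into
  exactness in every degree, where dimensions can be counted.
\<close>

lemma free_part_linear_extension:
  assumes "\<forall>l. \<forall>t<r l. d (l, t) \<in> free_component G r' l" "v \<in> free_module r"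
  shows "free_part j (linear_extension free_scale d v) = linear_extension free_scale d (free_part j v)"
proof (rule poly_mapping_eqI)
  fix c :: "nat \<times> nat"
  obtain l t where c: "c = (l, t)" by force
  have step: "(if l \<le> j then hom_part (j - l) (Poly_Mapping.lookup v b * Poly_Mapping.lookup (d b) c) else 0)
     = Poly_Mapping.lookup (free_part j v) b * Poly_Mapping.lookup (d b) c"
    if b: "b \<in> Poly_Mapping.keys v" for b
  proof -
    obtain l' t' where b': "b = (l', t')" by force
    then have "d b \<in> free_component G r' l'"
      using assms b by (auto simp: free_module_def)
    then consider "l \<le> l'" "Poly_Mapping.lookup (d b) c \<in> G (l' - l)" | "Poly_Mapping.lookup (d b) c = 0"
      unfolding mem_free_component c by (metis (full_types))
    then show ?thesis
    proof cases
      case 1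
      then show ?thesis
        using hom_part_mult_hom[OF 1(2), of "j - l" "Poly_Mapping.lookup v b"]
        by (auto simp: lookup_free_part b' mult.commute)
    qed auto
  qed
  have "Poly_Mapping.lookup (free_part j (linear_extension free_scale d v)) c
    = (\<Sum>b\<in>Poly_Mapping.keys v.
      if l \<le> j then hom_part (j - l) (Poly_Mapping.lookup v b * Poly_Mapping.lookup (d b) c) else 0)"
    unfolding c lookup_free_part
    by (auto simp: lookup_linear_extension_free[OF finite_keys subset_refl] hom_part_sum)
  also have "\<dots> = (\<Sum>b\<in>Poly_Mapping.keys v.
      Poly_Mapping.lookup (free_part j v) b * Poly_Mapping.lookup (d b) c)"
    using step by (intro sum.cong) auto
  also have "\<dots> = Poly_Mapping.lookup (linear_extension free_scale d (free_part j v)) c"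
    by (rule lookup_linear_extension_free[symmetric]) (auto simp: keys_free_part)
  finally show "Poly_Mapping.lookup (free_part j (linear_extension free_scale d v)) c
    = Poly_Mapping.lookup (linear_extension free_scale d (free_part j v)) c" .
qed

end

context std_graded_algebra
begin

abbreviation "a_dim j \<equiv> vector_space.dim scale (G j)"

lemma free_component_dim:
  "vector_space.fin_dim fscale (free_component G r j) \<and>
   vector_space.dim fscale (free_component G r j) = (\<Sum>l\<le>j. r l * a_dim (j - l))"
proof -
  have "vector_space.fin_dim fscale (free_component G r j) \<and>
   vector_space.dim fscale (free_component G r j)
     = (\<Sum>b\<in>{(l, t). l \<le> j \<and> t < r l}. local.dim (case b of (l, t) \<Rightarrow> G (j - l)))"
    unfolding free_component_eq_supported[of G, OF zero_in_G]
    by (rule dim_supported) (auto simp: subspace_G fin_dim_G finite_free_index[of j r "\<lambda>_. True", simplified])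
  also have "(\<Sum>b\<in>{(l, t). l \<le> j \<and> t < r l}. local.dim (case b of (l, t) \<Rightarrow> G (j - l)))
    = (\<Sum>l\<le>j. r l * a_dim (j - l))"
    by (subst free_index_sum[symmetric]) (auto intro!: sum.cong)
  finally show ?thesis .
qed

end

lemma tensor_component_dim:
  "vector_space.fin_dim free_scale (tensor_component r j :: (nat \<times> nat \<Rightarrow>\<^sub>0 'k::field) set) \<and>
   vector_space.dim free_scale (tensor_component r j :: (nat \<times> nat \<Rightarrow>\<^sub>0 'k) set) = r j"
proof -
  interpret K: vector_space "(*) :: 'k \<Rightarrow> 'k \<Rightarrow> 'k"
    by standard (auto simp: algebra_simps)
  have UNIV: "UNIV = K.span {1 :: 'k}"
    by (auto simp: K.span_singleton image_iff)
  have fs: "free_scale = (\<lambda>a. Poly_Mapping.map ((*) (a :: 'k)))"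
    by (rule ext) (simp add: free_scale_def)
  have eq: "{(l, t). l = j \<and> t < r l} = Pair j ` {..<r j}" by auto
  have d1: "K.dim UNIV = 1"
    unfolding UNIV by (simp add: K.dim_eq_card_independent)
  have "card {(l, t). l = j \<and> t < r l} = r j"
    unfolding eq by (simp add: card_image inj_on_def)
  then show ?thesis
    unfolding tensor_component_eq_supported fs
    using K.dim_supported[of "{(l, t). l = j \<and> t < r l}" "\<lambda>_. UNIV"] UNIV eq d1
      K.fin_dim_finite_span[of "{1}" UNIV] by auto
qed

lemma subspace_tensor_component:
  "module.subspace free_scale (tensor_component r j :: (nat \<times> nat \<Rightarrow>\<^sub>0 'k::field) set)"
  unfolding module.subspace_def[OF module_free_scale] tensor_component_def
  using keys_add by (fastforce simp: free_module_add free_module_scale in_keys_iff lookup_free_scale lookup_add)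


section \<open>Graded modules and existence of free resolutions\<close>

context vector_space
begin

lemma fin_dim_family_enum:
  fixes K :: "nat \<Rightarrow> 'b set"
  assumes "\<And>j. local.fin_dim (K j)"
  shows "\<exists>r (e :: nat \<times> nat \<Rightarrow> 'b). (\<forall>j. \<forall>t<r j. e (j, t) \<in> K j) \<and>
    (\<forall>j. \<forall>v\<in>K j. \<exists>c. v = (\<Sum>t<r j. scale (c t) (e (j, t))))"
proof -
  have "\<exists>b. (\<forall>t<local.dim (K j). b t \<in> K j) \<and>
    (\<forall>v\<in>K j. \<exists>c. v = (\<Sum>t<local.dim (K j). scale (c t) (b t)))" for j
  proof -
    obtain b where b: "\<forall>i<local.dim (K j). b i \<in> K j" "K j \<subseteq> span (b ` {..<local.dim (K j)})"
      "independent (b ` {..<local.dim (K j)})" "inj_on b {..<local.dim (K j)}"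
      by (rule fin_dim_enum[OF assms[of j]])
    have "\<exists>c. v = (\<Sum>t<local.dim (K j). scale (c t) (b t))" if "v \<in> K j" for v
    proof -
      have "v \<in> span (b ` {..<local.dim (K j)})" using that b(2) by blast
      then obtain u where "v = (\<Sum>w\<in>b ` {..<local.dim (K j)}. scale (u w) w)"
        unfolding span_finite[OF finite_imageI[OF finite_lessThan]] by auto
      then have "v = (\<Sum>t<local.dim (K j). scale (u (b t)) (b t))"
        using b(4) by (simp add: sum.reindex)
      then show ?thesis by (intro exI[of _ "\<lambda>t. u (b t)"])
    qed
    with b(1) show ?thesis by blast
  qed
  then obtain b where b: "\<And>j. (\<forall>t<local.dim (K j). b j t \<in> K j) \<and>
    (\<forall>v\<in>K j. \<exists>c. v = (\<Sum>t<local.dim (K j). scale (c t) (b j t)))"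
    by metis
  show ?thesis
    by (intro exI[of _ "\<lambda>j. local.dim (K j)"] exI[of _ "\<lambda>(j, t). b j t"]) (use b in auto)
qed

end

sublocale graded_algebra \<subseteq> F: vector_space
  "\<lambda>a. Poly_Mapping.map (scale a) :: (nat \<times> nat \<Rightarrow>\<^sub>0 'r) \<Rightarrow> _"
  by (rule vector_space_map_scale)

sublocale graded_algebra \<subseteq> FF: vector_space_pair
  "\<lambda>a. Poly_Mapping.map (scale a) :: (nat \<times> nat \<Rightarrow>\<^sub>0 'r) \<Rightarrow> _"
  "\<lambda>a. Poly_Mapping.map (scale a) :: (nat \<times> nat \<Rightarrow>\<^sub>0 'r) \<Rightarrow> _"
  ..

text \<open>
  Finite-dimensional components make it possible to resolve \<open>M\<close> by free modules that have
  finitely many basis elements in every degree.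
\<close>

locale graded_module = std_graded_algebra scale G
  for scale :: "'k::field \<Rightarrow> 'r::comm_ring_1 \<Rightarrow> 'r" and G :: "nat \<Rightarrow> 'r set" +
  fixes smul :: "'r \<Rightarrow> 'm::ab_group_add \<Rightarrow> 'm" and GM :: "nat \<Rightarrow> 'm set"
  assumes module_smul: "module smul"
    and smul_G: "x \<in> G i \<Longrightarrow> m \<in> GM j \<Longrightarrow> smul x m \<in> GM (i + j)"
    and GM_0: "0 \<in> GM j"
    and GM_add: "m \<in> GM j \<Longrightarrow> m' \<in> GM j \<Longrightarrow> m + m' \<in> GM j"
    and GM_sum: "\<exists>N f. (\<forall>i. f i \<in> GM i) \<and> m = (\<Sum>i\<le>N. f i)"
    and GM_indep: "finite A \<Longrightarrow> (\<And>i. i \<in> A \<Longrightarrow> f i \<in> GM i) \<Longrightarrow> sum f A = 0 \<Longrightarrow> i \<in> A \<Longrightarrow> f i = 0"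
    and GM_finite: "\<exists>B. finite B \<and> GM j \<subseteq> module.span (\<lambda>a. smul (scale a 1)) B"
begin

sublocale S: module smul by (rule module_smul)

lemma vector_space_M: "vector_space (\<lambda>a. smul (scale a 1))"
proof -
  have "scale a 1 * scale b 1 = scale (a * b) (1 :: 'r)" for a b
    by (simp add: scale_1_mult)
  then show ?thesis
    by unfold_locales (auto simp: S.scale_right_distrib S.scale_left_distrib scale_left_distrib)
qed

sublocale M: vector_space "\<lambda>a. smul (scale a 1)" by (rule vector_space_M)

sublocale FM: vector_space_pair "\<lambda>a. Poly_Mapping.map (scale a) :: (nat \<times> nat \<Rightarrow>\<^sub>0 'r) \<Rightarrow> _"
  "\<lambda>a. smul (scale a 1)" ..

lemma subspace_GM: "M.subspace (GM j)"
  unfolding M.subspace_def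
proof (intro conjI ballI allI)
  fix c x assume "x \<in> GM j"
  moreover have "scale c 1 \<in> G 0" by (rule subspace_scale[OF subspace_G one_in_G0])
  ultimately show "smul (scale c 1) x \<in> GM j" using smul_G[of "scale c 1" 0 x j] by simp
qed (auto intro: GM_0 GM_add)

lemma fin_dim_GM: "M.fin_dim (GM j)"
  using GM_finite unfolding M.fin_dim_def by blast

end

context graded_algebra
begin

lemma free_part_sum:
  obtains N where "v = (\<Sum>j\<le>N. free_part j v)"
proof -
  have "\<forall>b. \<exists>N. \<forall>i>N. hom_part i (Poly_Mapping.lookup v b) = 0"
    using hom_part_bound by blast
  then obtain B where B: "\<And>b i. i > B b \<Longrightarrow> hom_part i (Poly_Mapping.lookup v b) = 0"
    by metis
  define N where "N = (\<Sum>b\<in>Poly_Mapping.keys v. fst b + B b)"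
  have "v = (\<Sum>j\<le>N. free_part j v)"
  proof (rule poly_mapping_eqI)
    fix b :: "nat \<times> nat"
    obtain l t where b: "b = (l, t)" by force
    show "Poly_Mapping.lookup v b = Poly_Mapping.lookup (\<Sum>j\<le>N. free_part j v) b"
    proof (cases "b \<in> Poly_Mapping.keys v")
      case True
      then have le: "l + B b \<le> N"
        unfolding N_def using member_le_sum[of b "Poly_Mapping.keys v" "\<lambda>b. fst b + B b"] by (simp add: b)
      have "Poly_Mapping.lookup (\<Sum>j\<le>N. free_part j v) b
        = (\<Sum>j\<le>N. if l \<le> j then hom_part (j - l) (Poly_Mapping.lookup v b) else 0)"
        unfolding b by (simp add: lookup_sum lookup_free_part)
      also have "\<dots> = (\<Sum>j\<in>{l..N}. hom_part (j - l) (Poly_Mapping.lookup v b))"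
        by (rule sum.mono_neutral_cong_right) auto
      also have "\<dots> = (\<Sum>i\<le>N - l. hom_part i (Poly_Mapping.lookup v b))"
        by (rule sum.reindex_bij_witness[of _ "\<lambda>i. i + l" "\<lambda>j. j - l"]) (use le in auto)
      also have "\<dots> = Poly_Mapping.lookup v b"
        by (rule sum_hom_part) (use le B in auto)
      finally show ?thesis by simp
    next
      case False
      then show ?thesis
        unfolding b lookup_sum lookup_free_part in_keys_iff by (simp cong: if_cong)
    qed
  qed
  then show thesis by (rule that)
qed

end

context std_graded_algebra
begin

sublocale FS: module "free_scale :: 'r \<Rightarrow> (nat \<times> nat \<Rightarrow>\<^sub>0 'r) \<Rightarrow> _"
  by (rule module_free_scale)

text \<open>
  A basis of every component of \<open>Z\<close> gives generators. They are far from minimal, but there are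
  finitely many in every degree.
\<close>

lemma cover_by_free_module:
  fixes Z :: "(nat \<times> nat \<Rightarrow>\<^sub>0 'r) set"
  assumes Z: "FS.subspace Z" "Z \<subseteq> free_module r" "\<And>v j. v \<in> Z \<Longrightarrow> free_part j v \<in> Z"
  obtains r' d where "\<forall>j. \<forall>t<r' j. d (j, t) \<in> free_component G r j"
    "linear_extension free_scale d ` free_module r' = Z"
proof -
  let ?K = "\<lambda>j. Z \<inter> free_component G r j"
  have fd: "F.fin_dim (?K j)" for j
    using free_component_dim[of r j] F.fin_dim_subset[OF _ Int_lower2] by blast
  obtain r' :: "nat \<Rightarrow> nat" and d :: "nat \<times> nat \<Rightarrow> (nat \<times> nat \<Rightarrow>\<^sub>0 'r)" where d: "\<forall>j. \<forall>t<r' j. d (j, t) \<in> ?K j"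
    "\<forall>j. \<forall>v\<in>?K j. \<exists>c. v = (\<Sum>t<r' j. Poly_Mapping.map (scale (c t)) (d (j, t)))"
    using F.fin_dim_family_enum[of ?K, OF fd] by (elim exE conjE)
  let ?L = "linear_extension free_scale d"
  have "?L ` free_module r' = Z"
  proof (intro subset_antisym subsetI)
    fix v assume "v \<in> ?L ` free_module r'"
    then obtain y where y: "y \<in> free_module r'" "v = ?L y" by blast
    have "free_scale (Poly_Mapping.lookup y b) (d b) \<in> Z" if "b \<in> Poly_Mapping.keys y" for b
      using that y(1) d(1) unfolding free_module_def by (intro FS.subspace_scale[OF Z(1)]) auto
    then show "v \<in> Z"
      unfolding y(2) linear_extension_def by (intro FS.subspace_sum[OF Z(1)])
  next
    fix v assume v: "v \<in> Z"
    obtain N where N: "v = (\<Sum>j\<le>N. free_part j v)" by (rule free_part_sum)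
    have "\<exists>y\<in>free_module r'. free_part j v = ?L y" for j
    proof -
      have "free_part j v \<in> ?K j"
        using Z(2,3) v free_part_in by blast
      then obtain c where c: "free_part j v = (\<Sum>t<r' j. Poly_Mapping.map (scale (c t)) (d (j, t)))"
        using d(2) by blast
      have "free_part j v = ?L (\<Sum>t<r' j. Poly_Mapping.single (j, t) (scale (c t) 1))"
        unfolding c FS.linear_extension_sum FS.linear_extension_single free_scale_scale_1 ..
      moreover have "(\<Sum>t<r' j. Poly_Mapping.single (j, t) (scale (c t) 1)) \<in> free_module r'"
        by (rule free_module_sum) (auto simp: free_module_def)
      ultimately show ?thesis by blast
    qed
    then obtain y where y: "\<And>j. y j \<in> free_module r'" "\<And>j. free_part j v = ?L (y j)"
      by metis
    have "v = ?L (\<Sum>j\<le>N. y j)"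
      by (subst N) (simp add: FS.linear_extension_sum y(2))
    then show "v \<in> ?L ` free_module r'"
      using free_module_sum[of "{..N}" y] y(1) by blast
  qed
  with d(1) that show thesis by blast
qed

end

context graded_module
begin

lemma augmentation_free_component:
  assumes "\<forall>j. \<forall>t<r j. \<epsilon> (j, t) \<in> GM j" "v \<in> free_component G r j"
  shows "linear_extension smul \<epsilon> v \<in> GM j"
  unfolding linear_extension_def
proof (rule M.subspace_sum[OF subspace_GM])
  fix b assume b: "b \<in> Poly_Mapping.keys v"
  obtain l t where lt: "b = (l, t)" by force
  have *: "l \<le> j" "t < r l" "Poly_Mapping.lookup v b \<in> G (j - l)"
    using assms(2) b by (auto simp: free_component_def free_module_def lt)
  then show "smul (Poly_Mapping.lookup v b) (\<epsilon> b) \<in> GM j"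
    using smul_G[OF *(3), of "\<epsilon> b" l] assms(1) by (simp add: lt)
qed

text \<open>
  The images of the components of \<open>v\<close> lie in different components of \<open>M\<close>, so those of degree
  other than \<open>j\<close> cancel.
\<close>

lemma augmentation_free_part:
  assumes "\<forall>j. \<forall>t<r j. \<epsilon> (j, t) \<in> GM j" "v \<in> free_module r" "linear_extension smul \<epsilon> v \<in> GM j"
  shows "linear_extension smul \<epsilon> (free_part j v) = linear_extension smul \<epsilon> v"
proof -
  let ?L = "linear_extension smul \<epsilon>"
  obtain N where N: "v = (\<Sum>j\<le>N. free_part j v)" by (rule free_part_sum)
  define f where "f i = (if i \<le> N then ?L (free_part i v) else 0) - (if i = j then ?L v else 0)" for i
  have in_GM: "?L (free_part i v) \<in> GM i" for i
    using augmentation_free_component[OF assms(1) free_part_in[OF assms(2)]] .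
  have "?L v = (\<Sum>i\<le>N. ?L (free_part i v))"
    by (subst N) (simp add: S.linear_extension_sum)
  also have "\<dots> = (\<Sum>i\<le>max N j. if i \<le> N then ?L (free_part i v) else 0)"
    by (rule sum.mono_neutral_cong_left) auto
  finally have "(\<Sum>i\<le>max N j. f i) = 0"
    unfolding f_def by (simp add: sum_subtractf sum.delta)
  moreover have "f i \<in> GM i" for i
    unfolding f_def using in_GM assms(3)
    by (intro M.subspace_diff[OF subspace_GM]) (auto simp: GM_0)
  ultimately have fj: "f j = 0"
    using GM_indep[of "{..max N j}" f j] by simp
  show ?thesis
  proof (cases "j \<le> N")
    case True
    then show ?thesis using fj by (simp add: f_def)
  next
    case False
    have *: "free_part j v = 0"
    proof (rule poly_mapping_eqI)
      fix b :: "nat \<times> nat"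
      obtain l t where b: "b = (l, t)" by force
      have "free_part j v = (\<Sum>i\<le>N. free_part j (free_part i v))"
      proof (rule poly_mapping_eqI)
        fix b :: "nat \<times> nat"
        obtain l t where b: "b = (l, t)" by force
        show "Poly_Mapping.lookup (free_part j v) b
          = Poly_Mapping.lookup (\<Sum>i\<le>N. free_part j (free_part i v)) b"
          unfolding b lookup_sum lookup_free_part
          by (subst N) (simp add: lookup_sum hom_part_sum lookup_free_part)
      qed
      moreover have "Poly_Mapping.lookup (free_part j (free_part i v)) b = 0" if "i \<le> N" for i
        using that False unfolding b lookup_free_part
        by (auto simp: hom_part_eqI[OF hom_part_in])
      ultimately show "Poly_Mapping.lookup (free_part j v) b = Poly_Mapping.lookup 0 b"
        by (simp add: lookup_sum)
    qed
    then show ?thesis using fj False by (simp add: f_def)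
  qed
qed

lemma free_resolution_exists: "\<exists>r d \<epsilon>. free_resolution G smul GM r d \<epsilon>"
proof -
  obtain r0 :: "nat \<Rightarrow> nat" and \<epsilon> :: "nat \<times> nat \<Rightarrow> 'm" where e: "\<forall>j. \<forall>t<r0 j. \<epsilon> (j, t) \<in> GM j"
    "\<forall>j. \<forall>v\<in>GM j. \<exists>c. v = (\<Sum>t<r0 j. smul (scale (c t) 1) (\<epsilon> (j, t)))"
    using M.fin_dim_family_enum[of GM, OF fin_dim_GM] by (elim exE conjE)
  let ?E = "linear_extension smul \<epsilon>"
  have surj: "?E ` free_module r0 = UNIV"
  proof (rule subset_antisym[OF subset_UNIV], rule subsetI)
    fix m :: 'm
    obtain N f where f: "\<forall>i. f i \<in> GM i" "m = (\<Sum>i\<le>N. f i)"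
      using GM_sum by blast
    have "\<exists>y\<in>free_module r0. f i = ?E y" for i
    proof -
      obtain c where c: "f i = (\<Sum>t<r0 i. smul (scale (c t) 1) (\<epsilon> (i, t)))"
        using e(2) f(1) by blast
      have "f i = ?E (\<Sum>t<r0 i. Poly_Mapping.single (i, t) (scale (c t) 1))"
        unfolding c S.linear_extension_sum S.linear_extension_single ..
      moreover have "(\<Sum>t<r0 i. Poly_Mapping.single (i, t) (scale (c t) 1)) \<in> free_module r0"
        by (rule free_module_sum) (auto simp: free_module_def)
      ultimately show ?thesis by blast
    qed
    then obtain y where y: "\<And>i. y i \<in> free_module r0" "\<And>i. f i = ?E (y i)"
      by metis
    have "m = ?E (\<Sum>i\<le>N. y i)"
      unfolding f(2) by (simp add: S.linear_extension_sum y(2))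
    then show "m \<in> ?E ` free_module r0"
      using free_module_sum[of "{..N}" y] y(1) by blast
  qed
  define hom where "hom = (\<lambda>(s :: nat \<Rightarrow> nat, s' :: nat \<Rightarrow> nat, d :: nat \<times> nat \<Rightarrow> (nat \<times> nat \<Rightarrow>\<^sub>0 'r)).
    \<forall>j. \<forall>t<s' j. d (j, t) \<in> free_component G s j)"
  define first where "first = (\<lambda>(s :: nat \<Rightarrow> nat, s' :: nat \<Rightarrow> nat, d :: nat \<times> nat \<Rightarrow> (nat \<times> nat \<Rightarrow>\<^sub>0 'r)).
    s = r0 \<and> {v \<in> free_module r0. ?E v = 0} = linear_extension free_scale d ` free_module s')"
  define link where "link = (\<lambda>(s :: nat \<Rightarrow> nat, s' :: nat \<Rightarrow> nat, d :: nat \<times> nat \<Rightarrow> (nat \<times> nat \<Rightarrow>\<^sub>0 'r))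
      (u :: nat \<Rightarrow> nat, u' :: nat \<Rightarrow> nat, d' :: nat \<times> nat \<Rightarrow> (nat \<times> nat \<Rightarrow>\<^sub>0 'r)).
    u = s' \<and> {v \<in> free_module s'. linear_extension free_scale d v = 0}
      = linear_extension free_scale d' ` free_module u')"
  have "\<exists>f. \<forall>n. (hom (f n) \<and> (n = 0 \<longrightarrow> first (f n))) \<and> link (f n) (f (Suc n))"
  proof (rule dependent_nat_choice)
    let ?Z = "{v \<in> free_module r0. ?E v = 0}"
    have "FS.subspace ?Z"
      unfolding FS.subspace_def
      by (auto simp: free_module_add free_module_scale S.linear_extension_add S.linear_extension_free_scale)
    moreover have "free_part j v \<in> ?Z" if "v \<in> ?Z" for v j
      using that augmentation_free_part[OF e(1), of v j] free_part_in[of v r0 j]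
      by (auto simp: GM_0 mem_free_component)
    ultimately obtain r' d where "\<forall>j. \<forall>t<r' j. d (j, t) \<in> free_component G r0 j"
      "linear_extension free_scale d ` free_module r' = ?Z"
      using cover_by_free_module[of ?Z r0] by blast
    then show "\<exists>x. hom x \<and> ((0 :: nat) = 0 \<longrightarrow> first x)"
      by (intro exI[of _ "(r0, r', d)"]) (auto simp: hom_def first_def)
  next
    fix x and n :: nat assume x: "hom x \<and> (n = 0 \<longrightarrow> first x)"
    obtain s s' d where x_eq: "x = (s, s', d)" by (cases x)
    have d: "\<forall>j. \<forall>t<s' j. d (j, t) \<in> free_component G s j"
      using x by (simp add: x_eq hom_def)
    let ?Z = "{v \<in> free_module s'. linear_extension free_scale d v = 0}"
    have "FS.subspace ?Z"
      unfolding FS.subspace_def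
      by (auto simp: free_module_add free_module_scale FS.linear_extension_add FS.linear_extension_free_scale)
    moreover have "free_part j v \<in> ?Z" if "v \<in> ?Z" for v j
    proof -
      have "free_part j (0 :: nat \<times> nat \<Rightarrow>\<^sub>0 'r) = 0"
        by (rule free_part_id[of _ s]) simp
      then show ?thesis
        using that free_part_linear_extension[OF d, of v j] free_part_in[of v s' j]
        by (auto simp: mem_free_component)
    qed
    ultimately obtain r' d' where "\<forall>j. \<forall>t<r' j. d' (j, t) \<in> free_component G s' j"
      "linear_extension free_scale d' ` free_module r' = ?Z"
      using cover_by_free_module[of ?Z s'] by blast
    then show "\<exists>y. (hom y \<and> (Suc n = 0 \<longrightarrow> first y)) \<and> link x y"
      by (intro exI[of _ "(s', r', d')"]) (auto simp: hom_def link_def x_eq)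
  qed
  then obtain f where f: "\<And>n. hom (f n)" "first (f 0)" "\<And>n. link (f n) (f (Suc n))"
    by metis
  define r where "r n = fst (f n)" for n
  define d where "d n = snd (snd (f n))" for n
  have r_Suc: "fst (snd (f n)) = r (Suc n)" for n
    using f(3)[of n] unfolding link_def r_def by (auto simp: case_prod_beta)
  have f_eq: "f n = (r n, r (Suc n), d n)" for n
    unfolding r_def[of n] d_def r_Suc[symmetric] by simp
  have r0: "r 0 = r0"
    using f(2) by (simp add: f_eq first_def)
  have "free_resolution G smul GM r d \<epsilon>"
    unfolding free_resolution_def
  proof (intro conjI allI)
    show "t < r 0 j \<longrightarrow> \<epsilon> (j, t) \<in> GM j" for j t using e(1) r0 by simp
    show "t < r (Suc i) j \<longrightarrow> d i (j, t) \<in> free_component G (r i) j" for i j t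
      using f(1)[of i] by (simp add: f_eq hom_def)
    show "?E ` free_module (r 0) = UNIV" using surj r0 by simp
    show "{v \<in> free_module (r 0). ?E v = 0} = linear_extension free_scale (d 0) ` free_module (r 1)"
      using f(2) by (simp add: f_eq first_def)
    show "{v \<in> free_module (r (Suc i)). linear_extension free_scale (d i) v = 0} =
      linear_extension free_scale (d (Suc i)) ` free_module (r (Suc (Suc i)))" for i
      using f(3)[of i] by (simp add: f_eq link_def)
  qed
  then show ?thesis by blast
qed

end


section \<open>Betti numbers of an arbitrary resolution\<close>

definition betti_series ::
  "('k::field \<Rightarrow> 'r::comm_ring_1 \<Rightarrow> 'r) \<Rightarrow> (nat \<Rightarrow> 'r set) \<Rightarrow>
   ('r \<Rightarrow> 'm::ab_group_add \<Rightarrow> 'm) \<Rightarrow> (nat \<Rightarrow> 'm set) \<Rightarrow> nat \<Rightarrow> int fps" where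
  "betti_series scale G smul GM i = Abs_fps (\<lambda>j. int (betti scale G smul GM i j))"

sublocale std_graded_algebra \<subseteq> T: vector_space "free_scale :: 'k \<Rightarrow> (nat \<times> nat \<Rightarrow>\<^sub>0 'k) \<Rightarrow> _"
  by (rule vector_space_free_scale)

sublocale std_graded_algebra \<subseteq> TT: vector_space_pair
  "free_scale :: 'k \<Rightarrow> (nat \<times> nat \<Rightarrow>\<^sub>0 'k) \<Rightarrow> _" "free_scale :: 'k \<Rightarrow> (nat \<times> nat \<Rightarrow>\<^sub>0 'k) \<Rightarrow> _" ..

sublocale std_graded_algebra \<subseteq> FT: vector_space_pair
  "\<lambda>a. Poly_Mapping.map (scale a) :: (nat \<times> nat \<Rightarrow>\<^sub>0 'r) \<Rightarrow> _"
  "free_scale :: 'k \<Rightarrow> (nat \<times> nat \<Rightarrow>\<^sub>0 'k) \<Rightarrow> _" ..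

context std_graded_algebra
begin

text \<open>The map \<open>F \<rightarrow> k \<otimes> F\<close>.\<close>

definition reduce :: "(nat \<times> nat \<Rightarrow>\<^sub>0 'r) \<Rightarrow> (nat \<times> nat \<Rightarrow>\<^sub>0 'k)" where
  "reduce = Poly_Mapping.map res"

lemma lookup_reduce: "Poly_Mapping.lookup (reduce v) b = res (Poly_Mapping.lookup v b)"
  unfolding reduce_def by (rule lookup_map_zero) simp

lemma linear_reduce: "Vector_Spaces.linear fscale free_scale reduce"
  unfolding Vector_Spaces.linear_iff
  by (intro conjI allI F.vector_space_axioms T.vector_space_axioms poly_mapping_eqI)
    (simp_all add: lookup_reduce lookup_add residue_add lookup_map_zero residue_scale lookup_free_scale)

lemma reduce_linear_extension:
  "reduce (linear_extension free_scale d v) = linear_extension free_scale (\<lambda>b. reduce (d b)) (reduce v)"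
proof (rule poly_mapping_eqI)
  fix c
  have "Poly_Mapping.lookup (linear_extension free_scale (\<lambda>b. reduce (d b)) (reduce v)) c
    = (\<Sum>b\<in>Poly_Mapping.keys v. Poly_Mapping.lookup (reduce v) b * Poly_Mapping.lookup (reduce (d b)) c)"
    by (rule lookup_linear_extension_free) (auto simp: reduce_def intro: subsetD[OF keys_map_subset, rotated])
  then show "Poly_Mapping.lookup (reduce (linear_extension free_scale d v)) c
    = Poly_Mapping.lookup (linear_extension free_scale (\<lambda>b. reduce (d b)) (reduce v)) c"
    by (simp add: lookup_reduce lookup_linear_extension_free[OF finite_keys subset_refl]
      residue_sum residue_mult)
qed

definition lift_const :: "(nat \<times> nat \<Rightarrow>\<^sub>0 'k) \<Rightarrow> (nat \<times> nat \<Rightarrow>\<^sub>0 'r)" where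
  "lift_const = Poly_Mapping.map (\<lambda>a. scale a 1)"

lemma lookup_lift_const: "Poly_Mapping.lookup (lift_const v) b = scale (Poly_Mapping.lookup v b) 1"
  unfolding lift_const_def by (rule lookup_map_zero) simp

lemma reduce_lift_const: "reduce (lift_const v) = v"
  by (rule poly_mapping_eqI) (simp add: lookup_reduce lookup_lift_const residue_scale)

lemma mem_tensor_component:
  "v \<in> tensor_component r j \<longleftrightarrow>
     v \<in> free_module r \<and> (\<forall>l t. l \<noteq> j \<longrightarrow> Poly_Mapping.lookup v (l, t) = 0)"
  unfolding tensor_component_def by (auto simp: in_keys_iff)

lemma reduce_free_module: "v \<in> free_module r \<Longrightarrow> reduce v \<in> free_module r"
  unfolding free_module_def reduce_def using keys_map_subset[of res v] by auto

lemma lift_const_in: "w \<in> tensor_component r j \<Longrightarrow> lift_const w \<in> free_component G r j"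
proof -
  assume w: "w \<in> tensor_component r j"
  have "Poly_Mapping.keys (lift_const w) \<subseteq> Poly_Mapping.keys w"
    unfolding lift_const_def by (rule keys_map_subset) simp
  then have "lift_const w \<in> free_module r"
    using w by (auto simp: tensor_component_def free_module_def)
  moreover have "scale a 1 \<in> G 0" for a
    by (rule subspace_scale[OF subspace_G one_in_G0])
  ultimately show "lift_const w \<in> free_component G r j"
    unfolding mem_free_component using w
    by (auto simp: lookup_lift_const mem_tensor_component) (metis diff_self_eq_0 zero_in_G scale_zero_left)
qed

lemma reduce_free_component: "reduce ` free_component G r j = tensor_component r j"
proof (intro subset_antisym subsetI)
  fix w assume "w \<in> reduce ` free_component G r j"
  then obtain v where v: "v \<in> free_component G r j" "w = reduce v" by blast
  have "res (Poly_Mapping.lookup v (l, t)) = 0" if "l \<noteq> j" for l t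
  proof (cases "l \<le> j")
    case True
    then have "Poly_Mapping.lookup v (l, t) \<in> G (j - l)"
      using v(1) unfolding mem_free_component by presburger
    then show ?thesis using True that by (intro residue_G) auto
  next
    case False
    then have "Poly_Mapping.lookup v (l, t) = 0"
      using v(1) unfolding mem_free_component by presburger
    then show ?thesis by simp
  qed
  then show "w \<in> tensor_component r j"
    using v reduce_free_module by (auto simp: mem_tensor_component mem_free_component lookup_reduce)
next
  fix w :: "nat \<times> nat \<Rightarrow>\<^sub>0 'k" assume "w \<in> tensor_component r j"
  then show "w \<in> reduce ` free_component G r j"
    using lift_const_in reduce_lift_const by (metis imageI)
qed

text \<open>
  Nakayama's lemma in numerical form: modulo a graded submodule \<open>Z\<close>, a graded free module \<open>F\<close> is
  generated by a complement of the image of \<open>Z\<close> in \<open>k \<otimes> F\<close>.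
\<close>

lemma dim_submodule_lower_bound:
  fixes Z :: "nat \<Rightarrow> (nat \<times> nat \<Rightarrow>\<^sub>0 'r) set"
  assumes sub: "\<And>j. Z j \<subseteq> free_component G r j" and subsp: "\<And>j. F.subspace (Z j)"
    and mult: "\<And>i j x v. x \<in> G i \<Longrightarrow> v \<in> Z j \<Longrightarrow> free_scale x v \<in> Z (i + j)"
  shows "(\<Sum>l\<le>j. T.dim (reduce ` Z l) * a_dim (j - l)) \<le> F.dim (Z j)"
proof -
  define \<rho> where "\<rho> l = T.dim (reduce ` Z l)" for l
  let ?u = "\<lambda>l. r l - \<rho> l"
  have redZ: "reduce ` Z l \<subseteq> tensor_component r l" for l
    using sub[of l] reduce_free_component[of r l] by blast
  have redZ_sub: "T.subspace (reduce ` Z l)" for l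
    by (rule FT.linear_subspace_image[OF linear_reduce subsp])
  have fdT: "T.fin_dim (tensor_component r l)" and dT: "T.dim (tensor_component r l) = r l" for l
    using tensor_component_dim by auto
  have rho_le: "\<rho> l \<le> r l" for l
    unfolding \<rho>_def using T.fin_dim_dim_subset[OF fdT redZ[of l]] dT by simp
  have "\<exists>b. (\<forall>t<?u l. b t \<in> tensor_component r l) \<and>
    (\<forall>w\<in>tensor_component r l. \<exists>x\<in>reduce ` Z l. \<exists>c. w = x + (\<Sum>t<?u l. free_scale (c t) (b t)))" for l
  proof -
    obtain b where "\<forall>t<T.dim (tensor_component r l) - T.dim (reduce ` Z l). b t \<in> tensor_component r l"
      "\<forall>w\<in>tensor_component r l. \<exists>x\<in>reduce ` Z l. \<exists>c. w = x +
         (\<Sum>t<T.dim (tensor_component r l) - T.dim (reduce ` Z l). free_scale (c t) (b t))"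
      by (rule T.complement_enum[OF redZ_sub redZ fdT subspace_tensor_component])
    then show ?thesis unfolding dT \<rho>_def by blast
  qed
  then have "\<forall>l. \<exists>b. (\<forall>t<?u l. b t \<in> tensor_component r l) \<and>
    (\<forall>w\<in>tensor_component r l. \<exists>x\<in>reduce ` Z l. \<exists>c. w = x + (\<Sum>t<?u l. free_scale (c t) (b t)))"
    by (rule allI)
  from choice[OF this] obtain b where "\<forall>l. (\<forall>t<?u l. b l t \<in> tensor_component r l) \<and>
    (\<forall>w\<in>tensor_component r l. \<exists>x\<in>reduce ` Z l. \<exists>c. w = x + (\<Sum>t<?u l. free_scale (c t) (b l t)))"
    by (rule exE)
  then have b_in: "\<And>l t. t < ?u l \<Longrightarrow> b l t \<in> tensor_component r l"
    and b: "\<And>w l. w \<in> tensor_component r l \<Longrightarrow>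
      \<exists>x\<in>reduce ` Z l. \<exists>c. w = x + (\<Sum>t<?u l. free_scale (c t) (b l t))"
    by simp_all
  define g where "g = (\<lambda>(l, t). lift_const (b l t))"
  let ?L = "linear_extension free_scale g"
  have g: "\<forall>l. \<forall>t<?u l. g (l, t) \<in> free_component G r l"
    using b_in lift_const_in by (auto simp: g_def)
  define W where "W j = {z + ?L y | z y. z \<in> Z j \<and> y \<in> free_component G ?u j}" for j
  have W_add: "v + w \<in> W j" if "v \<in> W j" "w \<in> W j" for v w j
  proof -
    obtain z y z' y' where *: "v = z + ?L y" "w = z' + ?L y'" "z \<in> Z j" "z' \<in> Z j"
      "y \<in> free_component G ?u j" "y' \<in> free_component G ?u j"
      using \<open>v \<in> W j\<close> \<open>w \<in> W j\<close> unfolding W_def by blast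
    have "v + w = (z + z') + ?L (y + y')"
      unfolding * FS.linear_extension_add by (simp add: algebra_simps)
    then show ?thesis
      unfolding W_def using F.subspace_add[OF subsp *(3,4)] free_component_add[OF *(5,6)] by blast
  qed
  have W_0: "0 \<in> W j" for j
  proof -
    have "0 = 0 + ?L 0" by simp
    then show ?thesis
      unfolding W_def using F.subspace_0[OF subsp[of j]] free_component_0[of ?u j] by blast
  qed
  have W_mult: "free_scale x v \<in> W (i + j)" if "x \<in> G i" "v \<in> W j" for x v i j
  proof -
    obtain z y where *: "v = z + ?L y" "z \<in> Z j" "y \<in> free_component G ?u j"
      using \<open>v \<in> W j\<close> unfolding W_def by blast
    have "free_scale x v = free_scale x z + ?L (free_scale x y)"
      unfolding * FS.linear_extension_free_scale FS.scale_right_distrib ..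
    then show ?thesis
      unfolding W_def
      using mult[OF that(1) *(2)] free_component_free_scale[OF that(1) *(3)] by blast
  qed
  have W_sum: "sum f A \<in> W j" if "\<And>a. a \<in> A \<Longrightarrow> f a \<in> W j" for f and A :: "(nat \<times> nat) set" and j
    using that by (induction A rule: infinite_finite_induct) (auto intro: W_add W_0)
  have all: "v \<in> W j" if "v \<in> free_component G r j" for v j
    using that
  proof (induction j arbitrary: v rule: less_induct)
    case (less j)
    have "reduce v \<in> tensor_component r j"
      using less.prems reduce_free_component by blast
    then obtain z c where z: "z \<in> Z j" "reduce v = reduce z + (\<Sum>t<?u j. free_scale (c t) (b j t))"
      using b by blast
    define y where "y = (\<Sum>t<?u j. Poly_Mapping.single (j, t) (scale (c t) 1))"
    have one: "scale a 1 \<in> G 0" for a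
      by (rule subspace_scale[OF subspace_G one_in_G0])
    have y: "y \<in> free_component G ?u j"
      unfolding y_def
      by (rule free_component_sum)
        (auto simp: mem_free_component free_module_def lookup_single when_def one)
    have "reduce (free_scale (scale (c t) 1) (lift_const (b j t))) = free_scale (c t) (b j t)" for t
      unfolding free_scale_scale_1 FT.linear_scale[OF linear_reduce] reduce_lift_const ..
    then have "reduce (?L y) = (\<Sum>t<?u j. free_scale (c t) (b j t))"
      unfolding y_def FS.linear_extension_sum FS.linear_extension_single FT.linear_sum[OF linear_reduce]
      by (simp add: g_def)
    define v' where "v' = v - (z + ?L y)"
    have Lin: "?L y \<in> free_component G r j"
      by (rule linear_extension_free_component[OF g y])
    have v'_in: "v' \<in> free_component G r j"
      unfolding v'_def
      by (intro F.subspace_diff[OF subspace_free_component] free_component_add less.prems Lin)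
        (use z(1) sub in blast)
    have "reduce v' = 0"
      unfolding v'_def FT.linear_diff[OF linear_reduce] FT.linear_add[OF linear_reduce]
      using z(2) \<open>reduce (?L y) = _\<close> by simp
    have "v' \<in> W j"
    proof -
      have *: "Poly_Mapping.single b' (Poly_Mapping.lookup v' b') \<in> W j"
        if b'_in: "b' \<in> Poly_Mapping.keys v'" for b'
      proof -
        obtain l t where b': "b' = (l, t)" by force
        let ?x = "Poly_Mapping.lookup v' b'"
        have x: "l \<le> j" "t < r l" "?x \<in> G (j - l)"
          using v'_in b'_in by (auto simp: free_component_def free_module_def b')
        have "res ?x = 0"
          using \<open>reduce v' = 0\<close> lookup_reduce[of v' b'] by simp
        then have "l \<noteq> j"
          using x(3) G_0_eq_residue[of ?x] b'_in by (auto simp: in_keys_iff)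
        then have "l < j" using x(1) by simp
        have "Poly_Mapping.single b' 1 \<in> free_component G r l"
          unfolding mem_free_component using x(2)
          by (auto simp: b' free_module_def lookup_single when_def)
        then have "Poly_Mapping.single b' 1 \<in> W l"
          using less.IH[OF \<open>l < j\<close>] by blast
        then have "free_scale ?x (Poly_Mapping.single b' 1) \<in> W (j - l + l)"
          by (rule W_mult[OF x(3)])
        moreover have "free_scale ?x (Poly_Mapping.single b' 1) = Poly_Mapping.single b' ?x"
          by (rule poly_mapping_eqI) (simp add: lookup_free_scale lookup_single when_def)
        ultimately show ?thesis using x(1) by simp
      qed
      have "(\<Sum>b'\<in>Poly_Mapping.keys v'. Poly_Mapping.single b' (Poly_Mapping.lookup v' b')) \<in> W j"
        by (rule W_sum) (rule *)
      then show ?thesis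
        using poly_mapping_sum_single[OF finite_keys subset_refl, of v'] by simp
    qed
    moreover have "z + ?L y \<in> W j"
      unfolding W_def using z(1) y by blast
    ultimately have "v' + (z + ?L y) \<in> W j" by (rule W_add)
    then show ?case by (simp add: v'_def)
  qed
  have linL: "Vector_Spaces.linear fscale fscale ?L"
    unfolding Vector_Spaces.linear_iff
    by (intro conjI F.vector_space_axioms allI FS.linear_extension_add)
      (simp add: free_scale_scale_1[symmetric] FS.linear_extension_free_scale)
  have fdF: "F.fin_dim (free_component G s j)" and dF: "F.dim (free_component G s j) = (\<Sum>l\<le>j. s l * a_dim (j - l))" for s
    using free_component_dim by auto
  have fdZ: "F.fin_dim (Z j)"
    by (rule F.fin_dim_subset[OF fdF sub])
  from FF.dim_sum_image[OF linL subspace_free_component[of ?u j] fdF subsp[of j] fdZ]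
  have "F.dim (W j) \<le> F.dim (Z j) + F.dim (free_component G ?u j)"
    unfolding W_def by linarith
  moreover have "F.dim (free_component G r j) \<le> F.dim (W j)"
  proof (rule F.fin_dim_dim_subset)
    show "free_component G r j \<subseteq> W j" using all by blast
    have "W j \<subseteq> free_component G r j"
      unfolding W_def using sub[of j] linear_extension_free_component[OF g]
      by (auto intro!: free_component_add)
    then show "F.fin_dim (W j)" by (rule F.fin_dim_subset[OF fdF])
  qed
  ultimately have "(\<Sum>l\<le>j. r l * a_dim (j - l)) \<le> F.dim (Z j) + (\<Sum>l\<le>j. (r l - \<rho> l) * a_dim (j - l))"
    unfolding dF by linarith
  moreover have "(\<Sum>l\<le>j. r l * a_dim (j - l))
      = (\<Sum>l\<le>j. (r l - \<rho> l) * a_dim (j - l)) + (\<Sum>l\<le>j. \<rho> l * a_dim (j - l))"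
    unfolding sum.distrib[symmetric] using rho_le
    by (intro sum.cong) (auto simp: add_mult_distrib[symmetric])
  ultimately show ?thesis unfolding \<rho>_def by linarith
qed

end

locale resolution = graded_module scale G smul GM
  for scale :: "'k::field \<Rightarrow> 'r::comm_ring_1 \<Rightarrow> 'r" and G :: "nat \<Rightarrow> 'r set"
    and smul :: "'r \<Rightarrow> 'm::ab_group_add \<Rightarrow> 'm" and GM :: "nat \<Rightarrow> 'm set" +
  fixes r :: "nat \<Rightarrow> nat \<Rightarrow> nat" and d :: "nat \<Rightarrow> nat \<times> nat \<Rightarrow> (nat \<times> nat \<Rightarrow>\<^sub>0 'r)"
    and \<epsilon> :: "nat \<times> nat \<Rightarrow> 'm"
  assumes free_resolution: "free_resolution G smul GM r d \<epsilon>"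
begin

abbreviation "D i \<equiv> linear_extension free_scale (d i)"
abbreviation "E \<equiv> linear_extension smul \<epsilon>"

lemma \<epsilon>_in: "\<forall>j. \<forall>t<r 0 j. \<epsilon> (j, t) \<in> GM j"
  using free_resolution by (simp add: free_resolution_def)

lemma d_in: "\<forall>j. \<forall>t<r (Suc i) j. d i (j, t) \<in> free_component G (r i) j"
  using free_resolution by (simp add: free_resolution_def)

lemma E_surj: "E ` free_module (r 0) = UNIV"
  using free_resolution by (simp add: free_resolution_def)

text \<open>The kernel of the map that leaves \<open>F\<^sub>i\<close>; it is the syzygy module of index \<open>i + 1\<close>.\<close>

definition cyc :: "nat \<Rightarrow> (nat \<times> nat \<Rightarrow>\<^sub>0 'r) set" where
  "cyc i = {v \<in> free_module (r i). case i of 0 \<Rightarrow> E v = 0 | Suc i' \<Rightarrow> D i' v = 0}"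

lemma cyc_eq_image: "cyc i = D i ` free_module (r (Suc i))"
  using free_resolution unfolding cyc_def free_resolution_def by (cases i) auto

definition Z :: "nat \<Rightarrow> nat \<Rightarrow> (nat \<times> nat \<Rightarrow>\<^sub>0 'r) set" where
  "Z i j = cyc i \<inter> free_component G (r i) j"

lemma D_in: "v \<in> free_component G (r (Suc i)) j \<Longrightarrow> D i v \<in> free_component G (r i) j"
  by (rule linear_extension_free_component[OF d_in])

lemma Z_eq_image: "Z i j = D i ` free_component G (r (Suc i)) j"
proof (intro subset_antisym subsetI)
  fix v assume "v \<in> Z i j"
  then have v: "v \<in> cyc i" "v \<in> free_component G (r i) j" by (auto simp: Z_def)
  then obtain y where y: "y \<in> free_module (r (Suc i))" "v = D i y"
    unfolding cyc_eq_image by blast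
  have "v = free_part j (D i y)" using v(2) y(2) by (simp add: free_part_id)
  also have "\<dots> = D i (free_part j y)"
    by (rule free_part_linear_extension[OF d_in y(1)])
  finally show "v \<in> D i ` free_component G (r (Suc i)) j"
    using free_part_in[OF y(1)] by blast
next
  fix v assume "v \<in> D i ` free_component G (r (Suc i)) j"
  then show "v \<in> Z i j"
    unfolding Z_def cyc_eq_image using D_in free_component_subset by blast
qed

lemma GM_eq_image: "GM j = E ` free_component G (r 0) j"
proof (intro subset_antisym subsetI)
  fix m assume m: "m \<in> GM j"
  obtain y where y: "y \<in> free_module (r 0)" "m = E y"
    using E_surj by (metis UNIV_I imageE)
  then have "m = E (free_part j y)"
    using augmentation_free_part[OF \<epsilon>_in y(1)] m by simp
  then show "m \<in> E ` free_component G (r 0) j"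
    using free_part_in[OF y(1)] by blast
next
  fix m assume "m \<in> E ` free_component G (r 0) j"
  then show "m \<in> GM j" using augmentation_free_component[OF \<epsilon>_in] by blast
qed

lemma linear_D: "Vector_Spaces.linear fscale fscale (D i)"
  unfolding Vector_Spaces.linear_iff
  by (intro conjI F.vector_space_axioms allI FS.linear_extension_add)
    (simp add: free_scale_scale_1[symmetric] FS.linear_extension_free_scale)

lemma linear_E: "Vector_Spaces.linear fscale (\<lambda>a. smul (scale a 1)) E"
  unfolding Vector_Spaces.linear_iff
  by (intro conjI F.vector_space_axioms M.vector_space_axioms allI S.linear_extension_add)
    (simp add: free_scale_scale_1[symmetric] S.linear_extension_free_scale)

lemma subspace_Z: "F.subspace (Z i j)"
  unfolding Z_eq_image by (rule FF.linear_subspace_image[OF linear_D subspace_free_component])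

lemma Z_sub: "Z i j \<subseteq> free_component G (r i) j"
  by (simp add: Z_def)

lemma Z_mult:
  assumes "x \<in> G i'" "v \<in> Z i j"
  shows "free_scale x v \<in> Z i (i' + j)"
proof -
  obtain y where "y \<in> free_component G (r (Suc i)) j" "v = D i y"
    using assms(2) unfolding Z_eq_image by blast
  then show ?thesis
    unfolding Z_eq_image using free_component_free_scale[OF assms(1)]
    by (metis FS.linear_extension_free_scale imageI)
qed

definition rho :: "nat \<Rightarrow> nat \<Rightarrow> nat" where "rho i j = T.dim (reduce ` Z i j)"

lemma rho_bound: "(\<Sum>l\<le>j. rho i l * a_dim (j - l)) \<le> F.dim (Z i j)"
  unfolding rho_def by (rule dim_submodule_lower_bound[OF Z_sub subspace_Z Z_mult])

lemma fd_free: "F.fin_dim (free_component G s j)"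
  using free_component_dim by auto

lemma dim_Z_0: "M.dim (GM j) + F.dim (Z 0 j) = (\<Sum>l\<le>j. r 0 l * a_dim (j - l))"
proof -
  have "{v \<in> free_component G (r 0) j. E v = 0} = Z 0 j"
    unfolding Z_def cyc_def using free_component_subset by auto
  then show ?thesis
    using FM.rank_nullity[OF linear_E subspace_free_component fd_free, of "r 0" j] free_component_dim
    unfolding GM_eq_image[of j] by simp
qed

lemma dim_Z_Suc: "F.dim (Z i j) + F.dim (Z (Suc i) j) = (\<Sum>l\<le>j. r (Suc i) l * a_dim (j - l))"
proof -
  have "{v \<in> free_component G (r (Suc i)) j. D i v = 0} = Z (Suc i) j"
    unfolding Z_def cyc_def using free_component_subset by auto
  then show ?thesis
    using FF.rank_nullity[OF linear_D subspace_free_component fd_free, of i "r (Suc i)" j] free_component_dim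
    unfolding Z_eq_image[of i j] by simp
qed

abbreviation "tD i \<equiv> tensor_differential scale G (d i)"

lemma reduce_D: "reduce (D i v) = tD i (reduce v)"
  using reduce_linear_extension[of "d i" v] unfolding tensor_differential_def by (simp add: reduce_def)

lemma linear_tD: "Vector_Spaces.linear free_scale free_scale (tD i)"
  unfolding Vector_Spaces.linear_iff tensor_differential_def
  by (intro conjI T.vector_space_axioms allI module.linear_extension_add[OF module_free_scale]
    module.linear_extension_free_scale[OF module_free_scale])

text \<open>
  Both the boundaries and the rank of the differential of \<open>k \<otimes> F\<close> are read off from the images
  of the syzygies in \<open>k \<otimes> F\<close>.
\<close>

lemma tor_boundaries_eq: "tor_boundaries scale G r d i j = reduce ` Z i j"
  unfolding tor_boundaries_def reduce_free_component[symmetric] Z_eq_image image_image reduce_D ..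

lemma tD_tensor_component: "tD i ` tensor_component (r (Suc i)) j = reduce ` Z i j"
  using tor_boundaries_eq unfolding tor_boundaries_def .

lemma tor_boundaries_sub_cycles: "tor_boundaries scale G r d i j \<subseteq> tor_cycles scale G r d i j"
proof
  fix w assume "w \<in> tor_boundaries scale G r d i j"
  then obtain v where v: "v \<in> Z i j" "w = reduce v"
    unfolding tor_boundaries_eq by blast
  have "w \<in> tensor_component (r i) j"
    using v Z_sub reduce_free_component by blast
  moreover have "tD i' w = 0" if "i = Suc i'" for i'
  proof -
    have "D i' v = 0" using v(1) that by (simp add: Z_def cyc_def)
    then show ?thesis
      unfolding v(2) reduce_D[symmetric] using FT.linear_0[OF linear_reduce] by simp
  qed
  ultimately show "w \<in> tor_cycles scale G r d i j"
    by (cases i) (auto simp: tor_cycles_def)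
qed

lemma fd_cycles: "T.fin_dim (tor_cycles scale G r d i j)"
proof (rule T.fin_dim_subset)
  show "T.fin_dim (tensor_component (r i) j)" using tensor_component_dim by blast
  show "tor_cycles scale G r d i j \<subseteq> tensor_component (r i) j"
    by (auto simp: tor_cycles_def split: nat.splits)
qed

definition tor_dim :: "nat \<Rightarrow> nat \<Rightarrow> nat" where
  "tor_dim i j = T.dim (tor_cycles scale G r d i j) - T.dim (tor_boundaries scale G r d i j)"

lemma tor_dim_add: "tor_dim i j + rho i j = T.dim (tor_cycles scale G r d i j)"
  unfolding tor_dim_def rho_def tor_boundaries_eq[symmetric]
  using T.fin_dim_dim_subset[OF fd_cycles tor_boundaries_sub_cycles] by simp

lemma tor_dim_0: "tor_dim 0 j + rho 0 j = r 0 j"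
  unfolding tor_dim_add using tensor_component_dim by (auto simp: tor_cycles_def)

lemma tor_dim_Suc: "tor_dim (Suc i) j + rho (Suc i) j + rho i j = r (Suc i) j"
proof -
  have "T.fin_dim (tensor_component (r (Suc i)) j :: (nat \<times> nat \<Rightarrow>\<^sub>0 'k) set)"
    using tensor_component_dim by blast
  from TT.rank_nullity[OF linear_tD subspace_tensor_component this, of i]
  show ?thesis
    unfolding tor_dim_add tD_tensor_component rho_def[symmetric]
    using tensor_component_dim[of "r (Suc i)" j, where 'k = 'k]
    by (simp add: tor_cycles_def)
qed

text \<open>
  The excess of the dimension of the syzygies over the lower bound given by \<open>k \<otimes> F\<close>. It is the
  Hilbert series of the kernel of a minimal cover of the syzygy module of index \<open>i\<close>.
\<close>

definition excess :: "nat \<Rightarrow> int fps" where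
  "excess i = Abs_fps (\<lambda>j. int (F.dim (Z i j))) - Abs_fps (\<lambda>j. int (rho i j)) * hilbert_series scale G"

lemma conv_nth: "fps_nth (Abs_fps (\<lambda>j. int (f j)) * hilbert_series scale G) j
    = int (\<Sum>l\<le>j. f l * a_dim (j - l))"
  unfolding hilbert_series_def fps_mult_nth by (simp add: atMost_atLeast0)

lemma excess_nonneg: "0 \<le> fps_nth (excess i) j"
  unfolding excess_def fps_sub_nth conv_nth using rho_bound[of i j]
  by (simp del: of_nat_sum of_nat_mult)

lemma excess_0: "excess 0 = Abs_fps (\<lambda>j. int (tor_dim 0 j)) * hilbert_series scale G
    - Abs_fps (\<lambda>j. int (M.dim (GM j)))"
proof (rule fps_ext)
  fix j
  have "(\<Sum>l\<le>j. r 0 l * a_dim (j - l))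
      = (\<Sum>l\<le>j. tor_dim 0 l * a_dim (j - l)) + (\<Sum>l\<le>j. rho 0 l * a_dim (j - l))"
    unfolding tor_dim_0[symmetric] by (simp add: sum.distrib distrib_right)
  then have "int (M.dim (GM j)) + int (F.dim (Z 0 j))
    = int (\<Sum>l\<le>j. tor_dim 0 l * a_dim (j - l)) + int (\<Sum>l\<le>j. rho 0 l * a_dim (j - l))"
    using dim_Z_0[of j] by linarith
  then show "fps_nth (excess 0) j = fps_nth (Abs_fps (\<lambda>j. int (tor_dim 0 j)) * hilbert_series scale G
    - Abs_fps (\<lambda>j. int (M.dim (GM j)))) j"
    unfolding excess_def fps_sub_nth conv_nth by (simp del: of_nat_sum of_nat_mult)
qed

lemma excess_Suc: "excess (Suc i) + excess i
  = Abs_fps (\<lambda>j. int (tor_dim (Suc i) j)) * hilbert_series scale G"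
proof (rule fps_ext)
  fix j
  have "(\<Sum>l\<le>j. r (Suc i) l * a_dim (j - l)) = (\<Sum>l\<le>j. tor_dim (Suc i) l * a_dim (j - l))
      + (\<Sum>l\<le>j. rho (Suc i) l * a_dim (j - l)) + (\<Sum>l\<le>j. rho i l * a_dim (j - l))"
    unfolding tor_dim_Suc[symmetric] by (simp add: sum.distrib distrib_right)
  then have "int (F.dim (Z i j)) + int (F.dim (Z (Suc i) j))
    = int (\<Sum>l\<le>j. tor_dim (Suc i) l * a_dim (j - l))
      + int (\<Sum>l\<le>j. rho (Suc i) l * a_dim (j - l)) + int (\<Sum>l\<le>j. rho i l * a_dim (j - l))"
    using dim_Z_Suc[of i j] by linarith
  then show "fps_nth (excess (Suc i) + excess i) j
    = fps_nth (Abs_fps (\<lambda>j. int (tor_dim (Suc i) j)) * hilbert_series scale G) j"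
    unfolding excess_def fps_add_nth fps_sub_nth conv_nth by (simp del: of_nat_sum of_nat_mult)
qed

end

context graded_module
begin

text \<open>
  The resolution that is chosen in the definition of the Betti numbers is only known to exist;
  all that is said about them below holds for every resolution.
\<close>

lemma betti_resolution:
  obtains r d \<epsilon> where "resolution scale G smul GM r d \<epsilon>"
    "\<forall>i j. betti scale G smul GM i j = resolution.tor_dim scale G r d i j"
proof -
  let ?P = "\<lambda>(r, d). \<exists>\<epsilon>. free_resolution G smul GM r d \<epsilon>"
  obtain r d where rd: "(SOME (r, d). \<exists>\<epsilon>. free_resolution G smul GM r d \<epsilon>) = (r, d)"
    by force
  have "\<exists>x. ?P x" using free_resolution_exists by auto
  from someI_ex[OF this] obtain \<epsilon> where e: "free_resolution G smul GM r d \<epsilon>"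
    unfolding rd by auto
  have res: "resolution scale G smul GM r d \<epsilon>"
    by (intro resolution.intro graded_module_axioms resolution_axioms.intro e)
  have "\<forall>i j. betti scale G smul GM i j = resolution.tor_dim scale G r d i j"
    unfolding betti_def rd resolution.tor_dim_def[OF res] by simp
  with res show thesis by (rule that)
qed

text \<open>
  By the two recurrences the Hilbert series of \<open>M\<close> is the alternating sum of the \<open>H \<beta>\<^sub>i\<close> up to
  a remainder \<open>\<plusminus> e\<^sub>i\<close>. As the \<open>e\<^sub>i\<close> are nonnegative, two successive ones vanish wherever
  \<open>H \<beta>\<^bsub>i+1\<^esub>\<close> does, which makes the alternating sum converge.
\<close>

lemma betti_excess:
  obtains e where "\<And>i j. 0 \<le> fps_nth (e i) j"
    "e 0 = betti_series scale G smul GM 0 * hilbert_series scale G - Abs_fps (\<lambda>j. int (M.dim (GM j)))"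
    "\<And>i. e (Suc i) + e i = betti_series scale G smul GM (Suc i) * hilbert_series scale G"
proof -
  obtain r d \<epsilon> where res: "resolution scale G smul GM r d \<epsilon>"
    and b: "\<forall>i j. betti scale G smul GM i j = resolution.tor_dim scale G r d i j"
    by (rule betti_resolution)
  interpret R: resolution scale G smul GM r d \<epsilon> by (rule res)
  show thesis
    by (rule that[of R.excess])
      (simp_all add: R.excess_nonneg R.excess_0 R.excess_Suc betti_series_def b)
qed

end


section \<open>Koszul algebras\<close>

context std_graded_algebra
begin

lemma residue_smul_scale_1: "residue_smul scale G (scale a 1) b = a * b"
  by (simp add: residue_smul_def residue_scale)

lemma graded_module_residue: "graded_module scale G (residue_smul scale G) residue_grading"
proof
  show "residue_smul scale G x (y + z) = residue_smul scale G x y + residue_smul scale G x z" for x y z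
    by (simp add: residue_smul_def distrib_left)
  show "residue_smul scale G (x + x') y = residue_smul scale G x y + residue_smul scale G x' y" for x x' y
    by (simp add: residue_smul_def residue_add distrib_right)
  show "residue_smul scale G x (residue_smul scale G x' y) = residue_smul scale G (x * x') y" for x x' y
    by (simp add: residue_smul_def residue_mult)
  show "residue_smul scale G 1 y = y" for y
    by (simp add: residue_smul_def)
  show "residue_smul scale G x m \<in> residue_grading (i + j)" if "x \<in> G i" "m \<in> residue_grading j" for x m i j
    using that residue_G[of x i] by (auto simp: residue_grading_def residue_smul_def split: if_splits)
  show "0 \<in> residue_grading j" for j
    by (simp add: residue_grading_def)
  show "m + m' \<in> residue_grading j" if "m \<in> residue_grading j" "m' \<in> residue_grading j" for m m' j
    using that by (auto simp: residue_grading_def split: if_splits)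
  show "\<exists>N f. (\<forall>i. f i \<in> residue_grading i) \<and> m = (\<Sum>i\<le>N. f i)" for m :: 'k
    by (intro exI[of _ 0] exI[of _ "\<lambda>i. if i = 0 then m else 0"]) (auto simp: residue_grading_def)
  show "f i = 0" if A: "finite A" "\<And>i. i \<in> A \<Longrightarrow> f i \<in> residue_grading i" "sum f A = 0" "i \<in> A"
    for A :: "nat set" and f :: "nat \<Rightarrow> 'k" and i
  proof -
    have nz: "f l = 0" if "l \<in> A" "l \<noteq> 0" for l
      using A(2)[OF that(1)] that(2) by (simp add: residue_grading_def)
    show ?thesis
    proof (cases "i = 0")
      case True
      have "sum f A = f 0 + sum f (A - {0})"
        using A(1,4) True by (simp add: sum.remove)
      also have "sum f (A - {0}) = 0"
        using nz by (intro sum.neutral) auto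
      finally show ?thesis using A(3) True by simp
    qed (use nz A(4) in blast)
  qed
  show "\<exists>B. finite B \<and> residue_grading j \<subseteq> module.span (\<lambda>a. residue_smul scale G (scale a 1)) B" for j
  proof -
    have eq: "(\<lambda>a. residue_smul scale G (scale a 1)) = (*)"
      by (intro ext) (simp add: residue_smul_scale_1)
    have "a \<in> module.span (*) {1 :: 'k}" for a
      using module.span_scale[OF module_mult, of 1 "{1}" a] module.span_base[OF module_mult, of 1 "{1 :: 'k}"]
      by simp
    then show ?thesis unfolding eq by (intro exI[of _ "{1}"]) auto
  qed
qed

lemma residue_grading_dim:
  "vector_space.dim (\<lambda>a. residue_smul scale G (scale a 1)) (residue_grading j) = (if j = 0 then 1 else 0)"
proof -
  interpret K: vector_space "(*) :: 'k \<Rightarrow> 'k \<Rightarrow> 'k"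
    by standard (auto simp: algebra_simps)
  have eq: "(\<lambda>a. residue_smul scale G (scale a 1)) = (*)"
    by (intro ext) (simp add: residue_smul_scale_1)
  have UNIV_eq: "UNIV = K.span {1 :: 'k}"
    by (auto simp: K.span_singleton image_iff)
  have "K.dim UNIV = 1" unfolding UNIV_eq by (simp add: K.dim_eq_card_independent)
  moreover have "K.dim {0} = 0" using K.dim_le_card[of "{0}" "{}"] by simp
  ultimately show ?thesis unfolding eq by (simp add: residue_grading_def)
qed

definition diagonal_betti :: "nat \<Rightarrow> nat" where
  "diagonal_betti i = betti scale G (residue_smul scale G) residue_grading i i"

text \<open>
  For a Koszul algebra the remainder \<open>e\<^sub>i\<close> starts in degree \<open>i + 1\<close>, so the alternating sum
  of the \<open>H \<beta>\<^sub>i\<close> converges to the Hilbert series of \<open>k\<close>.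
\<close>

lemma koszul_hilbert_series:
  assumes "koszul scale G"
  shows "Abs_fps (\<lambda>i. (-1) ^ i * int (diagonal_betti i)) * hilbert_series scale G = 1"
proof -
  interpret K: graded_module scale G "residue_smul scale G" residue_grading
    by (rule graded_module_residue)
  let ?H = "hilbert_series scale G"
  let ?\<beta> = "betti_series scale G (residue_smul scale G) residue_grading"
  obtain e where e: "\<And>i j. 0 \<le> fps_nth (e i) j"
    "e 0 = ?\<beta> 0 * ?H - Abs_fps (\<lambda>j. int (K.M.dim (residue_grading j)))"
    "\<And>i. e (Suc i) + e i = ?\<beta> (Suc i) * ?H"
    using K.betti_excess by metis
  have "Abs_fps (\<lambda>j. int (K.M.dim (residue_grading j))) = (1 :: int fps)"
    by (rule fps_ext) (simp add: residue_grading_dim)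
  with e(2) have e0: "e 0 = ?\<beta> 0 * ?H - 1" by simp
  have \<beta>: "?\<beta> i = fps_const (int (diagonal_betti i)) * fps_X ^ i" for i
    using assms unfolding koszul_def betti_series_def diagonal_betti_def
    by (intro fps_ext) (auto simp: fps_X_power_nth)
  have \<beta>H: "fps_nth (?\<beta> i * ?H) j = (if j < i then 0 else int (diagonal_betti i) * fps_nth ?H (j - i))" for i j
    unfolding \<beta> by (simp add: mult.assoc fps_X_power_mult_nth)
  have vanish: "fps_nth (e i) j = 0" if "j \<le> i" for i j
    using arg_cong[OF e(3)[of i], of "\<lambda>f. fps_nth f j"] e(1)[of i j] e(1)[of "Suc i" j] \<beta>H[of "Suc i" j] that
    by simp
  have partial: "(\<Sum>i\<le>N. fps_const ((-1) ^ i) * (?\<beta> i * ?H)) = 1 + fps_const ((-1) ^ N) * e N" for N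
  proof (induction N)
    case 0
    then show ?case by (simp add: e0)
  next
    case (Suc N)
    have neg: "fps_const ((-1) ^ Suc N) = - fps_const ((-1 :: int) ^ N)"
      by simp
    have "(\<Sum>i\<le>Suc N. fps_const ((-1) ^ i) * (?\<beta> i * ?H))
      = 1 + fps_const ((-1) ^ N) * e N - fps_const ((-1) ^ N) * (e (Suc N) + e N)"
      unfolding sum.atMost_Suc Suc e(3) neg by (simp only: minus_mult_left[symmetric] diff_conv_add_uminus)
    also have "\<dots> = 1 + fps_const ((-1) ^ Suc N) * e (Suc N)"
      unfolding neg by (simp only: distrib_left minus_mult_left[symmetric] diff_conv_add_uminus minus_add_distrib add.assoc) (simp only: add.commute add.left_commute minus_add_cancel add_minus_cancel)
    finally show ?case .
  qed
  show ?thesis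
  proof (rule fps_ext)
    fix j
    have "fps_nth (Abs_fps (\<lambda>i. (-1) ^ i * int (diagonal_betti i)) * ?H) j
      = (\<Sum>i\<le>j. (-1) ^ i * int (diagonal_betti i) * fps_nth ?H (j - i))"
      by (simp add: fps_mult_nth atMost_atLeast0)
    also have "\<dots> = (\<Sum>i\<le>j. (-1) ^ i * fps_nth (?\<beta> i * ?H) j)"
      by (intro sum.cong) (auto simp: \<beta>H)
    also have "\<dots> = fps_nth (\<Sum>i\<le>j. fps_const ((-1) ^ i) * (?\<beta> i * ?H)) j"
      by (simp add: fps_sum_nth del: fps_const_power)
    also have "\<dots> = fps_nth (1 + fps_const ((-1) ^ j) * e j) j"
      unfolding partial ..
    also have "\<dots> = fps_nth 1 j"
      using vanish[of j j] by (simp del: fps_const_power)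
    finally show "fps_nth (Abs_fps (\<lambda>i. (-1) ^ i * int (diagonal_betti i)) * ?H) j = fps_nth 1 j" .
  qed
qed

text \<open>
  Compare an arbitrary resolution \<open>F\<close> of \<open>k\<close> with the start \<open>A \<leftarrow> A\<^sup>n\<close> of a minimal one, in both
  directions. Modulo the irrelevant ideal times syzygies, a syzygy of the generators \<open>var i\<close> is
  the image of some \<open>y \<in> F\<^sub>2\<close> that gives a cycle of \<open>k \<otimes> F\<close>. The degree of \<open>g\<close> as a
  syzygy is \<open>k + 2 \<ge> 3\<close>, where \<open>Tor\<^sub>2\<close> vanishes; so \<open>y\<close> is a boundary up to the irrelevant
  ideal times \<open>F\<^sub>2\<close>, and \<open>g\<close> is a combination of syzygies of lower degree.
\<close>

lemma koszul_syzygies: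
  assumes koszul: "koszul scale G"
    and g: "\<And>i. g i \<in> G (Suc k)" "(\<Sum>i<edim. var i * g i) = 0" and k: "k \<ge> 1"
  obtains \<tau> where "\<forall>l i. \<tau> l i \<in> G k" "\<forall>l. (\<Sum>i<edim. var i * \<tau> l i) = 0"
    "\<forall>i<edim. g i = (\<Sum>l<edim. var l * \<tau> l i)"
proof -
  interpret K: graded_module scale G "residue_smul scale G" residue_grading
    by (rule graded_module_residue)
  obtain r d \<epsilon> where res: "resolution scale G (residue_smul scale G) residue_grading r d \<epsilon>"
    and b: "\<forall>i j. betti scale G (residue_smul scale G) residue_grading i j
      = resolution.tor_dim scale G r d i j"
    by (rule K.betti_resolution)
  interpret R: resolution scale G "residue_smul scale G" residue_grading r d \<epsilon> by (rule res)
  let ?n = edim and ?deg = "Suc (Suc k)"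
  \<comment> \<open>the comparison maps from \<open>F\<close>\<close>
  define \<phi>0 where "\<phi>0 = linear_extension (*) (\<lambda>b. scale (\<epsilon> b) (1 :: 'r))"
  have \<phi>0_add: "\<phi>0 (v + w) = \<phi>0 v + \<phi>0 w" for v w
    unfolding \<phi>0_def by (rule module.linear_extension_add[OF module_mult])
  have \<phi>0_scale: "\<phi>0 (free_scale x v) = x * \<phi>0 v" for x v
    unfolding \<phi>0_def by (rule module.linear_extension_free_scale[OF module_mult])
  have \<phi>0_sum: "\<phi>0 (sum f A) = (\<Sum>a\<in>A. \<phi>0 (f a))" for f and A :: "(nat \<times> nat) set"
    unfolding \<phi>0_def by (rule module.linear_extension_sum[OF module_mult])
  have \<phi>0_0: "\<phi>0 0 = 0" unfolding \<phi>0_def by (rule module.linear_extension_0[OF module_mult])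
  have res_\<phi>0: "res (\<phi>0 v) = R.E v" for v
    unfolding \<phi>0_def linear_extension_def
    by (simp add: residue_sum residue_mult residue_scale residue_smul_def)
  have D_single: "R.D i (Poly_Mapping.single b 1) = d i b" for i b
    unfolding FS.linear_extension_single by simp
  have E_D: "R.E (R.D 0 v) = 0" if "v \<in> free_module (r 1)" for v
    using R.cyc_eq_image[of 0] that by (auto simp: R.cyc_def)
  have D_D: "R.D 0 (R.D 1 v) = 0" if "v \<in> free_module (r 2)" for v
    using R.cyc_eq_image[of 1] that by (auto simp: R.cyc_def numeral_2_eq_2)
  have single_in: "Poly_Mapping.single (l, t) 1 \<in> free_module (r i)" if "t < r i l" for i l t
    using that by (simp add: free_module_def)
  have "\<exists>a. t < r 1 l \<longrightarrow> \<phi>0 (d 0 (l, t)) = (\<Sum>i<?n. var i * a i)" for l t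
  proof (cases "t < r 1 l")
    case True
    have "res (\<phi>0 (d 0 (l, t))) = 0"
      unfolding res_\<phi>0 using E_D[OF single_in[OF True]] D_single by simp
    then show ?thesis using irrelevant_eq_var_combination by metis
  qed simp
  then have "\<forall>b. \<exists>a. snd b < r 1 (fst b) \<longrightarrow> \<phi>0 (d 0 b) = (\<Sum>i<?n. var i * a i)"
    by auto
  from choice[OF this] obtain a where
    a: "\<forall>b. snd b < r 1 (fst b) \<longrightarrow> \<phi>0 (d 0 b) = (\<Sum>i<?n. var i * a b i)"
    by (rule exE)
  define \<phi>1 where "\<phi>1 v i = linear_extension (*) (\<lambda>b. a b i) v" for v i
  have \<phi>1_add: "\<phi>1 (v + w) i = \<phi>1 v i + \<phi>1 w i" for v w i
    unfolding \<phi>1_def by (rule module.linear_extension_add[OF module_mult])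
  have \<phi>1_scale: "\<phi>1 (free_scale x v) i = x * \<phi>1 v i" for x v i
    unfolding \<phi>1_def by (rule module.linear_extension_free_scale[OF module_mult])
  have \<phi>1_sum: "\<phi>1 (sum f A) i = (\<Sum>a\<in>A. \<phi>1 (f a) i)" for f and A :: "'z set" and i
    unfolding \<phi>1_def by (rule module.linear_extension_sum[OF module_mult])
  have \<phi>1_\<phi>0: "(\<Sum>i<?n. var i * \<phi>1 v i) = \<phi>0 (R.D 0 v)" if v: "v \<in> free_module (r 1)" for v
  proof -
    have "(\<Sum>i<?n. var i * \<phi>1 v i)
      = (\<Sum>b\<in>Poly_Mapping.keys v. Poly_Mapping.lookup v b * (\<Sum>i<?n. var i * a b i))"
      unfolding \<phi>1_def linear_extension_def sum_distrib_left
      by (subst sum.swap) (intro sum.cong refl, simp only: mult.left_commute)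
    also have "\<dots> = (\<Sum>b\<in>Poly_Mapping.keys v. Poly_Mapping.lookup v b * \<phi>0 (d 0 b))"
      using v a by (intro sum.cong) (auto simp: free_module_def)
    also have "\<dots> = \<phi>0 (R.D 0 v)"
      by (simp add: linear_extension_def[of free_scale] \<phi>0_sum \<phi>0_scale)
    finally show ?thesis .
  qed
  \<comment> \<open>the comparison maps to \<open>F\<close>\<close>
  obtain u where u: "u \<in> free_component G (r 0) 0" "R.E u = 1"
    using R.GM_eq_image[of 0] by (auto simp: residue_grading_def) (metis UNIV_I imageE)
  have "\<exists>v. i < ?n \<longrightarrow> v \<in> free_component G (r 1) 1 \<and> R.D 0 v = free_scale (var i) u" for i
  proof (cases "i < ?n")
    case True
    have "free_scale (var i) u \<in> free_component G (r 0) 1"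
      using free_component_free_scale[OF var_in_G1[OF True] u(1)] by simp
    moreover have "R.E (free_scale (var i) u) = 0"
      unfolding K.S.linear_extension_free_scale u(2)
      using residue_G[OF var_in_G1[OF True]] by (simp add: residue_smul_def)
    ultimately have "free_scale (var i) u \<in> R.Z 0 1"
      unfolding R.Z_def R.cyc_def using free_component_subset by auto
    then show ?thesis unfolding R.Z_eq_image by auto
  qed simp
  then have "\<forall>i. \<exists>v. i < ?n \<longrightarrow> v \<in> free_component G (r 1) 1 \<and> R.D 0 v = free_scale (var i) u"
    by (rule allI)
  from choice[OF this] obtain v where
    v: "\<forall>i. i < ?n \<longrightarrow> v i \<in> free_component G (r 1) 1 \<and> R.D 0 (v i) = free_scale (var i) u"
    by (rule exE)
  \<comment> \<open>the homotopy\<close>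
  have "res (\<phi>0 u - 1) = 0"
    by (simp add: residue_diff res_\<phi>0 u(2))
  then obtain c where c: "\<phi>0 u - 1 = (\<Sum>i<?n. var i * c i)"
    by (rule irrelevant_eq_var_combination)
  define t where "t s i = \<phi>1 (v s) i - (if s = i then 1 else 0) - var s * c i" for s i
  have t: "(\<Sum>i<?n. var i * t s i) = 0" if s: "s < ?n" for s
  proof -
    have vs: "v s \<in> free_module (r 1)" using v s free_component_subset by blast
    have "(\<Sum>i<?n. var i * t s i)
      = (\<Sum>i<?n. var i * \<phi>1 (v s) i) - (\<Sum>i<?n. if s = i then var i else 0) - var s * (\<Sum>i<?n. var i * c i)"
    proof -
      have "var i * t s i = var i * \<phi>1 (v s) i - (if s = i then var i else 0) - var s * (var i * c i)" for i
        unfolding t_def by (cases "s = i") (simp_all add: right_diff_distrib mult.left_commute)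
      then show ?thesis
        unfolding sum_distrib_left by (simp only: sum_subtractf)
    qed
    also have "\<dots> = var s * \<phi>0 u - var s - var s * (\<phi>0 u - 1)"
      unfolding \<phi>1_\<phi>0[OF vs] c[symmetric] using v s \<phi>0_scale by (simp add: sum.delta)
    finally show ?thesis by (simp add: algebra_simps)
  qed
  \<comment> \<open>the image of the syzygy \<open>g\<close> in \<open>F\<^sub>1\<close>\<close>
  define w where "w = (\<Sum>s<?n. free_scale (g s) (v s))"
  have w_in: "w \<in> free_component G (r 1) ?deg"
    unfolding w_def
  proof (rule free_component_sum)
    fix s assume "s \<in> {..<?n}"
    then show "free_scale (g s) (v s) \<in> free_component G (r 1) ?deg"
      using free_component_free_scale[OF g(1)[of s], of "v s" "r 1" 1] v by simp
  qed
  have "R.D 0 w = (\<Sum>s<?n. free_scale (g s) (free_scale (var s) u))"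
    unfolding w_def FS.linear_extension_sum FS.linear_extension_free_scale
    using v by (intro sum.cong) auto
  also have "\<dots> = free_scale (\<Sum>s<?n. var s * g s) u"
    by (simp add: FS.scale_sum_left mult.commute)
  finally have "R.D 0 w = 0" by (simp add: g(2))
  then have "w \<in> R.Z 1 ?deg"
    unfolding R.Z_def R.cyc_def using w_in free_component_subset by auto
  then obtain y where y: "y \<in> free_component G (r 2) ?deg" "w = R.D 1 y"
    unfolding R.Z_eq_image by (auto simp: numeral_2_eq_2)
  have res_g: "res (g s) = 0" for s using residue_G[OF g(1)] by simp
  have "reduce w = 0"
  proof (rule poly_mapping_eqI)
    fix b
    show "Poly_Mapping.lookup (reduce w) b = Poly_Mapping.lookup 0 b"
      unfolding lookup_reduce w_def lookup_sum residue_sum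
      by (simp add: lookup_free_scale residue_mult res_g)
  qed
  then have "reduce y \<in> tor_cycles scale G r d 2 ?deg"
    using reduce_free_component[of "r 2" ?deg] y R.reduce_D[of 1 y]
    by (auto simp: tor_cycles_def numeral_2_eq_2)
  moreover have "tor_boundaries scale G r d 2 ?deg = tor_cycles scale G r d 2 ?deg"
  proof (rule T.fin_dim_subspace_eq)
    show "T.subspace (tor_boundaries scale G r d 2 ?deg)"
      unfolding R.tor_boundaries_eq by (rule FT.linear_subspace_image[OF linear_reduce R.subspace_Z])
    have "R.tor_dim 2 ?deg = 0"
      using koszul b k unfolding koszul_def by simp
    then show "T.dim (tor_cycles scale G r d 2 ?deg) \<le> T.dim (tor_boundaries scale G r d 2 ?deg)"
      unfolding R.tor_dim_def by simp
  qed (rule R.tor_boundaries_sub_cycles R.fd_cycles)+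
  ultimately obtain z where z: "z \<in> R.Z 2 ?deg" "reduce y = reduce z"
    unfolding R.tor_boundaries_eq by blast
  have Dz: "R.D 1 z = 0"
    using z(1) by (simp add: R.Z_def R.cyc_def numeral_2_eq_2)
  define y' where "y' = y - z"
  have y'_in: "y' \<in> free_module (r 2)"
    unfolding y'_def using F.subspace_diff[OF subspace_free_component y(1), of z] z(1) R.Z_sub
      free_component_subset by blast
  have w_y': "w = R.D 1 y'"
    unfolding y'_def FS.linear_extension_diff Dz y(2) by simp
  have "reduce y' = 0"
    unfolding y'_def FT.linear_diff[OF linear_reduce] z(2) by simp
  then have res_y': "res (Poly_Mapping.lookup y' b) = 0" for b
    using lookup_reduce[of y' b] by simp
  have "\<forall>b. \<exists>q. Poly_Mapping.lookup y' b = (\<Sum>l<?n. var l * q l)"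
    using irrelevant_eq_var_combination[OF res_y'] by metis
  from choice[OF this] obtain q where q: "\<forall>b. Poly_Mapping.lookup y' b = (\<Sum>l<?n. var l * q b l)"
    by (rule exE)
  define \<sigma> where "\<sigma> l i = (\<Sum>b\<in>Poly_Mapping.keys y'. q b l * \<phi>1 (d 1 b) i)" for l i
  have w_\<sigma>: "\<phi>1 w i = (\<Sum>l<?n. var l * \<sigma> l i)" for i
  proof -
    have "\<phi>1 w i = (\<Sum>b\<in>Poly_Mapping.keys y'. Poly_Mapping.lookup y' b * \<phi>1 (d 1 b) i)"
      unfolding w_y' by (simp add: linear_extension_def[of free_scale] \<phi>1_sum \<phi>1_scale)
    also have "\<dots> = (\<Sum>b\<in>Poly_Mapping.keys y'. \<Sum>l<?n. var l * (q b l * \<phi>1 (d 1 b) i))"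
      by (intro sum.cong refl, subst q[rule_format]) (simp only: sum_distrib_right mult.assoc)
    also have "\<dots> = (\<Sum>l<?n. var l * \<sigma> l i)"
      unfolding \<sigma>_def sum_distrib_left by (rule sum.swap)
    finally show ?thesis .
  qed
  have \<sigma>: "(\<Sum>i<?n. var i * \<sigma> l i) = 0" for l
  proof -
    have *: "(\<Sum>i<?n. var i * \<phi>1 (d 1 b) i) = 0" if b: "b \<in> Poly_Mapping.keys y'" for b
    proof -
      obtain l' t' where b': "b = (l', t')" by force
      have lt: "t' < r 2 l'" using y'_in b by (auto simp: free_module_def b')
      have "d 1 b \<in> free_module (r 1)"
        unfolding b' using R.d_in[of 1] lt
        by (intro subsetD[OF free_component_subset[of G "r 1" l']]) (simp add: numeral_2_eq_2)
      then have "(\<Sum>i<?n. var i * \<phi>1 (d 1 b) i) = \<phi>0 (R.D 0 (d 1 b))"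
        by (rule \<phi>1_\<phi>0)
      also have "R.D 0 (d 1 b) = 0"
        using D_D[OF single_in[OF lt]] unfolding D_single b' .
      finally show ?thesis by (simp add: \<phi>0_0)
    qed
    have "(\<Sum>i<?n. var i * \<sigma> l i)
      = (\<Sum>b\<in>Poly_Mapping.keys y'. q b l * (\<Sum>i<?n. var i * \<phi>1 (d 1 b) i))"
      unfolding \<sigma>_def sum_distrib_left by (subst sum.swap) (intro sum.cong refl, simp only: mult.left_commute)
    then show ?thesis using * by simp
  qed
  have "\<forall>s. \<exists>p. g s = (\<Sum>l<?n. var l * p l)"
    using irrelevant_eq_var_combination[OF res_g] by metis
  from choice[OF this] obtain p where p: "\<forall>s. g s = (\<Sum>l<?n. var l * p s l)"
    by (rule exE)
  define \<tau>' where "\<tau>' l i = \<sigma> l i - (\<Sum>s<?n. p s l * t s i)" for l i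
  have g_\<tau>': "g i = (\<Sum>l<?n. var l * \<tau>' l i)" if i: "i < ?n" for i
  proof -
    have "\<phi>1 w i = (\<Sum>s<?n. g s * \<phi>1 (v s) i)"
      unfolding w_def by (simp add: \<phi>1_sum \<phi>1_scale)
    also have "\<dots> = (\<Sum>s<?n. g s * t s i) + (\<Sum>s<?n. if s = i then g s else 0)
        + (\<Sum>s<?n. var s * g s) * c i"
    proof -
      have eq: "x * y = x * (y - e - z * u) + (if b then x else 0) + z * x * u"
        if "e = (if b then 1 else 0)" for x y z u e :: 'r and b
        unfolding that by (cases b) (simp_all add: algebra_simps)
      have "(\<Sum>s<?n. g s * \<phi>1 (v s) i)
        = (\<Sum>s<?n. g s * t s i + (if s = i then g s else 0) + var s * g s * c i)"
        unfolding t_def by (rule sum.cong[OF refl], rule eq, rule refl)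
      then show ?thesis
        by (simp only: sum.distrib sum_distrib_right)
    qed
    also have "\<dots> = (\<Sum>s<?n. g s * t s i) + g i"
      using i by (simp add: g(2) sum.delta)
    finally have "g i = \<phi>1 w i - (\<Sum>s<?n. g s * t s i)" by simp
    also have "(\<Sum>s<?n. g s * t s i) = (\<Sum>s<?n. \<Sum>l<?n. var l * (p s l * t s i))"
    proof (rule sum.cong)
      fix s
      show "g s * t s i = (\<Sum>l<?n. var l * (p s l * t s i))"
        by (subst p[rule_format]) (simp only: sum_distrib_right mult.assoc)
    qed simp
    also have "\<dots> = (\<Sum>l<?n. \<Sum>s<?n. var l * (p s l * t s i))"
      by (rule sum.swap)
    finally show ?thesis
      unfolding w_\<sigma> \<tau>'_def by (simp add: right_diff_distrib sum_subtractf sum_distrib_left)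
  qed
  have \<tau>': "(\<Sum>i<?n. var i * \<tau>' l i) = 0" for l
  proof -
    have "(\<Sum>i<?n. var i * (\<Sum>s<?n. p s l * t s i)) = (\<Sum>s<?n. p s l * (\<Sum>i<?n. var i * t s i))"
      unfolding sum_distrib_left by (subst sum.swap) (intro sum.cong refl, simp only: mult.left_commute)
    also have "\<dots> = 0" using t by simp
    finally show ?thesis
      unfolding \<tau>'_def by (simp add: right_diff_distrib sum_subtractf \<sigma>)
  qed
  show thesis
  proof (rule that[of "\<lambda>l i. hom_part k (\<tau>' l i)"])
    have shift: "hom_part (Suc k) (\<Sum>i<?n. var i * f i) = (\<Sum>i<?n. var i * hom_part k (f i))" for f
      unfolding hom_part_sum by (intro sum.cong) (auto simp: hom_part_mult_hom[OF var_in_G1])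
    show "\<forall>l. (\<Sum>i<?n. var i * hom_part k (\<tau>' l i)) = 0"
      unfolding shift[symmetric] \<tau>' by simp
    show "\<forall>i<?n. g i = (\<Sum>l<?n. var l * hom_part k (\<tau>' l i))"
    proof (intro allI impI)
      fix i assume i: "i < ?n"
      have "hom_part (Suc k) (g i) = g i" using hom_part_eqI[OF g(1), of "Suc k"] by simp
      then show "g i = (\<Sum>l<?n. var l * hom_part k (\<tau>' l i))"
        unfolding shift[symmetric] g_\<tau>'[OF i, symmetric] by (rule sym)
    qed
  qed simp
qed

end


section \<open>Polynomials of fixed degree\<close>

definition mdeg :: "(nat \<Rightarrow>\<^sub>0 nat) \<Rightarrow> nat" where
  "mdeg m = (\<Sum>i\<in>Poly_Mapping.keys m. Poly_Mapping.lookup m i)"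

definition monomials :: "nat \<Rightarrow> nat \<Rightarrow> (nat \<Rightarrow>\<^sub>0 nat) set" where
  "monomials n j = {m. Poly_Mapping.keys m \<subseteq> {..<n} \<and> mdeg m = j}"

definition hpoly :: "nat \<Rightarrow> nat \<Rightarrow> 'k::field mpoly set" where
  "hpoly n j = {p. Poly_Mapping.keys p \<subseteq> monomials n j}"

lemma mdeg_superset: "finite A \<Longrightarrow> Poly_Mapping.keys m \<subseteq> A \<Longrightarrow> mdeg m = (\<Sum>i\<in>A. Poly_Mapping.lookup m i)"
  unfolding mdeg_def by (rule sum.mono_neutral_left) (auto simp: in_keys_iff)

lemma keys_add_nat:
  "Poly_Mapping.keys (m + m') = Poly_Mapping.keys m \<union> Poly_Mapping.keys (m' :: 'a \<Rightarrow>\<^sub>0 nat)"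
  by (auto simp: in_keys_iff lookup_add)

lemma mdeg_add: "mdeg (m + m') = mdeg m + mdeg m'"
proof -
  let ?A = "Poly_Mapping.keys m \<union> Poly_Mapping.keys m'"
  have "mdeg x = (\<Sum>i\<in>?A. Poly_Mapping.lookup x i)" if "x = m \<or> x = m' \<or> x = m + m'" for x
    using that by (intro mdeg_superset) (auto simp: keys_add_nat)
  then show ?thesis by (simp add: lookup_add sum.distrib)
qed

lemma mdeg_0 [simp]: "mdeg 0 = 0" by (simp add: mdeg_def)

lemma mdeg_single [simp]: "mdeg (Poly_Mapping.single i k) = k"
  by (simp add: mdeg_def)

lemma mdeg_eq_0: "mdeg m = 0 \<longleftrightarrow> m = 0"
proof
  assume "mdeg m = 0"
  then have "Poly_Mapping.lookup m i = 0" for i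
    unfolding mdeg_def by (cases "i \<in> Poly_Mapping.keys m") (auto simp: in_keys_iff)
  then show "m = 0" by (intro poly_mapping_eqI) simp
qed simp

lemma monomials_add: "m \<in> monomials n i \<Longrightarrow> m' \<in> monomials n j \<Longrightarrow> m + m' \<in> monomials n (i + j)"
  unfolding monomials_def by (auto simp: mdeg_add keys_add_nat)

lemma monomials_0_degree: "monomials n 0 = {0}"
  unfolding monomials_def by (auto simp: mdeg_eq_0)

lemma monomial_split:
  assumes "Poly_Mapping.lookup (m :: nat \<Rightarrow>\<^sub>0 nat) i > 0"
  obtains m' where "m = Poly_Mapping.single i 1 + m'"
proof -
  have "m = Poly_Mapping.single i 1 + (m - Poly_Mapping.single i 1)"
    by (rule poly_mapping_eqI) (use assms in \<open>auto simp: lookup_add lookup_minus lookup_single when_def\<close>)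
  then show thesis by (rule that)
qed

lemma monomials_Suc_Suc:
  "monomials (Suc n) (Suc j) = monomials n (Suc j) \<union> (+) (Poly_Mapping.single n 1) ` monomials (Suc n) j"
  "monomials n (Suc j) \<inter> (+) (Poly_Mapping.single n 1) ` monomials (Suc n) j = {}"
proof -
  show "monomials (Suc n) (Suc j) = monomials n (Suc j) \<union> (+) (Poly_Mapping.single n 1) ` monomials (Suc n) j"
  proof (intro subset_antisym subsetI)
    fix m assume m: "m \<in> monomials (Suc n) (Suc j)"
    show "m \<in> monomials n (Suc j) \<union> (+) (Poly_Mapping.single n 1) ` monomials (Suc n) j"
    proof (cases "Poly_Mapping.lookup m n = 0")
      case True
      then have "n \<notin> Poly_Mapping.keys m" by (simp add: in_keys_iff)
      then have "Poly_Mapping.keys m \<subseteq> {..<n}"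
        using m unfolding monomials_def by (auto simp: less_Suc_eq)
      then show ?thesis using m by (auto simp: monomials_def)
    next
      case False
      then obtain m' where m': "m = Poly_Mapping.single n 1 + m'"
        using monomial_split[of m n] by auto
      then have "m' \<in> monomials (Suc n) j"
        using m unfolding monomials_def by (auto simp: mdeg_add keys_add_nat)
      then show ?thesis using m' by blast
    qed
  next
    fix m assume "m \<in> monomials n (Suc j) \<union> (+) (Poly_Mapping.single n 1) ` monomials (Suc n) j"
    then show "m \<in> monomials (Suc n) (Suc j)"
      unfolding monomials_def by (auto simp: mdeg_add keys_add_nat)
  qed
  show "monomials n (Suc j) \<inter> (+) (Poly_Mapping.single n 1) ` monomials (Suc n) j = {}"
    unfolding monomials_def by (auto simp: keys_add_nat)
qed

lemma finite_monomials: "finite (monomials n j)"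
proof (induction n arbitrary: j)
  case 0
  have "monomials 0 j \<subseteq> {0}" by (auto simp: monomials_def)
  then show ?case by (rule finite_subset) simp
next
  case (Suc n)
  note IH = this
  show ?case
  proof (induction j)
    case 0
    then show ?case by (simp add: monomials_0_degree)
  next
    case (Suc j)
    then show ?case unfolding monomials_Suc_Suc using IH by simp
  qed
qed

lemma card_monomials_Suc:
  "card (monomials (Suc n) (Suc j)) = card (monomials n (Suc j)) + card (monomials (Suc n) j)"
  unfolding monomials_Suc_Suc
  by (subst card_Un_disjoint)
    (simp_all add: finite_monomials monomials_Suc_Suc(2)[unfolded One_nat_def] card_image)

definition monomial_series :: "nat \<Rightarrow> int fps" where
  "monomial_series n = Abs_fps (\<lambda>j. int (card (monomials n j)))"

lemma monomial_series: "monomial_series n * (1 - fps_X) ^ n = 1"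
proof (induction n)
  case 0
  have "monomials 0 j = (if j = 0 then {0} else {})" for j
    by (auto simp: monomials_def mdeg_eq_0)
  then have "monomial_series 0 = 1"
    unfolding monomial_series_def by (intro fps_ext) simp
  then show ?case by simp
next
  case (Suc n)
  have "monomial_series (Suc n) * (1 - fps_X) = monomial_series n"
  proof (rule fps_ext)
    fix j
    show "fps_nth (monomial_series (Suc n) * (1 - fps_X)) j = fps_nth (monomial_series n) j"
    proof (cases j)
      case 0
      then show ?thesis by (simp add: monomial_series_def monomials_0_degree)
    next
      case (Suc i)
      show ?thesis
        unfolding Suc monomial_series_def
        by (simp add: right_diff_distrib fps_X_mult_right_nth card_monomials_Suc)
    qed
  qed
  then show ?case
    using Suc.IH by (simp add: mult.assoc[symmetric])
qed

lemma hpoly_eq_supported: "hpoly n j = supported (monomials n j) (\<lambda>_. UNIV)"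
  by (auto simp: hpoly_def supported_def)

global_interpretation P: vector_space "free_scale :: 'k::field \<Rightarrow> 'k mpoly \<Rightarrow> 'k mpoly"
  by (rule vector_space_free_scale)

global_interpretation PP: vector_space_pair "free_scale :: 'k::field \<Rightarrow> 'k mpoly \<Rightarrow> 'k mpoly"
  "free_scale :: 'k::field \<Rightarrow> 'k mpoly \<Rightarrow> 'k mpoly" ..

lemma free_scale_eq_mult: "free_scale c p = Poly_Mapping.single 0 c * (p :: 'k::field mpoly)"
  unfolding free_scale_def by (rule mult_map_scale_conv_mult)

lemma hpoly_dim:
  "P.fin_dim (hpoly n j :: 'k::field mpoly set) \<and> P.dim (hpoly n j :: 'k mpoly set) = card (monomials n j)"
proof -
  interpret K: vector_space "(*) :: 'k \<Rightarrow> 'k \<Rightarrow> 'k"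
    by standard (auto simp: algebra_simps)
  have UNIV_eq: "UNIV = K.span {1 :: 'k}"
    by (auto simp: K.span_singleton image_iff)
  have fs: "free_scale = (\<lambda>a. Poly_Mapping.map ((*) (a :: 'k)))"
    by (rule ext) (simp add: free_scale_def)
  have d1: "K.dim UNIV = 1"
    unfolding UNIV_eq by (simp add: K.dim_eq_card_independent)
  show ?thesis
    unfolding hpoly_eq_supported fs
    using K.dim_supported[of "monomials n j" "\<lambda>_. UNIV"] finite_monomials d1
      K.fin_dim_finite_span[of "{1}" UNIV] UNIV_eq by simp
qed

lemma subspace_hpoly: "P.subspace (hpoly n j)"
  unfolding P.subspace_def hpoly_def
  by (auto simp: free_scale_def dest: subsetD[OF keys_add] subsetD[OF keys_map_subset, rotated])

lemma hpoly_0 [simp]: "0 \<in> hpoly n j"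
  by (simp add: hpoly_def)

lemma hpoly_add: "p \<in> hpoly n j \<Longrightarrow> q \<in> hpoly n j \<Longrightarrow> p + q \<in> hpoly n j"
  by (rule P.subspace_add[OF subspace_hpoly])

lemma hpoly_diff: "p \<in> hpoly n j \<Longrightarrow> q \<in> hpoly n j \<Longrightarrow> p - q \<in> hpoly n j"
  by (rule P.subspace_diff[OF subspace_hpoly])

lemma hpoly_sum: "(\<And>a. a \<in> A \<Longrightarrow> f a \<in> hpoly n j) \<Longrightarrow> sum f A \<in> hpoly n j"
  by (rule P.subspace_sum[OF subspace_hpoly])

lemma hpoly_mult: "p \<in> hpoly n i \<Longrightarrow> q \<in> hpoly n j \<Longrightarrow> p * q \<in> hpoly n (i + j)"
  unfolding hpoly_def using keys_mult[of p q] monomials_add by blast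

lemma hpoly_single: "m \<in> monomials n j \<Longrightarrow> Poly_Mapping.single m c \<in> hpoly n j"
  by (auto simp: hpoly_def)

lemma hpoly_0_degree: "p \<in> hpoly n 0 \<Longrightarrow> p = Poly_Mapping.single 0 (Poly_Mapping.lookup p 0)"
  by (rule poly_mapping_eqI)
    (auto simp: hpoly_def monomials_0_degree lookup_single when_def in_keys_iff)

definition X :: "nat \<Rightarrow> 'k::field mpoly" where
  "X i = Poly_Mapping.single (Poly_Mapping.single i 1) 1"

lemma X_in: "i < n \<Longrightarrow> X i \<in> hpoly n 1"
  unfolding X_def by (rule hpoly_single) (simp add: monomials_def)

text \<open>
  Every monomial of \<open>p\<close> is assigned to one variable that divides it.
\<close>

lemma hpoly_Suc_split:
  fixes p :: "'k::field mpoly"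
  assumes "p \<in> hpoly n (Suc j)"
  obtains g where "\<forall>i. g i \<in> hpoly n j" "p = (\<Sum>i<n. X i * g i)"
proof -
  have "\<exists>i m'. m \<in> Poly_Mapping.keys p \<longrightarrow>
      i < n \<and> m = Poly_Mapping.single i 1 + m' \<and> m' \<in> monomials n j" for m
  proof (cases "m \<in> Poly_Mapping.keys p")
    case True
    then have m: "m \<in> monomials n (Suc j)" using assms by (auto simp: hpoly_def)
    then have "m \<noteq> 0" by (auto simp: monomials_def)
    then obtain i where i: "i \<in> Poly_Mapping.keys m"
      by (metis all_not_in_conv keys_eq_empty)
    then obtain m' where m': "m = Poly_Mapping.single i 1 + m'"
      using monomial_split[of m i] by (auto simp: in_keys_iff)
    have "i < n" using m i by (auto simp: monomials_def)
    moreover have "m' \<in> monomials n j"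
      using m unfolding m' monomials_def by (auto simp: mdeg_add keys_add_nat)
    ultimately show ?thesis using m' by blast
  qed auto
  then have "\<forall>m. \<exists>z. m \<in> Poly_Mapping.keys p \<longrightarrow>
      fst z < n \<and> m = Poly_Mapping.single (fst z) 1 + snd z \<and> snd z \<in> monomials n j"
    by simp
  from choice[OF this] obtain z where z: "\<forall>m. m \<in> Poly_Mapping.keys p \<longrightarrow>
      fst (z m) < n \<and> m = Poly_Mapping.single (fst (z m)) 1 + snd (z m) \<and> snd (z m) \<in> monomials n j"
    by (rule exE)
  let ?c = "Poly_Mapping.lookup p"
  define g where "g i = (\<Sum>m\<in>{m \<in> Poly_Mapping.keys p. fst (z m) = i}.
    Poly_Mapping.single (snd (z m)) (?c m))" for i
  have "\<forall>i. g i \<in> hpoly n j"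
    unfolding g_def using z by (auto intro!: hpoly_sum hpoly_single)
  moreover have "p = (\<Sum>i<n. X i * g i)"
  proof -
    have "(\<Sum>i<n. X i * g i) = (\<Sum>i<n. \<Sum>m\<in>{m \<in> Poly_Mapping.keys p. fst (z m) = i}. Poly_Mapping.single m (?c m))"
    proof (rule sum.cong[OF refl])
      fix i
      show "X i * g i = (\<Sum>m\<in>{m \<in> Poly_Mapping.keys p. fst (z m) = i}. Poly_Mapping.single m (?c m))"
        unfolding g_def sum_distrib_left
      proof (rule sum.cong[OF refl])
        fix m assume "m \<in> {m \<in> Poly_Mapping.keys p. fst (z m) = i}"
        then have "m = Poly_Mapping.single i 1 + snd (z m)" using z by auto
        then show "X i * Poly_Mapping.single (snd (z m)) (?c m) = Poly_Mapping.single m (?c m)"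
          unfolding X_def mult_single by simp
      qed
    qed
    also have "\<dots> = (\<Sum>m\<in>Poly_Mapping.keys p. Poly_Mapping.single m (?c m))"
      by (rule sum.group) (use z in auto)
    also have "\<dots> = p" by (rule poly_mapping_sum_single[symmetric]) auto
    finally show ?thesis by simp
  qed
  ultimately show thesis by (rule that)
qed


section \<open>Evaluation of polynomials\<close>

definition mon_eval :: "(nat \<Rightarrow> 'q::comm_ring_1) \<Rightarrow> (nat \<Rightarrow>\<^sub>0 nat) \<Rightarrow> 'q" where
  "mon_eval x m = (\<Prod>i\<in>Poly_Mapping.keys m. x i ^ Poly_Mapping.lookup m i)"

lemma mon_eval_superset:
  "finite A \<Longrightarrow> Poly_Mapping.keys m \<subseteq> A \<Longrightarrow> mon_eval x m = (\<Prod>i\<in>A. x i ^ Poly_Mapping.lookup m i)"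
  unfolding mon_eval_def by (rule prod.mono_neutral_left) (auto simp: in_keys_iff)

lemma mon_eval_add: "mon_eval x (m + m') = mon_eval x m * mon_eval x m'"
proof -
  let ?A = "Poly_Mapping.keys m \<union> Poly_Mapping.keys m'"
  have "mon_eval x y = (\<Prod>i\<in>?A. x i ^ Poly_Mapping.lookup y i)" if "y = m \<or> y = m' \<or> y = m + m'" for y
    using that by (intro mon_eval_superset) (auto simp: keys_add_nat)
  then show ?thesis by (simp add: lookup_add prod.distrib power_add)
qed

lemma mon_eval_0 [simp]: "mon_eval x 0 = 1" by (simp add: mon_eval_def)

lemma mon_eval_single_1 [simp]: "mon_eval x (Poly_Mapping.single i (Suc 0)) = x i"
  by (simp add: mon_eval_def)

lemma mpoly_eval_eq: "mpoly_eval scale x = linear_extension scale (mon_eval x)"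
  unfolding mpoly_eval_def linear_extension_def mon_eval_def by (rule ext) simp

context graded_algebra
begin

lemma eval_add: "mpoly_eval scale x (p + q) = mpoly_eval scale x p + mpoly_eval scale x q"
proof -
  let ?A = "Poly_Mapping.keys p \<union> Poly_Mapping.keys q"
  have "linear_extension scale (mon_eval x) y = (\<Sum>b\<in>?A. scale (Poly_Mapping.lookup y b) (mon_eval x b))"
    if "y = p \<or> y = q \<or> y = p + q" for y
    using that by (intro linear_extension_superset) (auto simp: in_keys_iff lookup_add)
  then show ?thesis
    unfolding mpoly_eval_eq by (simp add: lookup_add scale_left_distrib sum.distrib)
qed

lemma eval_0 [simp]: "mpoly_eval scale x 0 = 0"
  by (simp add: mpoly_eval_def)

lemma eval_sum: "mpoly_eval scale x (sum f A) = (\<Sum>a\<in>A. mpoly_eval scale x (f a))"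
  by (induction A rule: infinite_finite_induct) (auto simp: eval_add)

lemma eval_single: "mpoly_eval scale x (Poly_Mapping.single m c) = scale c (mon_eval x m)"
  unfolding mpoly_eval_eq linear_extension_def by simp

lemma eval_mult: "mpoly_eval scale x (p * q) = mpoly_eval scale x p * mpoly_eval scale x q"
proof -
  let ?e = "mpoly_eval scale x"
  have pq: "p = (\<Sum>m\<in>Poly_Mapping.keys p. Poly_Mapping.single m (Poly_Mapping.lookup p m))"
    "q = (\<Sum>m\<in>Poly_Mapping.keys q. Poly_Mapping.single m (Poly_Mapping.lookup q m))"
    by (rule poly_mapping_sum_single; simp)+
  have single: "?e (Poly_Mapping.single m c * Poly_Mapping.single m' c')
    = ?e (Poly_Mapping.single m c) * ?e (Poly_Mapping.single m' c')" for m m' c c'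
    unfolding mult_single eval_single mon_eval_add
    by (metis scale_mult_left scale_mult_right scale_scale)
  have "?e (p * q) = (\<Sum>m\<in>Poly_Mapping.keys p. \<Sum>m'\<in>Poly_Mapping.keys q.
      ?e (Poly_Mapping.single m (Poly_Mapping.lookup p m)) * ?e (Poly_Mapping.single m' (Poly_Mapping.lookup q m')))"
    by (subst pq(1), subst pq(2)) (simp only: sum_product eval_sum single)
  also have "\<dots> = ?e p * ?e q"
  proof -
    have "?e p = (\<Sum>m\<in>Poly_Mapping.keys p. ?e (Poly_Mapping.single m (Poly_Mapping.lookup p m)))"
      "?e q = (\<Sum>m\<in>Poly_Mapping.keys q. ?e (Poly_Mapping.single m (Poly_Mapping.lookup q m)))"
      using arg_cong[OF pq(1), of ?e] arg_cong[OF pq(2), of ?e] by (simp_all only: eval_sum)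
    then show ?thesis by (simp only: sum_product)
  qed
  finally show ?thesis .
qed

lemma eval_scale: "mpoly_eval scale x (free_scale c p) = scale c (mpoly_eval scale x p)"
  unfolding free_scale_eq_mult eval_mult eval_single by (simp add: scale_1_mult)

lemma eval_diff: "mpoly_eval scale x (p - q) = mpoly_eval scale x p - mpoly_eval scale x q"
  using eval_add[of x "p - q" q] by simp

lemma eval_X: "mpoly_eval scale x (X i) = x i"
  unfolding X_def eval_single by simp

lemma linear_eval: "Vector_Spaces.linear free_scale scale (mpoly_eval scale x)"
  unfolding Vector_Spaces.linear_iff
  by (intro conjI P.vector_space_axioms vector_space_axioms allI eval_add eval_scale)

end

sublocale graded_algebra \<subseteq> PA: vector_space_pair "free_scale :: 'k \<Rightarrow> 'k mpoly \<Rightarrow> 'k mpoly" scale ..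

context std_graded_algebra
begin

lemma eval_in:
  assumes "\<forall>i<n. x i \<in> G 1" "p \<in> hpoly n j"
  shows "mpoly_eval scale x p \<in> G j"
  using assms(2)
proof (induction j arbitrary: p)
  case 0
  have "1 \<in> G 0" by simp
  then show ?case
    by (subst hpoly_0_degree[OF 0], subst eval_single) (auto intro: subspace_scale[OF subspace_G])
next
  case (Suc j)
  obtain g where g: "\<forall>i. g i \<in> hpoly n j" "p = (\<Sum>i<n. X i * g i)"
    by (rule hpoly_Suc_split[OF Suc.prems])
  have "x i * mpoly_eval scale x (g i) \<in> G (Suc j)" if "i < n" for i
    using G_mult[of "x i" 1 "mpoly_eval scale x (g i)" j] assms(1) Suc.IH[of "g i"] g(1) that by simp
  then show ?case
    unfolding g(2) eval_sum eval_mult eval_X by (intro sum_in_G) simp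
qed

abbreviation "ev \<equiv> mpoly_eval scale var"

lemma ev_in: "p \<in> hpoly edim j \<Longrightarrow> ev p \<in> G j"
  by (rule eval_in) (use var_in_G1 in blast)+

lemma ev_surj: "y \<in> G j \<Longrightarrow> \<exists>p\<in>hpoly edim j. ev p = y"
proof (induction j arbitrary: y)
  case 0
  have "Poly_Mapping.single 0 (res y) \<in> hpoly edim 0"
    by (rule hpoly_single) (simp add: monomials_0_degree)
  moreover have "ev (Poly_Mapping.single 0 (res y)) = y"
    using G_0_eq_residue[OF 0] by (simp add: eval_single)
  ultimately show ?case by blast
next
  case (Suc j)
  obtain a where a: "\<forall>i. a i \<in> G j" "y = (\<Sum>i<edim. var i * a i)"
    by (rule G_Suc_eq_var_combination[OF Suc.prems])
  have "\<forall>i. \<exists>p. p \<in> hpoly edim j \<and> ev p = a i"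
    using Suc.IH a(1) by blast
  from choice[OF this] obtain p where p: "\<forall>i. p i \<in> hpoly edim j \<and> ev (p i) = a i"
    by (rule exE)
  have "(\<Sum>i<edim. X i * p i) \<in> hpoly edim (Suc j)"
    using p hpoly_mult[OF X_in] by (intro hpoly_sum) fastforce
  moreover have "ev (\<Sum>i<edim. X i * p i) = y"
    unfolding eval_sum eval_mult eval_X a(2) using p by simp
  ultimately show ?case by blast
qed

text \<open>The relations of degree \<open>j\<close> between the generators.\<close>

definition rel :: "nat \<Rightarrow> 'k mpoly set" where
  "rel j = {p \<in> hpoly edim j. ev p = 0}"

lemma rel_0: "rel 0 = {0}"
proof -
  have "p = 0" if "p \<in> rel 0" for p
  proof -
    have p: "p = Poly_Mapping.single 0 (Poly_Mapping.lookup p 0)"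
      using that hpoly_0_degree by (auto simp: rel_def)
    have "ev p = 0" using that by (simp add: rel_def)
    then have "Poly_Mapping.lookup p 0 = 0"
      by (subst (asm) p) (simp add: eval_single)
    then show ?thesis by (subst p) simp
  qed
  then show ?thesis by (auto simp: rel_def)
qed

lemma rel_1: "rel 1 = {0}"
proof -
  have "p = 0" if p: "p \<in> rel 1" for p
  proof -
    have "p \<in> hpoly edim (Suc 0)" using p by (simp add: rel_def)
    then obtain g where g: "\<forall>i. g i \<in> hpoly edim 0" "p = (\<Sum>i<edim. X i * g i)"
      by (rule hpoly_Suc_split)
    let ?c = "\<lambda>i. Poly_Mapping.lookup (g i) 0"
    have gi: "g i = Poly_Mapping.single 0 (?c i)" for i
      using g(1) by (intro hpoly_0_degree[of _ edim]) blast
    have "ev (g i) = scale (?c i) 1" for i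
      by (subst gi) (simp add: eval_single)
    then have "ev p = (\<Sum>i<edim. scale (?c i) (var i))"
      unfolding g(2) eval_sum eval_mult eval_X by (simp add: scale_mult_right[symmetric])
    then have "?c i = 0" if "i < edim" for i
      using p that by (intro var_independent) (auto simp: rel_def)
    then have "g i = 0" if "i < edim" for i
      using that by (subst gi) simp
    then show "p = 0" unfolding g(2) by simp
  qed
  then show ?thesis by (auto simp: rel_def)
qed

lemma dim_rel: "P.dim (rel j) + a_dim j = card (monomials edim j)"
proof -
  have "ev ` hpoly edim j = G j"
    using ev_in ev_surj by fastforce
  then show ?thesis
    using PA.rank_nullity[OF linear_eval[of var] subspace_hpoly, of edim j] hpoly_dim[of edim j, where 'k = 'k]
    unfolding rel_def by simp
qed

text \<open>
  Koszul algebras are quadratic: a relation \<open>f = \<Sum>X\<^sub>i g\<^sub>i\<close> yields the syzygy of the \<open>ev g\<^sub>i\<close>, and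
  lifting a decomposition of it into syzygies of lower degree rewrites \<open>f\<close> by relations of
  lower degree.
\<close>

lemma koszul_rel_Suc:
  assumes "koszul scale G" "j \<ge> 2" "f \<in> rel (Suc j)"
  obtains h where "\<forall>l. h l \<in> rel j" "f = (\<Sum>l<edim. X l * h l)"
proof -
  obtain k where k: "j = Suc k" "k \<ge> 1" using assms(2) by (cases j) auto
  have "f \<in> hpoly edim (Suc j)" using assms(3) by (simp add: rel_def)
  then obtain g where g: "\<forall>i. g i \<in> hpoly edim j" "f = (\<Sum>i<edim. X i * g i)"
    by (rule hpoly_Suc_split)
  have "ev (g i) \<in> G (Suc k)" for i using g(1) ev_in k by blast
  moreover have "(\<Sum>i<edim. var i * ev (g i)) = 0"
    using assms(3) unfolding g(2) rel_def by (simp add: eval_sum eval_mult eval_X)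
  ultimately obtain \<tau> where \<tau>: "\<forall>l i. \<tau> l i \<in> G k" "\<forall>l. (\<Sum>i<edim. var i * \<tau> l i) = 0"
    "\<forall>i<edim. ev (g i) = (\<Sum>l<edim. var l * \<tau> l i)"
    by (rule koszul_syzygies[OF assms(1) _ _ k(2)])
  have "\<forall>z. \<exists>p. p \<in> hpoly edim k \<and> ev p = \<tau> (fst z) (snd z)"
    using ev_surj \<tau>(1) by blast
  from choice[OF this] obtain p where p: "\<forall>z. p z \<in> hpoly edim k \<and> ev (p z) = \<tau> (fst z) (snd z)"
    by (rule exE)
  \<comment> \<open>lifts to polynomials of the syzygies and of the coefficients of their combination\<close>
  define h where "h l = (if l < edim then
    (\<Sum>i<edim. X i * p (l, i)) + (g l - (\<Sum>i<edim. X i * p (i, l))) else 0)" for l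
  have Xp: "X i * p z \<in> hpoly edim j" if "i < edim" for i z
    using hpoly_mult[OF X_in[OF that], of "p z" k] p k by simp
  have "h l \<in> rel j" for l
  proof (cases "l < edim")
    case True
    have "h l \<in> hpoly edim j"
      unfolding h_def using True g(1) Xp by (auto intro!: hpoly_add hpoly_diff hpoly_sum)
    moreover have "ev (h l) = 0"
      unfolding h_def using True \<tau> p
      by (simp add: eval_add eval_diff eval_sum eval_mult eval_X)
    ultimately show ?thesis by (simp add: rel_def)
  qed (simp add: h_def rel_def)
  moreover have "f = (\<Sum>l<edim. X l * h l)"
  proof -
    have "(\<Sum>l<edim. X l * h l) = (\<Sum>l<edim. X l * ((\<Sum>i<edim. X i * p (l, i)) + (g l - (\<Sum>i<edim. X i * p (i, l)))))"
      by (intro sum.cong) (auto simp: h_def)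
    also have "\<dots> = (\<Sum>l<edim. X l * g l) + ((\<Sum>l<edim. \<Sum>i<edim. X l * (X i * p (l, i)))
        - (\<Sum>l<edim. \<Sum>i<edim. X l * (X i * p (i, l))))"
      by (simp only: distrib_left right_diff_distrib sum.distrib sum_subtractf sum_distrib_left) simp
    also have "(\<Sum>l<edim. \<Sum>i<edim. X l * (X i * p (i, l))) = (\<Sum>l<edim. \<Sum>i<edim. X l * (X i * p (l, i)))"
      by (subst sum.swap) (simp only: mult.left_commute)
    finally show ?thesis unfolding g(2) by simp
  qed
  ultimately show thesis using that by blast
qed

end


section \<open>Adjoining homogeneous elements to an ideal\<close>

text \<open>
  The part of degree \<open>j\<close> of the ideal generated by \<open>f 0, \<dots>, f (l - 1)\<close> in \<open>n\<close> variables, where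
  \<open>f i\<close> is homogeneous of degree \<open>d i\<close>.
\<close>

primrec ideal_piece ::
  "nat \<Rightarrow> (nat \<Rightarrow> 'k::field mpoly) \<Rightarrow> (nat \<Rightarrow> nat) \<Rightarrow> nat \<Rightarrow> nat \<Rightarrow> 'k mpoly set" where
  "ideal_piece n f d 0 j = {0}"
| "ideal_piece n f d (Suc l) j = {u + v * f l | u v. u \<in> ideal_piece n f d l j \<and>
     v \<in> (if d l \<le> j then hpoly n (j - d l) else {0})}"

locale homogeneous_sequence =
  fixes n :: nat and f :: "nat \<Rightarrow> 'k::field mpoly" and d :: "nat \<Rightarrow> nat"
  assumes f_in: "f l \<in> hpoly n (d l)"
begin

abbreviation "I \<equiv> ideal_piece n f d"

lemma piece_sub: "I l j \<subseteq> hpoly n j"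
proof (induction l)
  case (Suc l)
  have "u + v * f l \<in> hpoly n j" if "u \<in> I l j" "v \<in> (if d l \<le> j then hpoly n (j - d l) else {0})" for u v
  proof -
    have "v * f l \<in> hpoly n j"
      using that(2) hpoly_mult[of v n "j - d l" "f l" "d l"] f_in by (auto split: if_splits)
    then show ?thesis using Suc that(1) by (auto intro: hpoly_add)
  qed
  then show ?case by auto
qed simp

lemma linear_times: "Vector_Spaces.linear free_scale free_scale (\<lambda>v. v * q)" for q :: "'k mpoly"
  unfolding Vector_Spaces.linear_iff
  by (intro conjI P.vector_space_axioms allI) (simp_all add: distrib_right free_scale_eq_mult mult.assoc)

lemma subspace_coeffs: "P.subspace (if d l \<le> j then hpoly n (j - d l) else {0})"
  by (simp add: subspace_hpoly)

lemma subspace_piece: "P.subspace (I l j)"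
proof (induction l)
  case (Suc l)
  have "I (Suc l) j = {x + y | x y. x \<in> I l j \<and> y \<in> (\<lambda>v. v * f l) ` (if d l \<le> j then hpoly n (j - d l) else {0})}"
    unfolding ideal_piece.simps by blast
  then show ?case
    using P.subspace_sums[OF Suc PP.linear_subspace_image[OF linear_times subspace_coeffs, of "f l" l j]] by simp
qed (simp add: P.subspace_0)

lemma fd_piece: "P.fin_dim (I l j)"
  using P.fin_dim_subset[OF _ piece_sub] hpoly_dim by blast

lemma piece_0 [simp]: "0 \<in> I l j"
  by (rule P.subspace_0[OF subspace_piece])

lemma piece_sum: "(\<And>a. a \<in> A \<Longrightarrow> g a \<in> I l j) \<Longrightarrow> sum g A \<in> I l j"
  by (rule P.subspace_sum[OF subspace_piece])

lemma piece_mult: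
  assumes "q \<in> hpoly n i" "u \<in> I l j"
  shows "q * u \<in> I l (i + j)"
  using assms(2)
proof (induction l arbitrary: u)
  case (Suc l)
  then obtain w v where wv: "u = w + v * f l" "w \<in> I l j" "v \<in> (if d l \<le> j then hpoly n (j - d l) else {0})"
    by auto
  have "q * v \<in> (if d l \<le> i + j then hpoly n (i + j - d l) else {0})"
    using wv(3) hpoly_mult[OF assms(1), of v "j - d l"] by (auto split: if_splits)
  moreover have "q * w \<in> I l (i + j)" by (rule Suc.IH[OF wv(2)])
  moreover have "q * u = q * w + (q * v) * f l"
    unfolding wv(1) by (simp add: distrib_left mult.assoc)
  ultimately show ?case unfolding ideal_piece.simps by blast
qed simp

lemma piece_mono: "I l j \<subseteq> I (l + l') j"
proof (induction l')
  case (Suc l')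
  have "u \<in> I (Suc (l + l')) j" if "u \<in> I (l + l') j" for u
  proof -
    have "u = u + 0 * f (l + l')" by simp
    moreover have "0 \<in> (if d (l + l') \<le> j then hpoly n (j - d (l + l')) else {0})" by simp
    ultimately show ?thesis using that unfolding ideal_piece.simps by blast
  qed
  then show ?case using Suc by auto
qed simp

lemma gen_in_piece: "l < l' \<Longrightarrow> f l \<in> I l' (d l)"
proof -
  assume l: "l < l'"
  have one: "1 \<in> hpoly n 0" by (simp add: hpoly_def monomials_0_degree)
  have "f l = 0 + 1 * f l" by simp
  moreover have "1 \<in> (if d l \<le> d l then hpoly n (d l - d l) else {0})"
    using one by simp
  ultimately have "f l \<in> I (Suc l) (d l)"
    unfolding ideal_piece.simps using piece_0[of l "d l"] by blast
  then show ?thesis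
    using piece_mono[of "Suc l" "d l" "l' - Suc l"] l by auto
qed

definition quotient_series :: "nat \<Rightarrow> int fps" where
  "quotient_series l = Abs_fps (\<lambda>j. int (card (monomials n j)) - int (P.dim (I l j)))"

lemma quotient_series_0: "quotient_series 0 = monomial_series n"
  unfolding quotient_series_def monomial_series_def
  using P.dim_le_card[of "{0 :: 'k mpoly}" "{}"] by simp

lemma dim_piece_Suc:
  "d l \<le> j \<Longrightarrow> P.dim (I (Suc l) j) + P.dim {v \<in> hpoly n (j - d l). v * f l \<in> I l j}
    = P.dim (I l j) + card (monomials n (j - d l))"
  "\<not> d l \<le> j \<Longrightarrow> I (Suc l) j = I l j"
proof -
  assume j: "d l \<le> j"
  then show "P.dim (I (Suc l) j) + P.dim {v \<in> hpoly n (j - d l). v * f l \<in> I l j}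
    = P.dim (I l j) + card (monomials n (j - d l))"
    using PP.dim_sum_image[OF linear_times[of "f l"] subspace_hpoly[of n "j - d l"] _ subspace_piece[of l j] fd_piece[of l j]]
      hpoly_dim[of n "j - d l", where 'k = 'k] by simp
next
  assume "\<not> d l \<le> j"
  then show "I (Suc l) j = I l j" by simp
qed

lemma piece_sub_colon: "d l \<le> j \<Longrightarrow> I l (j - d l) \<subseteq> {v \<in> hpoly n (j - d l). v * f l \<in> I l j}"
proof safe
  fix u assume j: "d l \<le> j" and u: "u \<in> I l (j - d l)"
  then show "u \<in> hpoly n (j - d l)" using piece_sub by blast
  show "u * f l \<in> I l j"
    using piece_mult[OF f_in[of l] u] j by (simp add: mult.commute)
qed

text \<open>
  The kernel of the multiplication by \<open>f l\<close> into the quotient contains the ideal itself; equality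
  is regularity of \<open>f l\<close>, which is the case of the next lemma.
\<close>

lemma quotient_series_Suc_ge:
  "fps_nth ((1 - fps_X ^ d l) * quotient_series l) j \<le> fps_nth (quotient_series (Suc l)) j"
proof (cases "d l \<le> j")
  case True
  have "P.dim (I l (j - d l)) \<le> P.dim {v \<in> hpoly n (j - d l). v * f l \<in> I l j}"
    by (rule P.fin_dim_dim_subset[OF _ piece_sub_colon[OF True]])
      (rule P.fin_dim_subset[of "hpoly n (j - d l)"], use hpoly_dim in auto)
  then show ?thesis
    using dim_piece_Suc(1)[OF True] True
    unfolding quotient_series_def left_diff_distrib
    by (simp add: fps_X_power_mult_nth del: ideal_piece.simps)
next
  case False
  then show ?thesis
    unfolding quotient_series_def left_diff_distrib dim_piece_Suc(2)[OF False]
    by (simp add: fps_X_power_mult_nth)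
qed

lemma quotient_series_Suc_eq:
  assumes "\<And>j v. v \<in> hpoly n j \<Longrightarrow> v * f l \<in> I l (j + d l) \<Longrightarrow> v \<in> I l j"
  shows "quotient_series (Suc l) = (1 - fps_X ^ d l) * quotient_series l"
proof (rule fps_ext)
  fix j
  show "fps_nth (quotient_series (Suc l)) j = fps_nth ((1 - fps_X ^ d l) * quotient_series l) j"
  proof (cases "d l \<le> j")
    case True
    have "{v \<in> hpoly n (j - d l). v * f l \<in> I l j} = I l (j - d l)"
      using piece_sub_colon[OF True] assms[of _ "j - d l"] True by auto
    then show ?thesis
      using dim_piece_Suc(1)[OF True] True
      unfolding quotient_series_def left_diff_distrib
      by (simp add: fps_X_power_mult_nth del: ideal_piece.simps)
  next
    case False
    then show ?thesis
      unfolding quotient_series_def left_diff_distrib dim_piece_Suc(2)[OF False]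
      by (simp add: fps_X_power_mult_nth)
  qed
qed

end


section \<open>Growth of coefficients\<close>

text \<open>
  This is \<open>1 / (1 - z\<^sup>2)\<close>.
\<close>

definition even_series :: "'a::comm_ring_1 fps" where
  "even_series = Abs_fps (\<lambda>i. if even i then 1 else 0)"

lemma even_series: "even_series * (1 - fps_X ^ 2) = 1"
proof (rule fps_ext)
  fix j
  consider "j = 0" | "j = 1" | i where "j = Suc (Suc i)"
    by (metis One_nat_def not0_implies_Suc)
  then show "fps_nth (even_series * (1 - fps_X ^ 2)) j = fps_nth 1 j"
    by cases (simp_all add: even_series_def right_diff_distrib fps_X_power_mult_right_nth)
qed

lemma fps_mult_nonneg:
  "(\<And>j. 0 \<le> fps_nth (a :: 'a::linordered_idom fps) j) \<Longrightarrow> (\<And>j. 0 \<le> fps_nth b j) \<Longrightarrow> 0 \<le> fps_nth (a * b) j"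
  by (simp add: fps_mult_nth sum_nonneg)

lemma fps_power_nonneg:
  "(\<And>j. 0 \<le> fps_nth (a :: 'a::linordered_idom fps) j) \<Longrightarrow> 0 \<le> fps_nth (a ^ n) j"
proof (induction n arbitrary: j)
  case (Suc n)
  then show ?case unfolding power_Suc by (intro fps_mult_nonneg) simp_all
qed simp

context std_graded_algebra
begin

text \<open>
  The relations of a Koszul algebra are generated by \<open>N = dim S\<^sub>2 - dim A\<^sub>2\<close> quadrics, and
  adjoining a quadric to an ideal multiplies the Hilbert series of the quotient at least by
  \<open>1 - z\<^sup>2\<close>.
\<close>

lemma koszul_series_bound:
  assumes koszul: "koszul scale G"
  obtains N where "N + a_dim 2 = card (monomials edim 2)"
    "\<forall>j. fps_nth (monomial_series edim) j \<le> fps_nth (hilbert_series scale G * even_series ^ N) j"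
proof -
  let ?N = "P.dim (rel 2)"
  have fd: "P.fin_dim (rel j)" for j
    by (rule P.fin_dim_subset[of "hpoly edim j"]) (use hpoly_dim in \<open>auto simp: rel_def\<close>)
  obtain b where b: "\<forall>i<?N. b i \<in> rel 2" "rel 2 \<subseteq> P.span (b ` {..<?N})"
    "P.independent (b ` {..<?N})" "inj_on b {..<?N}"
    by (rule P.fin_dim_enum[OF fd])
  define f where "f i = (if i < ?N then b i else 0)" for i
  interpret H: homogeneous_sequence edim f "\<lambda>_. 2"
    by standard (use b(1) in \<open>auto simp: f_def rel_def\<close>)
  have sub1: "rel j \<subseteq> H.I ?N j" for j
  proof (induction j rule: less_induct)
    case (less j)
    consider "j = 0" | "j = 1" | "j = 2" | "j \<ge> 3" by linarith
    then show ?case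
    proof cases
      case 3
      have "b ` {..<?N} \<subseteq> H.I ?N 2"
        using H.gen_in_piece[of _ ?N] by (auto simp: f_def)
      then show ?thesis
        unfolding 3 using b(2) P.span_minimal[OF _ H.subspace_piece] by blast
    next
      case 4
      then obtain i where i: "j = Suc i" "i \<ge> 2" by (cases j) auto
      show ?thesis
      proof
        fix p assume "p \<in> rel j"
        then obtain h where h: "\<forall>l. h l \<in> rel i" "p = (\<Sum>l<edim. X l * h l)"
          using koszul_rel_Suc[OF koszul i(2)] i(1) by blast
        have "X l * h l \<in> H.I ?N j" if "l < edim" for l
          using H.piece_mult[OF X_in[OF that], of "h l" ?N i] less[of i] h(1) i(1) by auto
        then show "p \<in> H.I ?N j" unfolding h(2) by (intro H.piece_sum) auto
      qed
    qed (use rel_0 rel_1 in auto)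
  qed
  have sub2: "H.I l j \<subseteq> rel j" for l j
  proof (induction l)
    case 0
    then show ?case by (simp add: rel_def)
  next
    case (Suc l)
    have "ev (f l) = 0" using b(1) by (auto simp: f_def rel_def)
    then have "ev p = 0" if "p \<in> H.I (Suc l) j" for p
      using that Suc by (auto simp: rel_def eval_add eval_mult)
    then show ?case
      using H.piece_sub[of "Suc l" j] unfolding rel_def by blast
  qed
  have "H.quotient_series ?N = hilbert_series scale G"
  proof (rule fps_ext)
    fix j
    have "H.I ?N j = rel j" using sub1 sub2 by blast
    then show "fps_nth (H.quotient_series ?N) j = fps_nth (hilbert_series scale G) j"
      using dim_rel[of j] unfolding H.quotient_series_def hilbert_series_def by simp
  qed
  moreover have "\<forall>j. fps_nth (monomial_series edim) j \<le> fps_nth (H.quotient_series l * even_series ^ l) j" for l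
  proof (induction l)
    case 0
    then show ?case by (simp add: H.quotient_series_0)
  next
    case (Suc l)
    let ?D = "H.quotient_series (Suc l) - (1 - fps_X ^ 2) * H.quotient_series l"
    have even_nonneg: "0 \<le> fps_nth (even_series :: int fps) j" for j by (simp add: even_series_def)
    have "0 \<le> fps_nth (?D * even_series ^ Suc l) j" for j
      using H.quotient_series_Suc_ge[of l]
      by (intro fps_mult_nonneg fps_power_nonneg even_nonneg) simp
    moreover have "?D * even_series ^ Suc l
      = H.quotient_series (Suc l) * even_series ^ Suc l - H.quotient_series l * even_series ^ l"
    proof -
      have "(1 - fps_X ^ 2) * H.quotient_series l * even_series ^ Suc l
        = H.quotient_series l * even_series ^ l * (even_series * (1 - fps_X ^ 2))"
        by (simp only: power_Suc mult_ac)
      then show ?thesis unfolding even_series left_diff_distrib by simp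
    qed
    ultimately have *: "fps_nth (H.quotient_series l * even_series ^ l) j
        \<le> fps_nth (H.quotient_series (Suc l) * even_series ^ Suc l) j" for j
      by (metis diff_ge_0_iff_ge fps_sub_nth)
    show ?case
      using Suc * order_trans by blast
  qed
  ultimately show thesis using that[of ?N] dim_rel[of 2] by metis
qed

end

text \<open>
  The exponent is that of partial sums: a series with a pole of order \<open>p\<close> at \<open>1\<close> is multiplied by
  \<open>1 / (1 - z)\<close> before its growth is measured, so that \<open>p = 0\<close> (a polynomial) needs no separate
  treatment.
\<close>

definition polynomial_growth :: "nat \<Rightarrow> int fps \<Rightarrow> bool" where
  "polynomial_growth q f \<longleftrightarrow> (\<exists>C. \<forall>j. \<bar>real_of_int (fps_nth f j)\<bar> \<le> C * real (j + 1) ^ q)"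

definition geometric_series :: "int fps" where
  "geometric_series = Abs_fps (\<lambda>_. 1)"

lemma geometric_series: "geometric_series * (1 - fps_X) = 1"
  by (rule fps_ext) (auto simp: geometric_series_def right_diff_distrib fps_X_mult_right_nth)

lemma polynomial_growth_mult:
  assumes "polynomial_growth q f" "\<And>j. fps_nth g j \<in> {0, 1}"
  shows "polynomial_growth (Suc q) (f * g)"
proof -
  obtain C where C: "\<And>j. \<bar>real_of_int (fps_nth f j)\<bar> \<le> C * real (j + 1) ^ q"
    using assms(1) unfolding polynomial_growth_def by blast
  have C0: "0 \<le> C" using C[of 0] by simp
  have "\<bar>real_of_int (fps_nth (f * g) j)\<bar> \<le> C * real (j + 1) ^ Suc q" for j
  proof -
    have "\<bar>real_of_int (fps_nth (f * g) j)\<bar>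
      \<le> (\<Sum>i=0..j. \<bar>real_of_int (fps_nth f i) * real_of_int (fps_nth g (j - i))\<bar>)"
      unfolding fps_mult_nth of_int_sum of_int_mult by (rule sum_abs)
    also have "\<dots> \<le> (\<Sum>i=0..j. C * real (j + 1) ^ q)"
    proof (rule sum_mono)
      fix i assume i: "i \<in> {0..j}"
      have "\<bar>real_of_int (fps_nth f i) * real_of_int (fps_nth g (j - i))\<bar> \<le> \<bar>real_of_int (fps_nth f i)\<bar>"
        using assms(2)[of "j - i"] by auto
      also have "\<dots> \<le> C * real (i + 1) ^ q" by (rule C)
      also have "\<dots> \<le> C * real (j + 1) ^ q"
        using i C0 by (intro mult_left_mono power_mono) auto
      finally show "\<bar>real_of_int (fps_nth f i) * real_of_int (fps_nth g (j - i))\<bar> \<le> C * real (j + 1) ^ q" .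
    qed
    also have "\<dots> = C * real (j + 1) ^ Suc q" by simp
    finally show ?thesis .
  qed
  then show ?thesis unfolding polynomial_growth_def by blast
qed

lemma polynomial_growth_power:
  assumes "polynomial_growth q f" "\<And>j. fps_nth g j \<in> {0, 1}"
  shows "polynomial_growth (q + n) (f * g ^ n)"
proof (induction n)
  case (Suc n)
  then show ?case
    using polynomial_growth_mult[OF Suc assms(2)] by (simp add: mult_ac)
qed (use assms in simp)

lemma polynomial_growth_poly: "polynomial_growth 0 (fps_of_poly h * geometric_series)"
proof -
  have "\<bar>real_of_int (fps_nth (fps_of_poly h * geometric_series) j)\<bar>
      \<le> (\<Sum>i\<le>degree h. \<bar>real_of_int (coeff h i)\<bar>)" for j
  proof -
    have "\<bar>real_of_int (fps_nth (fps_of_poly h * geometric_series) j)\<bar>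
      = \<bar>\<Sum>i=0..j. real_of_int (coeff h i)\<bar>"
      by (simp add: fps_mult_nth geometric_series_def)
    also have "\<dots> \<le> (\<Sum>i=0..j. \<bar>real_of_int (coeff h i)\<bar>)" by (rule sum_abs)
    also have "\<dots> \<le> (\<Sum>i\<in>{0..j} \<union> {..degree h}. \<bar>real_of_int (coeff h i)\<bar>)"
      by (rule sum_mono2) auto
    also have "\<dots> = (\<Sum>i\<le>degree h. \<bar>real_of_int (coeff h i)\<bar>)"
      by (rule sum.mono_neutral_right) (auto simp: coeff_eq_0 not_le)
    finally show ?thesis .
  qed
  then show ?thesis
    unfolding polynomial_growth_def by (intro exI[of _ "\<Sum>i\<le>degree h. \<bar>real_of_int (coeff h i)\<bar>"]) simp
qed

lemma rational_series_growth:
  assumes "H * (1 - fps_X) ^ p = fps_of_poly h"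
  shows "polynomial_growth p (H * geometric_series)"
proof -
  have "H = H * (geometric_series * (1 - fps_X)) ^ p"
    by (simp add: geometric_series)
  also have "\<dots> = fps_of_poly h * geometric_series ^ p"
    unfolding power_mult_distrib assms[symmetric] by (simp only: mult_ac)
  finally have eq: "H * geometric_series = fps_of_poly h * geometric_series * geometric_series ^ p"
    by (simp only: mult_ac)
  have "polynomial_growth (0 + p) (fps_of_poly h * geometric_series * geometric_series ^ p)"
    by (rule polynomial_growth_power[OF polynomial_growth_poly]) (simp add: geometric_series_def)
  then show ?thesis unfolding eq by simp
qed

text \<open>
  As a function of \<open>j\<close>, \<open>j choose n\<close> grows like \<open>j\<^sup>n\<close>; on multiples \<open>j = n t\<close> it is at least
  \<open>t\<^sup>n\<close>.
\<close>

lemma binomial_growth: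
  assumes "\<And>j. real (j choose n) \<le> C * real (j + 1) ^ q"
  shows "n \<le> q"
proof (rule ccontr)
  assume "\<not> n \<le> q"
  then have nq: "q < n" by simp
  define K where "K = C * real (n + 1) ^ q"
  have "0 \<le> C" using assms[of 0] order_trans[of 0 "real (0 choose n)"] by simp
  obtain t :: nat where t: "real t > K" "t \<ge> 1"
  proof -
    obtain t where "real t > K" using reals_Archimedean2 by blast
    then show ?thesis using that[of "Suc t"] by simp
  qed
  have "real t ^ n \<le> real ((n * t) choose n)"
    using binomial_ge_n_over_k_pow_k[of n "n * t", where 'a = real] t(2) nq by simp
  also have "\<dots> \<le> C * real (n * t + 1) ^ q" by (rule assms)
  also have "\<dots> \<le> C * real ((n + 1) * t) ^ q"
    using \<open>0 \<le> C\<close> t(2) by (intro mult_left_mono power_mono) (simp_all del: of_nat_mult of_nat_add)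
  also have "\<dots> = K * real t ^ q"
    unfolding K_def of_nat_mult power_mult_distrib by (simp only: mult_ac)
  finally have "real t ^ n \<le> K * real t ^ q" .
  moreover have "real t ^ n = real t ^ (n - q) * real t ^ q"
    using nq by (simp add: power_add[symmetric])
  ultimately have "real t ^ (n - q) \<le> K"
    using t(2) by simp
  moreover have "real t \<le> real t ^ (n - q)"
    using power_increasing[of 1 "n - q" "real t"] nq t(2) by simp
  ultimately show False using t(1) by simp
qed

lemma monomial_series_ge: "(j choose n) \<le> fps_nth (monomial_series n * geometric_series) j"
proof -
  have eq: "monomial_series n * geometric_series = monomial_series (Suc n)"
  proof -
    have "monomial_series n * geometric_series
      = (monomial_series (Suc n) * (1 - fps_X) ^ Suc n) * (monomial_series n * geometric_series)"
      unfolding monomial_series by simp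
    also have "\<dots> = monomial_series (Suc n) * (monomial_series n * (1 - fps_X) ^ n)
        * (geometric_series * (1 - fps_X))"
      by (simp only: power_Suc mult_ac)
    finally show ?thesis unfolding monomial_series geometric_series by simp
  qed
  have "int (j choose n) \<le> fps_nth (monomial_series (Suc n)) j"
  proof (induction n arbitrary: j)
    case 0
    have "Poly_Mapping.single 0 j \<in> monomials (Suc 0) j"
      by (auto simp: monomials_def)
    then have "0 < card (monomials (Suc 0) j)"
      using finite_monomials card_gt_0_iff by blast
    then show ?case by (simp add: monomial_series_def)
  next
    case (Suc n)
    note IH = this
    have step: "fps_nth (monomial_series (Suc (Suc n))) (Suc j) =
      fps_nth (monomial_series (Suc n)) (Suc j) + fps_nth (monomial_series (Suc (Suc n))) j" for j
      by (simp add: monomial_series_def card_monomials_Suc)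
    show ?case
    proof (induction j)
      case 0
      then show ?case by (simp add: monomial_series_def)
    next
      case (Suc j)
      have "int (j choose n) \<le> int (Suc j choose n)"
        by (cases n) (simp_all add: binomial_Suc_Suc)
      then show ?case
        using Suc IH[of "Suc j"] unfolding step binomial_Suc_Suc by simp
    qed
  qed
  then show ?thesis unfolding eq .
qed

context std_graded_algebra
begin

text \<open>
  Krull's height theorem for the quadrics that define a Koszul algebra, in terms of the pole
  order \<open>p\<close> of the Hilbert series at \<open>1\<close>.
\<close>

lemma koszul_pole_order:
  assumes "koszul scale G" "hilbert_series scale G * (1 - fps_X) ^ p = fps_of_poly h"
  shows "edim + a_dim 2 \<le> p + card (monomials edim 2)"
proof -
  obtain N where N: "N + a_dim 2 = card (monomials edim 2)"
    "\<forall>j. fps_nth (monomial_series edim) j \<le> fps_nth (hilbert_series scale G * even_series ^ N) j"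
    by (rule koszul_series_bound[OF assms(1)])
  let ?L = "hilbert_series scale G * geometric_series * even_series ^ N"
  have "polynomial_growth (p + N) ?L"
    by (rule polynomial_growth_power[OF rational_series_growth[OF assms(2)]]) (simp add: even_series_def)
  then obtain C where C: "\<And>j. \<bar>real_of_int (fps_nth ?L j)\<bar> \<le> C * real (j + 1) ^ (p + N)"
    unfolding polynomial_growth_def by blast
  have "real (j choose edim) \<le> C * real (j + 1) ^ (p + N)" for j
  proof -
    let ?D = "hilbert_series scale G * even_series ^ N - monomial_series edim"
    have "0 \<le> fps_nth (?D * geometric_series) j"
      by (rule fps_mult_nonneg) (use N(2) in \<open>simp_all add: geometric_series_def\<close>)
    moreover have "?D * geometric_series = ?L - monomial_series edim * geometric_series"
      by (simp add: algebra_simps)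
    ultimately have "fps_nth (monomial_series edim * geometric_series) j \<le> fps_nth ?L j"
      by (metis diff_ge_0_iff_ge fps_sub_nth)
    then have "real (j choose edim) \<le> real_of_int (fps_nth ?L j)"
      using monomial_series_ge[of j edim] by linarith
    then show ?thesis using C[of j] by linarith
  qed
  then have "edim \<le> p + N" by (rule binomial_growth)
  then show ?thesis using N(1) by linarith
qed

end


section \<open>Complete intersections\<close>

lemma hpoly_mpoly_ring: "p \<in> hpoly n j \<Longrightarrow> p \<in> mpoly_ring n"
  unfolding hpoly_def mpoly_ring_def monomials_def by blast

lemma mpoly_ring_0 [simp]: "0 \<in> mpoly_ring n"
  by (simp add: mpoly_ring_def)

lemma one_in_hpoly: "1 \<in> hpoly n 0"
  by (simp add: hpoly_def monomials_0_degree)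

definition hpart :: "nat \<Rightarrow> 'k::field mpoly \<Rightarrow> 'k mpoly" where
  "hpart j = Poly_Mapping.mapp (\<lambda>m c. if mdeg m = j then c else 0)"

lemma lookup_hpart: "Poly_Mapping.lookup (hpart j p) m = (if mdeg m = j then Poly_Mapping.lookup p m else 0)"
  unfolding hpart_def by (simp add: lookup_mapp when_def in_keys_iff)

lemma hpart_in: "p \<in> mpoly_ring n \<Longrightarrow> hpart j p \<in> hpoly n j"
  unfolding hpoly_def mpoly_ring_def monomials_def
  by (auto simp: in_keys_iff lookup_hpart split: if_splits)

lemma hpart_add: "hpart j (p + q) = hpart j p + hpart j q"
  by (rule poly_mapping_eqI) (simp add: lookup_hpart lookup_add)

lemma hpart_0 [simp]: "hpart j 0 = 0"
  by (rule poly_mapping_eqI) (simp add: lookup_hpart)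

lemma hpart_sum: "hpart j (sum f A) = (\<Sum>a\<in>A. hpart j (f a))"
  by (induction A rule: infinite_finite_induct) (auto simp: hpart_add)

lemma hpart_hpoly: "p \<in> hpoly n i \<Longrightarrow> hpart j p = (if i = j then p else 0)"
  by (rule poly_mapping_eqI) (auto simp: lookup_hpart hpoly_def monomials_def in_keys_iff)

lemma sum_hpart: obtains N where "p = (\<Sum>j\<le>N. hpart j p)"
proof -
  let ?N = "\<Sum>m\<in>Poly_Mapping.keys p. mdeg m"
  have "p = (\<Sum>j\<le>?N. hpart j p)"
  proof (rule poly_mapping_eqI)
    fix m
    have "m \<in> Poly_Mapping.keys p \<Longrightarrow> mdeg m \<le> ?N"
      by (rule member_le_sum) auto
    then show "Poly_Mapping.lookup p m = Poly_Mapping.lookup (\<Sum>j\<le>?N. hpart j p) m"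
      by (auto simp: lookup_sum lookup_hpart sum.delta in_keys_iff)
  qed
  then show thesis by (rule that)
qed

lemma hpart_mult:
  assumes "f \<in> hpoly n d" "g \<in> mpoly_ring n"
  shows "hpart j (g * f) = (if d \<le> j then hpart (j - d) g * f else 0)"
proof -
  obtain N where N: "g = (\<Sum>i\<le>N. hpart i g)" by (rule sum_hpart)
  have "hpart j (hpart i g * f) = (if i + d = j then hpart i g * f else 0)" for i
    by (rule hpart_hpoly[OF hpoly_mult[OF hpart_in[OF assms(2)] assms(1)]])
  then have eq: "hpart j (g * f) = (\<Sum>i\<le>N. if i + d = j then hpart i g * f else 0)"
    by (subst N) (simp add: sum_distrib_right hpart_sum)
  show ?thesis
  proof (cases "d \<le> j")
    case True
    have "hpart (j - d) g = (\<Sum>i\<le>N. hpart (j - d) (hpart i g))"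
      by (subst N) (simp add: hpart_sum)
    also have "\<dots> = (\<Sum>i\<le>N. if i = j - d then hpart i g else 0)"
      by (intro sum.cong refl hpart_hpoly[OF hpart_in[OF assms(2)]])
    finally have e: "hpart (j - d) g = (\<Sum>i\<le>N. if i = j - d then hpart i g else 0)" .
    have "hpart (j - d) g * f = (\<Sum>i\<le>N. if i = j - d then hpart i g * f else 0)"
      by (subst e) (simp add: sum.delta)
    also have "\<dots> = hpart j (g * f)"
      unfolding eq using True by (intro sum.cong) auto
    finally show ?thesis using True by simp
  qed (simp add: eq)
qed

lemma homogeneous_iff: "f \<in> mpoly_ring n \<Longrightarrow> homogeneous f \<Longrightarrow> \<exists>d. f \<in> hpoly n d"
  unfolding homogeneous_def mpoly_ring_def hpoly_def monomials_def mdeg_def by blast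

lemma mem_mpoly_ideal_take:
  assumes "l \<le> length fs"
  shows "p \<in> mpoly_ideal n (take l fs) \<longleftrightarrow>
    (\<exists>g. p = (\<Sum>i<l. g i * fs ! i) \<and> (\<forall>i<l. g i \<in> mpoly_ring n))"
proof -
  have "length (take l fs) = l" using assms by simp
  moreover have "(\<Sum>i<l. g i * take l fs ! i) = (\<Sum>i<l. g i * fs ! i)" for g
    by (rule sum.cong) auto
  ultimately show ?thesis unfolding mpoly_ideal_def by simp
qed

context std_graded_algebra
begin

text \<open>
  Each element of a homogeneous regular sequence multiplies the Hilbert series of the quotient by
  exactly \<open>1 - z\<^sup>d\<close>. The ideals of the definition are not graded a priori; taking homogeneous
  parts identifies their graded pieces with the \<open>ideal_piece\<close>s.
\<close>

lemma complete_intersection_hilbert_series: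
  assumes "complete_intersection scale G"
  obtains n and L :: nat and d :: "nat \<Rightarrow> nat" where "\<forall>i<L. 1 \<le> d i"
    "hilbert_series scale G * (1 - fps_X) ^ n = (\<Prod>i<L. 1 - fps_X ^ d i)"
proof -
  obtain n x fs where x: "\<forall>i<n. x i \<in> G 1" and hom: "\<forall>f\<in>set fs. homogeneous f"
    and reg: "regular_sequence n fs" and onto: "mpoly_eval scale x ` mpoly_ring n = UNIV"
    and ker: "{p \<in> mpoly_ring n. mpoly_eval scale x p = 0} = mpoly_ideal n fs"
    using assms unfolding complete_intersection_def by (elim conjE exE)
  let ?L = "length fs"
  have ring: "fs ! i \<in> mpoly_ring n" if "i < ?L" for i
    using reg that nth_mem unfolding regular_sequence_def by blast
  have "\<forall>i. \<exists>d. i < ?L \<longrightarrow> fs ! i \<in> hpoly n d"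
    using homogeneous_iff ring hom nth_mem by blast
  from choice[OF this] obtain d where d: "\<forall>i. i < ?L \<longrightarrow> fs ! i \<in> hpoly n (d i)"
    by (rule exE)
  define f where "f i = (if i < ?L then fs ! i else 0)" for i
  interpret H: homogeneous_sequence n f d
    by standard (use d in \<open>auto simp: f_def\<close>)
  have part: "hpart j p \<in> H.I l j" if lp: "l \<le> ?L" "p \<in> mpoly_ideal n (take l fs)" for p l j
  proof -
    obtain g where g: "p = (\<Sum>i<l. g i * fs ! i)" "\<forall>i<l. g i \<in> mpoly_ring n"
      using lp by (auto simp: mem_mpoly_ideal_take)
    have "hpart j (g i * fs ! i) \<in> H.I l j" if i: "i < l" for i
    proof (cases "d i \<le> j")
      case True
      have "fs ! i \<in> H.I l (d i)"
        using H.gen_in_piece[OF i] i lp(1) by (simp add: f_def)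
      then have "hpart (j - d i) (g i) * fs ! i \<in> H.I l (j - d i + d i)"
        using g(2) i by (intro H.piece_mult hpart_in) auto
      then show ?thesis
        using hpart_mult[of "fs ! i" n "d i" "g i" j] d g(2) i \<open>l \<le> ?L\<close> True by simp
    next
      case False
      then show ?thesis
        using hpart_mult[of "fs ! i" n "d i" "g i" j] d g(2) i \<open>l \<le> ?L\<close> by simp
    qed
    then show ?thesis
      unfolding g(1) hpart_sum by (intro H.piece_sum) auto
  qed
  have sub: "H.I l j \<subseteq> mpoly_ideal n (take l fs)" if "l \<le> ?L" for l j
    using that
  proof (induction l)
    case 0
    then show ?case by (simp add: mpoly_ideal_def)
  next
    case (Suc l)
    show ?case
    proof
      fix p assume "p \<in> H.I (Suc l) j"
      then obtain u v where uv: "p = u + v * f l" "u \<in> H.I l j"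
        "v \<in> (if d l \<le> j then hpoly n (j - d l) else {0})"
        by auto
      have "u \<in> mpoly_ideal n (take l fs)" using Suc uv(2) by auto
      then obtain g where g: "u = (\<Sum>i<l. g i * fs ! i)" "\<forall>i<l. g i \<in> mpoly_ring n"
        using Suc.prems by (auto simp: mem_mpoly_ideal_take)
      have "v \<in> mpoly_ring n"
        using uv(3) hpoly_mpoly_ring by (auto split: if_splits)
      then have "\<forall>i<Suc l. (g(l := v)) i \<in> mpoly_ring n" using g(2) by simp
      moreover have "p = (\<Sum>i<Suc l. (g(l := v)) i * fs ! i)"
        unfolding uv(1) g(1) using Suc.prems by (simp add: f_def)
      ultimately show "p \<in> mpoly_ideal n (take (Suc l) fs)"
        unfolding mem_mpoly_ideal_take[OF Suc.prems] by blast
    qed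
  qed
  have one: "1 \<notin> mpoly_ideal n fs" using reg by (simp add: regular_sequence_def)
  have mono: "mpoly_ideal n (take l fs) \<subseteq> mpoly_ideal n fs" if l: "l \<le> ?L" for l
  proof
    fix p assume "p \<in> mpoly_ideal n (take l fs)"
    then obtain g where g: "p = (\<Sum>i<l. g i * fs ! i)" "\<forall>i<l. g i \<in> mpoly_ring n"
      using l by (auto simp: mem_mpoly_ideal_take)
    have "p = (\<Sum>i<?L. (if i < l then g i else 0) * fs ! i)"
      unfolding g(1) using l by (intro sum.mono_neutral_cong_left) auto
    moreover have "\<forall>i<?L. (if i < l then g i else 0) \<in> mpoly_ring n" using g(2) by simp
    ultimately show "p \<in> mpoly_ideal n fs"
      unfolding mpoly_ideal_def by (auto intro!: exI[of _ "\<lambda>i. if i < l then g i else 0"])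
  qed
  have colon: "v \<in> mpoly_ideal n (take i fs)"
    if "i < ?L" "v \<in> mpoly_ring n" "v * fs ! i \<in> mpoly_ideal n (take i fs)" for i v
    using reg that unfolding regular_sequence_def by blast
  have gen: "v * fs ! i \<in> mpoly_ideal n fs" if "i < ?L" "v \<in> mpoly_ring n" for v i
  proof -
    have "v * fs ! i = (\<Sum>k<?L. (if k = i then v else 0) * fs ! k)"
      using that(1) by (simp add: if_distrib[of "\<lambda>y. y * _"] cong: if_cong)
    then show ?thesis
      unfolding mpoly_ideal_def using that(2)
      by (auto intro!: exI[of _ "\<lambda>k. if k = i then v else 0"])
  qed
  \<comment> \<open>no element of a regular sequence is a constant\<close>
  have d1: "1 \<le> d i" if i: "i < ?L" for i
  proof (rule ccontr)
    assume "\<not> 1 \<le> d i"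
    then have "fs ! i \<in> hpoly n 0" using d i by (metis less_one not_le)
    then have c: "fs ! i = Poly_Mapping.single 0 (Poly_Mapping.lookup (fs ! i) 0)" (is "_ = Poly_Mapping.single 0 ?c")
      by (rule hpoly_0_degree)
    show False
    proof (cases "?c = 0")
      case True
      then have "fs ! i = 0" by (subst c) simp
      moreover have "0 \<in> mpoly_ideal n (take i fs)"
        unfolding mpoly_ideal_def by (auto intro!: exI[of _ "\<lambda>_. 0"])
      ultimately have "1 * fs ! i \<in> mpoly_ideal n (take i fs)" by simp
      then have "1 \<in> mpoly_ideal n (take i fs)"
        using colon[OF i, of 1] hpoly_mpoly_ring[OF one_in_hpoly] by blast
      then show False using mono[of i] i one by auto
    next
      case False
      have "Poly_Mapping.single 0 (inverse ?c) * fs ! i = 1"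
        by (subst (2) c) (simp add: mult_single False)
      moreover have "Poly_Mapping.single 0 (inverse ?c) \<in> mpoly_ring n"
        by (intro hpoly_mpoly_ring[of _ n 0] hpoly_single) (simp add: monomials_0_degree)
      ultimately have "1 \<in> mpoly_ideal n fs" using gen[OF i] by metis
      then show False using one by blast
    qed
  qed
  have series: "l \<le> ?L \<Longrightarrow> H.quotient_series l * (1 - fps_X) ^ n = (\<Prod>i<l. 1 - fps_X ^ d i)" for l
  proof (induction l)
    case 0
    then show ?case by (simp add: H.quotient_series_0 monomial_series)
  next
    case (Suc l)
    have "H.quotient_series (Suc l) = (1 - fps_X ^ d l) * H.quotient_series l"
    proof (rule H.quotient_series_Suc_eq)
      fix j v assume v: "v \<in> hpoly n j" "v * f l \<in> H.I l (j + d l)"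
      have "v * fs ! l \<in> mpoly_ideal n (take l fs)"
        using v(2) sub[of l] Suc.prems by (auto simp: f_def)
      then have "v \<in> mpoly_ideal n (take l fs)"
        using colon[of l v] hpoly_mpoly_ring[OF v(1)] Suc.prems by simp
      then show "v \<in> H.I l j"
        using part[of l v j] hpart_hpoly[OF v(1), of j] Suc.prems by simp
    qed
    then show ?case using Suc by (simp add: mult_ac)
  qed
  have "H.quotient_series ?L = hilbert_series scale G"
  proof (rule fps_ext)
    fix j
    have "{p \<in> hpoly n j. mpoly_eval scale x p = 0} = H.I ?L j"
    proof (intro subset_antisym subsetI)
      fix p assume p: "p \<in> {p \<in> hpoly n j. mpoly_eval scale x p = 0}"
      then have "p \<in> mpoly_ideal n fs"
        using ker hpoly_mpoly_ring by blast
      then show "p \<in> H.I ?L j"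
        using part[of ?L p j] p hpart_hpoly[of p n j j] by simp
    next
      fix p assume p: "p \<in> H.I ?L j"
      then have "p \<in> mpoly_ideal n fs" using sub[of ?L j] by auto
      then show "p \<in> {p \<in> hpoly n j. mpoly_eval scale x p = 0}"
        using ker p H.piece_sub[of ?L j] by auto
    qed
    moreover have "mpoly_eval scale x ` hpoly n j = G j"
    proof (intro subset_antisym subsetI)
      fix y assume "y \<in> mpoly_eval scale x ` hpoly n j"
      then show "y \<in> G j" using eval_in[OF x] by blast
    next
      fix y assume y: "y \<in> G j"
      obtain p where p: "p \<in> mpoly_ring n" "y = mpoly_eval scale x p"
        using onto by (metis UNIV_I imageE)
      obtain N where N: "p = (\<Sum>i\<le>N. hpart i p)" by (rule sum_hpart)
      have in_G: "mpoly_eval scale x (hpart i p) \<in> G i" for i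
        by (rule eval_in[OF x hpart_in[OF p(1)]])
      have hp: "hpart j p = (\<Sum>i\<le>N. if i = j then hpart i p else 0)"
        by (subst N) (simp add: hpart_sum hpart_hpoly[OF hpart_in[OF p(1)]] cong: if_cong)
      have "y = hom_part j y" using y by (simp add: hom_part_eqI)
      also have "\<dots> = (\<Sum>i\<le>N. hom_part j (mpoly_eval scale x (hpart i p)))"
        unfolding p(2) by (subst N) (simp add: eval_sum hom_part_sum)
      also have "\<dots> = (\<Sum>i\<le>N. if i = j then mpoly_eval scale x (hpart i p) else 0)"
        by (intro sum.cong refl) (auto simp: hom_part_eqI[OF in_G])
      also have "\<dots> = mpoly_eval scale x (hpart j p)"
        using arg_cong[OF hp, of "mpoly_eval scale x"]
        by (cases "j \<le> N") (simp_all add: sum.delta)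
      finally show "y \<in> mpoly_eval scale x ` hpoly n j" using hpart_in[OF p(1)] by blast
    qed
    ultimately show "fps_nth (H.quotient_series ?L) j = fps_nth (hilbert_series scale G) j"
      using PA.rank_nullity[OF linear_eval[of x] subspace_hpoly, of n j] hpoly_dim[of n j, where 'k = 'k]
      unfolding H.quotient_series_def hilbert_series_def by simp
  qed
  then show thesis
    using that[of ?L d n] d1 series[of ?L] by simp
qed

end


subsection \<open>Koszul complete intersections are quadratic\<close>

lemma fps_mult_nth_012:
  fixes f g :: "'a::comm_ring_1 fps"
  shows "fps_nth (f * g) 0 = fps_nth f 0 * fps_nth g 0"
    "fps_nth (f * g) (Suc 0) = fps_nth f 0 * fps_nth g (Suc 0) + fps_nth f (Suc 0) * fps_nth g 0"
    "fps_nth (f * g) 2 = fps_nth f 0 * fps_nth g 2 + fps_nth f (Suc 0) * fps_nth g (Suc 0) + fps_nth f 2 * fps_nth g 0"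
  by (simp_all add: fps_mult_nth numeral_2_eq_2)

lemma one_minus_X_power_nth:
  "fps_nth ((1 - fps_X :: int fps) ^ k) 0 = 1" "fps_nth ((1 - fps_X :: int fps) ^ k) (Suc 0) = - int k"
  by (induction k) (simp_all add: fps_mult_nth_012)

lemma one_minus_X2_power_nth:
  "fps_nth ((1 - fps_X ^ 2 :: int fps) ^ k) 0 = 1" "fps_nth ((1 - fps_X ^ 2 :: int fps) ^ k) (Suc 0) = 0"
  "fps_nth ((1 - fps_X ^ 2 :: int fps) ^ k) 2 = - int k"
  by (induction k) (simp_all add: fps_mult_nth_012 fps_X_power_nth)

context std_graded_algebra
begin

lemma hilbert_series_nth: "fps_nth (hilbert_series scale G) j = int (a_dim j)"
  by (simp add: hilbert_series_def)

lemma a_dim_1: "a_dim (Suc 0) = edim"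
  by (simp add: edim_def)

text \<open>
  Linear forms in the regular sequence only remove variables. A form of degree at least three
  would lower the order of the pole at \<open>1\<close> without contributing a quadric, which
  \<open>koszul_pole_order\<close> forbids.
\<close>

lemma koszul_complete_intersection:
  assumes "koszul scale G" "complete_intersection scale G"
  obtains m where "hilbert_series scale G * (1 - fps_X) ^ edim = (1 - fps_X ^ 2) ^ m" "m \<le> edim"
proof -
  let ?H = "hilbert_series scale G"
  obtain n and L :: nat and d :: "nat \<Rightarrow> nat" where d: "\<forall>i<L. 1 \<le> d i" and series: "?H * (1 - fps_X) ^ n = (\<Prod>i<L. 1 - fps_X ^ d i)"
    by (rule complete_intersection_hilbert_series[OF assms(2)])
  define A where "A = {i. i < L \<and> d i = 1}"
  define B where "B = {i. i < L \<and> d i = 2}"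
  define C where "C = {i. i < L \<and> d i \<ge> 3}"
  have fin: "finite A" "finite B" "finite C" by (simp_all add: A_def B_def C_def)
  let ?c = "\<lambda>i. 1 - fps_X ^ d i :: int fps"
  have "d i = 1 \<or> d i = 2 \<or> d i \<ge> 3" if "i < L" for i
    using d that by (metis One_nat_def Suc_leI le_neq_implies_less numeral_2_eq_2 numeral_3_eq_3)
  then have "{..<L} = A \<union> (B \<union> C)"
    by (auto simp: A_def B_def C_def)
  then have "prod ?c {..<L} = prod ?c A * (prod ?c B * prod ?c C)"
    using fin by (simp add: prod.union_disjoint A_def B_def C_def disjoint_iff)
  moreover have "prod ?c A = (1 - fps_X) ^ card A" "prod ?c B = (1 - fps_X ^ 2) ^ card B"
    by (simp_all add: A_def B_def)
  ultimately have series': "?H * (1 - fps_X) ^ n = (1 - fps_X) ^ card A * ((1 - fps_X ^ 2) ^ card B * prod ?c C)"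
    using series by simp
  have C_low: "fps_nth (prod ?c C') 0 = 1 \<and> fps_nth (prod ?c C') (Suc 0) = 0 \<and> fps_nth (prod ?c C') 2 = 0"
    if "C' \<subseteq> C" for C'
    using finite_subset[OF that fin(3)] that
  proof (induction C')
    case (insert i C')
    then have "d i \<ge> 3" by (auto simp: C_def)
    then show ?case using insert by (auto simp: fps_mult_nth_012 fps_X_power_nth)
  qed simp
  define E where "E = (1 - fps_X ^ 2) ^ card B * prod ?c C"
  have E_low: "fps_nth E 0 = 1" "fps_nth E (Suc 0) = 0" "fps_nth E 2 = - int (card B)"
    using C_low[of C] unfolding E_def by (simp_all add: fps_mult_nth_012 one_minus_X2_power_nth)
  \<comment> \<open>the linear forms only remove variables\<close>
  have "fps_nth (?H * (1 - fps_X) ^ n) (Suc 0) = fps_nth ((1 - fps_X) ^ card A * E) (Suc 0)"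
    unfolding series' E_def ..
  then have n: "n = edim + card A"
    unfolding fps_mult_nth_012(2) E_low
    by (simp add: one_minus_X_power_nth E_low hilbert_series_nth a_dim_1 dim_G_0)
  have nz: "(1 - fps_X :: int fps) ^ k \<noteq> 0" for k
    using one_minus_X_power_nth(1)[of k] by (metis fps_zero_nth zero_neq_one)
  have HE: "?H * (1 - fps_X) ^ edim = E"
  proof -
    have "(1 - fps_X) ^ card A * (?H * (1 - fps_X) ^ edim) = (1 - fps_X) ^ card A * E"
      using series' unfolding n power_add E_def by (simp only: mult_ac)
    then show ?thesis using nz mult_cancel_left by blast
  qed
  have H2: "card B + a_dim 2 = card (monomials edim 2)"
  proof -
    have "?H = E * monomial_series edim"
      unfolding HE[symmetric] using monomial_series[of edim] by (simp add: mult.assoc mult.commute)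
    then have "fps_nth ?H 2 = fps_nth (E * monomial_series edim) 2" by simp
    then have "int (a_dim 2) = int (card (monomials edim 2)) - int (card B)"
      unfolding fps_mult_nth_012(3) E_low
      by (simp add: hilbert_series_nth monomial_series_def monomials_0_degree)
    then show ?thesis by linarith
  qed
  \<comment> \<open>the pole order at \<open>1\<close>\<close>
  define w :: "int poly" where "w = (\<Prod>i\<in>B \<union> C. \<Sum>k<d i. monom 1 k)"
  have w_fps: "fps_of_poly w = (\<Prod>i\<in>B \<union> C. \<Sum>k<d i. fps_X ^ k)"
    unfolding w_def by (simp add: fps_of_poly_prod fps_of_poly_sum fps_of_poly_monom')
  have w1: "poly w 1 > 0"
  proof -
    have "poly w 1 = (\<Prod>i\<in>B \<union> C. int (d i))"
      unfolding w_def by (simp add: poly_prod poly_sum poly_monom)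
    also have "\<dots> > 0" by (rule prod_pos) (auto simp: B_def C_def)
    finally show ?thesis .
  qed
  have E_w: "E = (1 - fps_X) ^ (card B + card C) * fps_of_poly w"
  proof -
    have "E = prod ?c B * prod ?c C" by (simp add: B_def E_def)
    also have "\<dots> = prod ?c (B \<union> C)"
      using fin by (subst prod.union_disjoint) (auto simp: B_def C_def)
    also have "\<dots> = (\<Prod>i\<in>B \<union> C. (1 - fps_X) * (\<Sum>k<d i. fps_X ^ k))"
      by (simp only: one_diff_power_eq)
    also have "\<dots> = (1 - fps_X) ^ card (B \<union> C) * fps_of_poly w"
      unfolding w_fps prod.distrib by simp
    also have "card (B \<union> C) = card B + card C"
      using fin by (intro card_Un_disjoint) (auto simp: B_def C_def)
    finally show ?thesis .
  qed
  have le: "card B + card C \<le> edim"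
  proof (rule ccontr)
    assume "\<not> card B + card C \<le> edim"
    then obtain k where k: "card B + card C = edim + Suc k"
      by (metis add_Suc_right less_imp_Suc_add not_le)
    have "?H * (1 - fps_X) ^ edim = (1 - fps_X) ^ edim * ((1 - fps_X) ^ Suc k * fps_of_poly w)"
      unfolding HE E_w k power_add by (simp only: mult_ac)
    then have "(1 - fps_X) ^ edim * ?H = (1 - fps_X) ^ edim * ((1 - fps_X) ^ Suc k * fps_of_poly w)"
      by (simp only: mult.commute)
    then have "?H = (1 - fps_X) ^ Suc k * fps_of_poly w"
      using nz mult_cancel_left by blast
    also have "\<dots> = fps_of_poly ([:1, -1:] ^ Suc k * w)"
      by (simp add: fps_of_poly_mult fps_of_poly_power fps_of_poly_pCons del: power_Suc)
    finally have H: "?H = fps_of_poly ([:1, -1:] ^ Suc k * w)" .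
    define v where "v = [:1, -1:] ^ Suc k * w"
    have "coeff v i = int (a_dim i)" for i
      using arg_cong[OF H, of "\<lambda>f. fps_nth f i"] by (simp add: hilbert_series_nth v_def del: power_Suc)
    then have "poly v 1 = (\<Sum>i\<le>degree v. int (a_dim i))"
      unfolding poly_altdef by simp
    moreover have "int (a_dim 0) \<le> (\<Sum>i\<le>degree v. int (a_dim i))"
      by (rule member_le_sum) auto
    moreover have "poly v 1 = 0" by (simp add: v_def)
    ultimately show False by (simp add: dim_G_0)
  qed
  have "?H * (1 - fps_X) ^ (edim - (card B + card C)) = fps_of_poly w"
  proof -
    have "(1 - fps_X) ^ (card B + card C) * (?H * (1 - fps_X) ^ (edim - (card B + card C)))
      = ?H * ((1 - fps_X) ^ (card B + card C) * (1 - fps_X) ^ (edim - (card B + card C)))"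
      by (simp only: mult_ac)
    also have "\<dots> = (1 - fps_X) ^ (card B + card C) * fps_of_poly w"
      unfolding power_add[symmetric] using HE E_w le by simp
    finally show ?thesis using nz mult_cancel_left by blast
  qed
  from koszul_pole_order[OF assms(1) this]
  have "card C = 0" using H2 le by linarith
  then have "prod ?c C = 1" using fin(3) by simp
  then show thesis
    using that[of "card B"] HE le by (simp add: E_def)
qed

end


section \<open>Bounding chains of primes by the growth of the algebra\<close>

definition prime_chain :: "nat \<Rightarrow> (nat \<Rightarrow> 'r::comm_ring_1 set) \<Rightarrow> bool" where
  "prime_chain l P \<longleftrightarrow> (\<forall>i\<le>l. prime_ideal (P i)) \<and> (\<forall>i<l. P i \<subset> P (Suc i))"

lemma prime_ideal_ideal: "prime_ideal P \<Longrightarrow> module.subspace (*) P"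
  by (simp add: prime_ideal_def)

context graded_algebra
begin

lemma ideal_subspace: "module.subspace (*) I \<Longrightarrow> subspace I"
  unfolding subspace_def ideal_iff by (metis scale_1_mult)

definition filt :: "nat \<Rightarrow> 'r set" where
  "filt j = {x. \<forall>i>j. hom_part i x = 0}"

lemma subspace_filt: "subspace (filt j)"
  unfolding subspace_def filt_def by (auto simp: hom_part_add hom_part_scale)

lemma filt_mono: "i \<le> j \<Longrightarrow> filt i \<subseteq> filt j"
  unfolding filt_def by auto

lemma ex_filt: "\<exists>j. x \<in> filt j"
  using hom_part_bound[of x] unfolding filt_def by blast

lemma filt_mult:
  assumes "a \<in> filt s" "x \<in> filt j"
  shows "a * x \<in> filt (s + j)"
  unfolding filt_def
proof (intro CollectI allI impI)
  fix k assume k: "k > s + j"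
  have a: "a = (\<Sum>i\<le>s. hom_part i a)"
    using sum_hom_part[of "{..s}" a] assms(1) by (simp add: filt_def)
  have "hom_part k (hom_part i a * x) = 0" if "i \<le> s" for i
    using hom_part_mult_hom[OF hom_part_in[of i a], of k x] assms(2) k that by (auto simp: filt_def)
  then have "(\<Sum>i\<le>s. hom_part k (hom_part i a * x)) = 0" by simp
  then show "hom_part k (a * x) = 0"
    by (subst a) (simp add: sum_distrib_right hom_part_sum)
qed

end

context std_graded_algebra
begin

lemma one_in_filt: "1 \<in> filt j"
  by (simp add: filt_def hom_part_eqI[OF one_in_G0])

sublocale AA: vector_space_pair scale scale ..

lemma filt_dim: "local.fin_dim (filt j) \<and> local.dim (filt j) \<le> (\<Sum>i\<le>j. a_dim i)"
proof (induction j)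
  case 0
  have "x \<in> G 0" if "x \<in> filt 0" for x
  proof -
    have "hom_part 0 x = x"
      using sum_hom_part[of "{0}" x] that by (simp add: filt_def)
    then show ?thesis using hom_part_in[of 0 x] by metis
  qed
  then have "filt 0 \<subseteq> G 0" by blast
  then show ?case
    using fin_dim_subset[OF fin_dim_G] fin_dim_dim_subset[OF fin_dim_G] by simp
next
  case (Suc j)
  let ?W = "{u + id v | u v. u \<in> filt j \<and> v \<in> G (Suc j)}"
  have lin: "Vector_Spaces.linear scale scale id"
    by (rule linear_id)
  have "local.dim ?W \<le> local.dim (filt j) + a_dim (Suc j)"
    using AA.dim_sum_image[OF lin subspace_G fin_dim_G subspace_filt conjunct1[OF Suc], of "Suc j"] by linarith
  moreover have fd: "local.fin_dim ?W"
    using fin_dim_sums[OF conjunct1[OF Suc] fin_dim_G[of "Suc j"]] by simp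
  moreover have "filt (Suc j) \<subseteq> ?W"
  proof
    fix x assume x: "x \<in> filt (Suc j)"
    have "x - hom_part (Suc j) x \<in> filt j"
      unfolding filt_def
    proof (intro CollectI allI impI)
      fix i assume "i > j"
      then show "hom_part i (x - hom_part (Suc j) x) = 0"
        using x by (cases "i = Suc j") (auto simp: filt_def hom_part_diff hom_part_eqI[OF hom_part_in])
    qed
    moreover have "x = (x - hom_part (Suc j) x) + id (hom_part (Suc j) x)" by simp
    ultimately show "x \<in> ?W" by blast
  qed
  ultimately show ?case
    using fin_dim_subset[OF fd] fin_dim_dim_subset[OF fd, of "filt (Suc j)"] Suc by auto
qed

text \<open>
  A Hilbert function for \<open>R / P\<close> that makes sense for inhomogeneous \<open>P\<close>: dimensions are taken
  along the filtration by degree.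
\<close>

definition filt_codim :: "'r set \<Rightarrow> nat \<Rightarrow> int" where
  "filt_codim P j = int (local.dim (filt j)) - int (local.dim (filt j \<inter> P))"

lemma fd_filt: "local.fin_dim (filt j)"
  using filt_dim by blast

lemma filt_codim_nonneg: "0 \<le> filt_codim P j"
  unfolding filt_codim_def using fin_dim_dim_subset[OF fd_filt, of "filt j \<inter> P" j] by simp

lemma filt_codim_le: "filt_codim P j \<le> int (\<Sum>i\<le>j. a_dim i)"
  unfolding filt_codim_def using filt_dim[of j] by linarith

lemma subspace_filt_Int: "module.subspace (*) P \<Longrightarrow> subspace (filt j \<inter> P)"
  by (intro subspace_inter subspace_filt ideal_subspace)

lemma filt_codim_pos:
  assumes "prime_ideal P"
  shows "1 \<le> filt_codim P j"
proof (rule ccontr)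
  assume "\<not> 1 \<le> filt_codim P j"
  then have "local.dim (filt j) \<le> local.dim (filt j \<inter> P)"
    unfolding filt_codim_def by linarith
  then have "filt j \<inter> P = filt j"
    by (intro fin_dim_subspace_eq subspace_filt_Int prime_ideal_ideal assms fd_filt) auto
  then have "1 \<in> P" using one_in_filt by blast
  then show False using assms by (simp add: prime_ideal_def)
qed

text \<open>
  An element \<open>a\<close> of \<open>P' - P\<close> is a nonzerodivisor modulo \<open>P\<close>, so the quotient by \<open>P'\<close> is
  smaller than that by \<open>P\<close> at least by a shifted copy of the latter.
\<close>

lemma filt_codim_step:
  assumes P: "prime_ideal P" and P': "module.subspace (*) P'" "P \<subseteq> P'"
    and a: "a \<in> P'" "a \<notin> P" "a \<in> filt s"
  shows "filt_codim P' (s + j) + filt_codim P j \<le> filt_codim P (s + j)"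
proof -
  have idP: "module.subspace (*) P" by (rule prime_ideal_ideal[OF P])
  let ?W = "{u + a * v | u v. u \<in> filt (s + j) \<inter> P \<and> v \<in> filt j}"
  have "{v \<in> filt j. a * v \<in> filt (s + j) \<inter> P} = filt j \<inter> P"
  proof -
    have "a * v \<in> P \<longleftrightarrow> v \<in> P" for v
      using P a(2) idP unfolding prime_ideal_def ideal_iff by blast
    then show ?thesis using filt_mult[OF a(3)] by blast
  qed
  then have "local.dim ?W + local.dim (filt j \<inter> P) = local.dim (filt (s + j) \<inter> P) + local.dim (filt j)"
    using AA.dim_sum_image[OF linear_mult[of a] subspace_filt[of j] fd_filt
      subspace_filt_Int[OF idP] fin_dim_subset[OF fd_filt Int_lower1], of "s + j"] by simp
  moreover have "?W \<subseteq> filt (s + j) \<inter> P'"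
  proof clarify
    fix u v assume uv: "u \<in> filt (s + j)" "u \<in> P" "v \<in> filt j"
    have "a * v \<in> P'" using P'(1) a(1) unfolding ideal_iff by (metis mult.commute)
    then have "u + a * v \<in> P'" using P' uv(2) unfolding ideal_iff by blast
    moreover have "u + a * v \<in> filt (s + j)"
      using subspace_add[OF subspace_filt uv(1) filt_mult[OF a(3) uv(3)]] .
    ultimately show "u + a * v \<in> filt (s + j) \<inter> P'" by blast
  qed
  then have "local.dim ?W \<le> local.dim (filt (s + j) \<inter> P')"
    by (rule fin_dim_dim_subset[OF fin_dim_subset[OF fd_filt Int_lower1]])
  ultimately show ?thesis unfolding filt_codim_def by linarith
qed

text \<open>
  By \<open>filt_codim_step\<close> each prime, from the top of the chain downwards, adds one to the degree of
  growth of the quotient.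
\<close>

lemma prime_chain_growth:
  "prime_chain l P \<Longrightarrow> \<exists>s\<ge>1. \<forall>j. int (j choose l) \<le> filt_codim (P 0) (s * j)"
proof (induction l arbitrary: P)
  case 0
  then have "prime_ideal (P 0)" by (simp add: prime_chain_def)
  then show ?case using filt_codim_pos by (intro exI[of _ 1]) auto
next
  case (Suc l)
  have "prime_chain l (\<lambda>i. P (Suc i))"
    using Suc.prems by (simp add: prime_chain_def)
  then obtain s' where s': "s' \<ge> 1" "\<forall>j. int (j choose l) \<le> filt_codim (P 1) (s' * j)"
    using Suc.IH by fastforce
  have P0: "prime_ideal (P 0)" and P1: "prime_ideal (P 1)" and P01: "P 0 \<subset> P 1"
    using Suc.prems by (auto simp: prime_chain_def)
  obtain a where a: "a \<in> P 1" "a \<notin> P 0" using P01 by blast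
  obtain t where t: "a \<in> filt t" using ex_filt by blast
  define s where "s = s' * (t + 1)"
  have "t \<le> s" using s'(1) unfolding s_def by (metis le_add1 le_trans mult_le_mono1 nat_mult_1)
  then have as: "a \<in> filt s" using t filt_mono by blast
  have "int (j choose Suc l) \<le> filt_codim (P 0) (s * j)" for j
  proof (induction j)
    case 0
    then show ?case using filt_codim_nonneg by simp
  next
    case (Suc j)
    have "int (j choose l) \<le> int (((t + 1) * Suc j) choose l)"
      using binomial_right_mono[of j "(t + 1) * Suc j" l] by simp
    also have "\<dots> \<le> filt_codim (P 1) (s * Suc j)"
      using s'(2) unfolding s_def mult.assoc by blast
    finally have "int (j choose l) + int (j choose Suc l) \<le> filt_codim (P 1) (s + s * j) + filt_codim (P 0) (s * j)"
      using Suc by simp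
    also have "\<dots> \<le> filt_codim (P 0) (s + s * j)"
      using filt_codim_step[OF P0 prime_ideal_ideal[OF P1] _ a as] P01 by blast
    finally show ?case by simp
  qed
  then show ?case using s'(1) unfolding s_def[symmetric]
    by (intro exI[of _ s]) (auto simp: s_def)
qed

lemma prime_chain_bound:
  fixes P :: "nat \<Rightarrow> 'r set"
  assumes "prime_chain l P" "\<And>j. int (a_dim j) \<le> fps_nth S j"
    "S * (1 - fps_X) ^ p = fps_of_poly h"
  shows "l \<le> p"
proof -
  obtain s where s: "s \<ge> 1" "\<forall>j. int (j choose l) \<le> filt_codim (P 0) (s * j)"
    using prime_chain_growth[OF assms(1)] by blast
  obtain C where C: "\<And>j. \<bar>real_of_int (fps_nth (S * geometric_series) j)\<bar> \<le> C * real (j + 1) ^ p"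
    using rational_series_growth[OF assms(3)] unfolding polynomial_growth_def by blast
  have C0: "0 \<le> C" using C[of 0] by simp
  have "real (j choose l) \<le> (C * real s ^ p) * real (j + 1) ^ p" for j
  proof -
    have "int (j choose l) \<le> (\<Sum>i\<le>s * j. int (a_dim i))"
      using s(2) filt_codim_le[of "P 0" "s * j"] order_trans by fastforce
    also have "\<dots> \<le> (\<Sum>i\<le>s * j. fps_nth S i)" by (intro sum_mono assms(2))
    also have "\<dots> = fps_nth (S * geometric_series) (s * j)"
      by (simp add: fps_mult_nth geometric_series_def atMost_atLeast0)
    finally have "real (j choose l) \<le> real_of_int (fps_nth (S * geometric_series) (s * j))"
      by linarith
    also have "\<dots> \<le> C * real (s * j + 1) ^ p" using C[of "s * j"] by linarith
    also have "\<dots> \<le> C * real (s * (j + 1)) ^ p"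
      using s(1) C0 by (intro mult_left_mono power_mono) (simp_all del: of_nat_mult of_nat_add)
    also have "\<dots> = (C * real s ^ p) * real (j + 1) ^ p"
      unfolding of_nat_mult power_mult_distrib by (simp only: mult_ac)
    finally show ?thesis .
  qed
  then show ?thesis by (rule binomial_growth)
qed


section \<open>Ascending chains of homogeneous ideals\<close>

definition hom_ideal :: "'r set \<Rightarrow> bool" where
  "hom_ideal I \<longleftrightarrow> module.subspace (*) I \<and> (\<forall>x\<in>I. \<forall>j. hom_part j x \<in> I)"

abbreviation "mon \<equiv> mon_eval var"

definition smaller :: "(nat \<Rightarrow>\<^sub>0 nat) \<Rightarrow> (nat \<Rightarrow>\<^sub>0 nat) set" where
  "smaller m = {m' \<in> monomials edim (mdeg m). m' < m}"

text \<open>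
  The standard monomials of an ideal for the lexicographic order: those that do not lead an
  element of the ideal.
\<close>

definition std :: "'r set \<Rightarrow> (nat \<Rightarrow>\<^sub>0 nat) set" where
  "std I = {m. Poly_Mapping.keys m \<subseteq> {..<edim} \<and>
     mon m \<notin> {y + z | y z. y \<in> I \<and> z \<in> span (mon ` smaller m)}}"

lemma std_antimono: "I \<subseteq> I' \<Longrightarrow> std I' \<subseteq> std I"
  unfolding std_def by blast

lemma std_multiple:
  assumes I: "hom_ideal I" and m: "m \<notin> std I" "Poly_Mapping.keys m \<subseteq> {..<edim}"
  shows "m + c \<notin> std I"
proof
  assume std: "m + c \<in> std I"
  have c: "Poly_Mapping.keys c \<subseteq> {..<edim}" using std by (auto simp: std_def keys_add_nat)
  obtain y z where yz: "mon m = y + z" "y \<in> I" "z \<in> span (mon ` smaller m)"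
    using m unfolding std_def by blast
  have "z * mon c \<in> span ((\<lambda>x. x * mon c) ` mon ` smaller m)"
    using AA.linear_span_image[OF linear_mult_right[of "mon c"], of "mon ` smaller m"] yz(3) by blast
  also have "span ((\<lambda>x. x * mon c) ` mon ` smaller m) \<subseteq> span (mon ` smaller (m + c))"
  proof (rule span_mono, clarify)
    fix m' assume m': "m' \<in> smaller m"
    have "c \<in> monomials edim (mdeg c)" using c by (simp add: monomials_def)
    then have "m' + c \<in> monomials edim (mdeg (m + c))"
      using m' monomials_add unfolding mdeg_add smaller_def by blast
    moreover have "m' + c < m + c" using m' by (simp add: smaller_def)
    ultimately have "m' + c \<in> smaller (m + c)" by (simp add: smaller_def)
    then show "mon m' * mon c \<in> mon ` smaller (m + c)"
      by (metis imageI mon_eval_add)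
  qed
  finally have "z * mon c \<in> span (mon ` smaller (m + c))" .
  moreover have "y * mon c \<in> I"
    using I yz(2) unfolding hom_ideal_def ideal_iff by (metis mult.commute)
  moreover have "mon (m + c) = y * mon c + z * mon c"
    unfolding mon_eval_add yz(1) by (rule distrib_right)
  ultimately show False using std unfolding std_def by blast
qed

lemma G_eq_span_std:
  assumes I: "hom_ideal I" and x: "x \<in> G j"
  obtains y c where "y \<in> I" "x = y + (\<Sum>m\<in>std I \<inter> monomials edim j. scale (c m) (mon m))"
proof -
  let ?S = "std I \<inter> monomials edim j"
  define W where "W = {y + z | y z. y \<in> I \<and> z \<in> span (mon ` ?S)}"
  have subI: "subspace I" using I ideal_subspace by (simp add: hom_ideal_def)
  have W: "subspace W" unfolding W_def by (rule subspace_sums[OF subI subspace_span])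
  have IW: "I \<subseteq> W" unfolding W_def using span_zero[of "mon ` ?S"] by force
  have SW: "mon m \<in> W" if "m \<in> ?S" for m
    unfolding W_def using subspace_0[OF subI] span_base[of "mon m" "mon ` ?S"] that by force
  have mon_W: "mon m \<in> W" if "m \<in> monomials edim j" for m
  proof (rule ccontr)
    let ?B = "{m \<in> monomials edim j. mon m \<notin> W}"
    assume "mon m \<notin> W"
    then have ne: "?B \<noteq> {}" using that by blast
    have fin: "finite ?B" using finite_monomials by simp
    define m0 where "m0 = Min ?B"
    have m0: "m0 \<in> ?B" unfolding m0_def by (rule Min_in[OF fin ne])
    have small: "mon m' \<in> W" if "m' \<in> smaller m0" for m'
    proof (rule ccontr)
      assume "mon m' \<notin> W"
      then have "m' \<in> ?B" using that m0 by (auto simp: smaller_def monomials_def)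
      then have "m0 \<le> m'" unfolding m0_def using fin by (intro Min_le)
      then show False using that leD unfolding smaller_def by blast
    qed
    have "m0 \<notin> std I" using m0 SW by blast
    then obtain y z where yz: "mon m0 = y + z" "y \<in> I" "z \<in> span (mon ` smaller m0)"
      using m0 unfolding std_def by (auto simp: monomials_def)
    have "z \<in> W" using yz(3) span_minimal[OF _ W, of "mon ` smaller m0"] small by blast
    then have "mon m0 \<in> W" unfolding yz(1) using subspace_add[OF W] IW yz(2) by blast
    then show False using m0 by blast
  qed
  obtain p where p: "p \<in> hpoly edim j" "ev p = x" using ev_surj[OF x] by blast
  have "ev p \<in> W"
    unfolding mpoly_eval_eq linear_extension_def
    by (intro subspace_sum[OF W] subspace_scale[OF W] mon_W) (use p(1) in \<open>auto simp: hpoly_def\<close>)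
  then obtain y z where yz: "x = y + z" "y \<in> I" "z \<in> span (mon ` ?S)"
    unfolding p(2) W_def by blast
  have "z \<in> range (\<lambda>c. \<Sum>m\<in>?S. scale (c m) (mon m))"
  proof -
    let ?R = "range (\<lambda>c. \<Sum>m\<in>?S. scale (c m) (mon m))"
    have "subspace ?R"
      unfolding subspace_def
    proof (intro conjI ballI allI)
      show "0 \<in> ?R" by (rule range_eqI[of _ _ "\<lambda>_. 0"]) simp
    next
      fix u v assume "u \<in> ?R" "v \<in> ?R"
      then obtain c c' where "u = (\<Sum>m\<in>?S. scale (c m) (mon m))" "v = (\<Sum>m\<in>?S. scale (c' m) (mon m))"
        by blast
      then show "u + v \<in> ?R"
        by (intro range_eqI[of _ _ "\<lambda>m. c m + c' m"]) (simp add: scale_left_distrib sum.distrib)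
    next
      fix a u assume "u \<in> ?R"
      then obtain c where "u = (\<Sum>m\<in>?S. scale (c m) (mon m))" by blast
      then show "scale a u \<in> ?R"
        by (intro range_eqI[of _ _ "\<lambda>m. a * c m"]) (simp add: scale_sum_right)
    qed
    moreover have "mon ` ?S \<subseteq> ?R"
    proof clarify
      fix m assume m: "m \<in> std I" "m \<in> monomials edim j"
      have fin: "finite ?S" using finite_monomials by simp
      have "(\<Sum>m'\<in>?S. scale (if m' = m then 1 else 0) (mon m')) = (\<Sum>m'\<in>?S. if m' = m then mon m' else 0)"
        by (intro sum.cong) auto
      then have "mon m = (\<Sum>m'\<in>?S. scale (if m' = m then 1 else 0) (mon m'))"
        using m fin by (simp add: sum.delta)
      then show "mon m \<in> ?R" by (rule range_eqI[of _ _ "\<lambda>m'. if m' = m then 1 else 0"])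
    qed
    ultimately show ?thesis using yz(3) span_minimal by blast
  qed
  then show thesis using that yz by blast
qed

text \<open>
  Standard monomials of \<open>I\<close> give normal forms modulo \<open>I\<close>. The normal form of an element of
  \<open>I'\<close> outside \<open>I\<close> is nonzero, and its largest monomial is not standard for \<open>I'\<close>.
\<close>

lemma std_strict:
  assumes I: "hom_ideal I" and I': "hom_ideal I'" and sub: "I \<subset> I'"
  shows "\<exists>m. m \<in> std I \<and> m \<notin> std I'"
proof (rule ccontr)
  assume no: "\<not> (\<exists>m. m \<in> std I \<and> m \<notin> std I')"
  obtain x where x: "x \<in> I'" "x \<notin> I" using sub by blast
  obtain N where N: "(\<Sum>i\<le>N. hom_part i x) = x" using hom_part_bound by blast
  have "\<exists>j. hom_part j x \<notin> I"
  proof (rule ccontr)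
    assume "\<nexists>j. hom_part j x \<notin> I"
    then have "(\<Sum>i\<le>N. hom_part i x) \<in> I"
      using I by (intro ideal_sum) (auto simp: hom_ideal_def)
    then show False using x(2) N by simp
  qed
  then obtain j where j: "hom_part j x \<notin> I" by blast
  let ?x = "hom_part j x" and ?S = "std I \<inter> monomials edim j"
  have x': "?x \<in> I'" using I' x(1) by (simp add: hom_ideal_def)
  obtain y c where yc: "y \<in> I" "?x = y + (\<Sum>m\<in>?S. scale (c m) (mon m))"
    by (rule G_eq_span_std[OF I hom_part_in])
  define v where "v = (\<Sum>m\<in>?S. scale (c m) (mon m))"
  have idI': "module.subspace (*) I'" using I' by (simp add: hom_ideal_def)
  have v: "v \<in> I'"
    using ideal_diff[OF idI' x', of y] yc sub unfolding v_def by auto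
  let ?B = "{m \<in> ?S. c m \<noteq> 0}"
  have finS: "finite ?S" using finite_monomials by simp
  have fin: "finite ?B" by (rule finite_subset[OF _ finS]) blast
  have ne: "?B \<noteq> {}"
  proof
    assume "?B = {}"
    then have "v = 0" unfolding v_def by (intro sum.neutral) auto
    then show False using j yc by (simp add: v_def)
  qed
  define m0 where "m0 = Max ?B"
  have m0: "m0 \<in> ?B" unfolding m0_def by (rule Max_in[OF fin ne])
  define w where "w = (\<Sum>m\<in>?S - {m0}. scale (c m) (mon m))"
  have "v = scale (c m0) (mon m0) + w"
    unfolding v_def w_def using m0 finS by (intro sum.remove) auto
  then have "scale (c m0) (mon m0) = v - w" by simp
  then have "scale (inverse (c m0)) (scale (c m0) (mon m0)) = scale (inverse (c m0)) (v - w)"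
    by simp
  then have eq: "mon m0 = scale (inverse (c m0)) v + scale (- inverse (c m0)) w"
    using m0 by (simp add: scale_right_diff_distrib)
  have "scale (inverse (c m0)) v \<in> I'"
    by (rule subspace_scale[OF ideal_subspace[OF idI'] v])
  moreover have "scale (- inverse (c m0)) w \<in> span (mon ` smaller m0)"
  proof (rule span_scale, unfold w_def, rule span_sum)
    fix m assume m: "m \<in> ?S - {m0}"
    show "scale (c m) (mon m) \<in> span (mon ` smaller m0)"
    proof (cases "c m = 0")
      case True
      then show ?thesis using span_zero by simp
    next
      case False
      then have "m \<le> m0" using m fin unfolding m0_def by (intro Max_ge) auto
      then have "m < m0" using m by (simp add: less_le)
      then have "m \<in> smaller m0" using m m0 by (auto simp: smaller_def monomials_def)
      then show ?thesis by (intro span_scale span_base) simp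
    qed
  qed
  ultimately have "m0 \<notin> std I'"
    unfolding std_def using eq by blast
  then show False using no m0 by blast
qed

end

lemma monotone_subsequence_nat:
  fixes f :: "nat \<Rightarrow> nat"
  shows "\<exists>g. strict_mono g \<and> incseq (\<lambda>t. f (g t))"
proof -
  obtain g where g: "strict_mono g" "monoseq (\<lambda>t. f (g t))"
    using seq_monosub[of f] by auto
  show ?thesis
  proof (cases "incseq (\<lambda>t. f (g t))")
    case True
    then show ?thesis using g(1) by blast
  next
    case False
    then have dec: "decseq (\<lambda>t. f (g t))" using g(2) by (simp add: monoseq_iff)
    \<comment> \<open>a decreasing sequence of natural numbers is constant from its minimum on\<close>
    define v where "v = (LEAST v. v \<in> range (\<lambda>t. f (g t)))"
    have "v \<in> range (\<lambda>t. f (g t))"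
      unfolding v_def by (rule LeastI[of _ "f (g 0)"]) simp
    then obtain N where N: "v = f (g N)" by blast
    have "f (g (N + t)) = v" for t
    proof (rule antisym)
      show "f (g (N + t)) \<le> v" unfolding N using dec by (simp add: decseq_def)
      show "v \<le> f (g (N + t))" unfolding v_def by (rule Least_le) simp
    qed
    then have "incseq (\<lambda>t. f (g (N + t)))" by (simp add: incseq_def)
    moreover have "strict_mono (\<lambda>t. g (N + t))"
      using g(1) by (simp add: strict_mono_def)
    ultimately show ?thesis by blast
  qed
qed

text \<open>
  Dickson's lemma, through a subsequence that is monotone in every exponent.
\<close>

lemma dickson:
  fixes m :: "nat \<Rightarrow> (nat \<Rightarrow>\<^sub>0 nat)"
  assumes "\<And>l. Poly_Mapping.keys (m l) \<subseteq> {..<n}"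
  obtains i j c where "i < j" "m j = m i + c"
proof -
  have "\<exists>r. strict_mono r \<and> (\<forall>i<k. incseq (\<lambda>t. Poly_Mapping.lookup (m (r t)) i))" for k
  proof (induction k)
    case 0
    then show ?case by (intro exI[of _ id]) (simp add: strict_mono_def)
  next
    case (Suc k)
    then obtain r where r: "strict_mono r" "\<forall>i<k. incseq (\<lambda>t. Poly_Mapping.lookup (m (r t)) i)" by blast
    obtain g where g: "strict_mono g" "incseq (\<lambda>t. Poly_Mapping.lookup (m (r (g t))) k)"
      using monotone_subsequence_nat[of "\<lambda>t. Poly_Mapping.lookup (m (r t)) k"] by blast
    have "incseq (\<lambda>t. Poly_Mapping.lookup (m (r (g t))) i)" if "i < Suc k" for i
    proof (cases "i = k")
      case False
      then have "incseq (\<lambda>t. Poly_Mapping.lookup (m (r t)) i)" using r(2) that by simp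
      then show ?thesis using g(1) by (simp add: incseq_def strict_mono_less_eq)
    qed (use g(2) in simp)
    moreover have "strict_mono (\<lambda>t. r (g t))" using r(1) g(1) by (simp add: strict_mono_def)
    ultimately show ?case by blast
  qed
  then obtain r where r: "strict_mono r" "\<forall>i<n. incseq (\<lambda>t. Poly_Mapping.lookup (m (r t)) i)" by blast
  have le: "Poly_Mapping.lookup (m (r 0)) i \<le> Poly_Mapping.lookup (m (r 1)) i" for i
  proof (cases "i < n")
    case True
    then show ?thesis using r(2) by (simp add: incseq_def)
  next
    case False
    then have "i \<notin> Poly_Mapping.keys (m (r 0))" using assms by blast
    then show ?thesis by (simp add: in_keys_iff)
  qed
  have "m (r 1) = m (r 0) + (m (r 1) - m (r 0))"
    by (rule poly_mapping_eqI) (use le in \<open>simp add: lookup_add lookup_minus\<close>)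
  moreover have "r 0 < r 1" using r(1) by (simp add: strict_mono_def)
  ultimately show thesis using that by blast
qed

context std_graded_algebra
begin

text \<open>
  Along an ascending chain the sets of standard monomials shrink. A monomial lost at each step
  would give a sequence in which none divides a later one, contrary to Dickson's lemma.
\<close>

lemma wf_hom_ideal: "wf {(I', I). hom_ideal I \<and> hom_ideal I' \<and> I \<subset> I'}"
  unfolding wf_iff_no_infinite_down_chain
proof
  assume "\<exists>f. \<forall>i. (f (Suc i), f i) \<in> {(I', I). hom_ideal I \<and> hom_ideal I' \<and> I \<subset> I'}"
  then obtain f where f: "\<And>i. hom_ideal (f i)" "\<And>i. f i \<subset> f (Suc i)" by blast
  have mono: "f i \<subseteq> f j" if "i \<le> j" for i j
    using that by (rule lift_Suc_mono_le[of f, rotated]) (rule psubset_imp_subset[OF f(2)])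
  have "\<forall>i. \<exists>m. m \<in> std (f i) \<and> m \<notin> std (f (Suc i))"
    using std_strict[OF f(1) f(1) f(2)] by blast
  from choice[OF this] obtain m where m: "\<forall>i. m i \<in> std (f i) \<and> m i \<notin> std (f (Suc i))"
    by (rule exE)
  have keys: "Poly_Mapping.keys (m i) \<subseteq> {..<edim}" for i
    using m by (auto simp: std_def)
  obtain i j c where ij: "i < j" "m j = m i + c"
    by (rule dickson[of m edim, OF keys])
  have "m i \<notin> std (f j)"
    using m std_antimono[OF mono[of "Suc i" j]] ij(1) by auto
  then have "m j \<notin> std (f j)"
    unfolding ij(2) by (rule std_multiple[OF f(1) _ keys])
  then show False using m by blast
qed

end


section \<open>The Hilbert series and the Krull dimension\<close>

context std_graded_algebra
begin

definition quotient_hilbert :: "'r set \<Rightarrow> int fps" where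
  "quotient_hilbert I = Abs_fps (\<lambda>j. int (a_dim j) - int (local.dim (I \<inter> G j)))"

definition adjoin :: "'r set \<Rightarrow> 'r \<Rightarrow> 'r set" where
  "adjoin I a = {u + a * v | u v. u \<in> I}"

definition colon :: "'r set \<Rightarrow> 'r \<Rightarrow> 'r set" where
  "colon I a = {x. a * x \<in> I}"

lemma hom_ideal_ideal: "hom_ideal I \<Longrightarrow> module.subspace (*) I"
  by (simp add: hom_ideal_def)

lemma subset_adjoin: "I \<subseteq> adjoin I a"
proof
  fix u assume "u \<in> I"
  moreover have "u = u + a * 0" by simp
  ultimately show "u \<in> adjoin I a" unfolding adjoin_def by blast
qed

lemma mem_adjoin: "hom_ideal I \<Longrightarrow> a \<in> adjoin I a"
proof -
  assume "hom_ideal I"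
  then have "0 \<in> I" by (simp add: hom_ideal_def ideal_iff)
  moreover have "a = 0 + a * 1" by simp
  ultimately show ?thesis unfolding adjoin_def by blast
qed

lemma ideal_adjoin:
  assumes "module.subspace (*) I"
  shows "module.subspace (*) (adjoin I a)"
  unfolding ideal_iff
proof (intro conjI ballI allI)
  show "0 \<in> adjoin I a" using subset_adjoin[of I a] assms unfolding ideal_iff by blast
next
  fix x y assume "x \<in> adjoin I a" "y \<in> adjoin I a"
  then obtain u v u' v' where *: "x = u + a * v" "y = u' + a * v'" "u \<in> I" "u' \<in> I"
    unfolding adjoin_def by blast
  have "x + y = (u + u') + a * (v + v')" unfolding * by (simp add: algebra_simps)
  moreover have "u + u' \<in> I" using assms * unfolding ideal_iff by blast
  ultimately show "x + y \<in> adjoin I a" unfolding adjoin_def by blast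
next
  fix c x assume "x \<in> adjoin I a"
  then obtain u v where *: "x = u + a * v" "u \<in> I" unfolding adjoin_def by blast
  have "c * x = c * u + a * (c * v)" unfolding * by (simp add: algebra_simps)
  moreover have "c * u \<in> I" using assms * unfolding ideal_iff by blast
  ultimately show "c * x \<in> adjoin I a" unfolding adjoin_def by blast
qed

lemma hom_ideal_adjoin:
  assumes "hom_ideal I" "a \<in> G i"
  shows "hom_ideal (adjoin I a)"
  unfolding hom_ideal_def
proof (intro conjI ballI allI)
  show "module.subspace (*) (adjoin I a)" by (rule ideal_adjoin[OF hom_ideal_ideal[OF assms(1)]])
  fix x j assume "x \<in> adjoin I a"
  then obtain u v where *: "x = u + a * v" "u \<in> I" unfolding adjoin_def by blast
  have "hom_part j x = hom_part j u + a * (if i \<le> j then hom_part (j - i) v else 0)"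
    unfolding * hom_part_add hom_part_mult_hom[OF assms(2)] by simp
  moreover have "hom_part j u \<in> I" using assms(1) *(2) by (simp add: hom_ideal_def)
  ultimately show "hom_part j x \<in> adjoin I a" unfolding adjoin_def by blast
qed

lemma hom_ideal_colon:
  assumes "hom_ideal I" "a \<in> G i"
  shows "hom_ideal (colon I a)"
  unfolding hom_ideal_def ideal_iff
proof (intro conjI ballI allI)
  have I: "module.subspace (*) I" by (rule hom_ideal_ideal[OF assms(1)])
  show "0 \<in> colon I a" using I by (simp add: colon_def ideal_iff)
  show "x + y \<in> colon I a" if "x \<in> colon I a" "y \<in> colon I a" for x y
    using that I by (simp add: colon_def ideal_iff distrib_left)
  show "c * x \<in> colon I a" if "x \<in> colon I a" for c x
  proof -
    have "c * (a * x) \<in> I" using that I unfolding colon_def ideal_iff by blast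
    then show ?thesis by (simp only: colon_def mem_Collect_eq mult.left_commute[of a c x])
  qed
  show "hom_part j x \<in> colon I a" if "x \<in> colon I a" for x j
  proof -
    have "hom_part (i + j) (a * x) \<in> I" using that assms(1) by (simp add: colon_def hom_ideal_def)
    then show ?thesis by (simp add: colon_def hom_part_mult_hom[OF assms(2)])
  qed
qed

lemma quotient_hilbert_adjoin:
  assumes I: "hom_ideal I" and a: "a \<in> G i"
  shows "quotient_hilbert I = quotient_hilbert (adjoin I a) + fps_X ^ i * quotient_hilbert (colon I a)"
proof (rule fps_ext)
  fix j
  show "fps_nth (quotient_hilbert I) j
    = fps_nth (quotient_hilbert (adjoin I a) + fps_X ^ i * quotient_hilbert (colon I a)) j"
  proof (cases "i \<le> j")
    case True
    let ?W = "{u + a * v | u v. u \<in> I \<inter> G j \<and> v \<in> G (j - i)}"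
    have "adjoin I a \<inter> G j = ?W"
    proof (intro subset_antisym subsetI)
      fix x assume x: "x \<in> adjoin I a \<inter> G j"
      then obtain u v where *: "x = u + a * v" "u \<in> I" unfolding adjoin_def by blast
      have "x = hom_part j x" using x hom_part_eqI[of x j j] by simp
      also have "\<dots> = hom_part j u + a * hom_part (j - i) v"
        unfolding * hom_part_add hom_part_mult_hom[OF a] using True by simp
      finally have "x = hom_part j u + a * hom_part (j - i) v" .
      moreover have "hom_part j u \<in> I \<inter> G j" using I *(2) by (simp add: hom_ideal_def)
      ultimately show "x \<in> ?W" by blast
    next
      fix x assume "x \<in> ?W"
      then obtain u v where *: "x = u + a * v" "u \<in> I" "u \<in> G j" "v \<in> G (j - i)" by blast
      have "a * v \<in> G j" using G_mult[OF a *(4)] True by simp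
      then have "x \<in> G j" unfolding *(1) by (rule subspace_add[OF subspace_G *(3)])
      then show "x \<in> adjoin I a \<inter> G j" using * unfolding adjoin_def by blast
    qed
    moreover have "{v \<in> G (j - i). a * v \<in> I \<inter> G j} = colon I a \<inter> G (j - i)"
      using G_mult[OF a, of _ "j - i"] True by (auto simp: colon_def)
    moreover have sub: "subspace (I \<inter> G j)"
      by (intro subspace_inter ideal_subspace hom_ideal_ideal I subspace_G)
    ultimately have "local.dim (adjoin I a \<inter> G j) + local.dim (colon I a \<inter> G (j - i))
      = local.dim (I \<inter> G j) + a_dim (j - i)"
      using AA.dim_sum_image[OF linear_mult[of a] subspace_G[of "j - i"] fin_dim_G sub
        fin_dim_subset[OF fin_dim_G Int_lower2]] by simp
    then show ?thesis
      unfolding quotient_hilbert_def using True by (simp add: fps_X_power_mult_nth)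
  next
    case False
    have "adjoin I a \<inter> G j = I \<inter> G j"
    proof (intro subset_antisym subsetI)
      fix x assume x: "x \<in> adjoin I a \<inter> G j"
      then obtain u v where *: "x = u + a * v" "u \<in> I" unfolding adjoin_def by blast
      have "x = hom_part j x" using x hom_part_eqI[of x j j] by simp
      also have "\<dots> = hom_part j u"
        unfolding * hom_part_add hom_part_mult_hom[OF a] using False by simp
      finally show "x \<in> I \<inter> G j" using I *(2) x unfolding hom_ideal_def by auto
    qed (use subset_adjoin in blast)
    then show ?thesis
      unfolding quotient_hilbert_def using False by (simp add: fps_X_power_mult_nth)
  qed
qed

text \<open>
  If \<open>x\<close> and \<open>y\<close> are outside \<open>I\<close>, their highest homogeneous parts outside \<open>I\<close> multiply to a part
  of \<open>x * y\<close> modulo \<open>I\<close>.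
\<close>

lemma prime_ideal_test:
  assumes I: "hom_ideal I" "1 \<notin> I"
    and hom: "\<And>i j a b. a \<in> G i \<Longrightarrow> b \<in> G j \<Longrightarrow> a * b \<in> I \<Longrightarrow> a \<in> I \<or> b \<in> I"
  shows "prime_ideal I"
  unfolding prime_ideal_def
proof (intro conjI allI impI)
  show id: "module.subspace (*) I" by (rule hom_ideal_ideal[OF I(1)])
  show "1 \<notin> I" by (rule I(2))
  fix x y assume xy: "x * y \<in> I"
  show "x \<in> I \<or> y \<in> I"
  proof (rule ccontr)
    assume "\<not> (x \<in> I \<or> y \<in> I)"
    then have notin: "x \<notin> I" "y \<notin> I" by auto
    have top: "\<exists>N. hom_part N z \<notin> I \<and> (\<forall>i>N. hom_part i z \<in> I)" if z: "z \<notin> I" for z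
    proof -
      obtain N where N: "\<forall>i>N. hom_part i z = 0" "(\<Sum>i\<le>N. hom_part i z) = z"
        using hom_part_bound by blast
      have fin: "finite {i. hom_part i z \<notin> I}"
      proof (rule finite_subset)
        show "{i. hom_part i z \<notin> I} \<subseteq> {..N}"
          using N(1) id unfolding ideal_iff by (metis (mono_tags, lifting) atMost_iff mem_Collect_eq not_le subsetI)
      qed simp
      have ne: "{i. hom_part i z \<notin> I} \<noteq> {}"
      proof
        assume "{i. hom_part i z \<notin> I} = {}"
        then have "(\<Sum>i\<le>N. hom_part i z) \<in> I" by (intro ideal_sum[OF id]) blast
        then show False using z N(2) by simp
      qed
      show ?thesis
        using Max_in[OF fin ne] Max_ge[OF fin] by (intro exI[of _ "Max {i. hom_part i z \<notin> I}"]) (force simp: not_le)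
    qed
    obtain i where i: "hom_part i x \<notin> I" "\<forall>k>i. hom_part k x \<in> I"
      using top[OF notin(1)] by (elim exE conjE)
    obtain j where j: "hom_part j y \<notin> I" "\<forall>k>j. hom_part k y \<in> I"
      using top[OF notin(2)] by (elim exE conjE)
    \<comment> \<open>the product of the top homogeneous parts outside \<open>I\<close> is a part of the product modulo \<open>I\<close>\<close>
    obtain N where N: "\<forall>k>N. hom_part k x = 0" "(\<Sum>k\<le>N. hom_part k x) = x"
      using hom_part_bound by blast
    have "hom_part (i + j) (x * y) = (\<Sum>k\<le>N. hom_part (i + j) (hom_part k x * y))"
      by (subst N(2)[symmetric]) (simp add: sum_distrib_right hom_part_sum)
    also have "\<dots> = (\<Sum>k\<le>N. if k \<le> i + j then hom_part k x * hom_part (i + j - k) y else 0)"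
      by (intro sum.cong refl hom_part_mult_hom hom_part_in)
    finally have part: "hom_part (i + j) (x * y)
      = (\<Sum>k\<le>N. if k \<le> i + j then hom_part k x * hom_part (i + j - k) y else 0)" .
    have "i \<le> N"
    proof (rule ccontr)
      assume "\<not> i \<le> N"
      then have "hom_part i x = 0" using N(1) by simp
      then show False using i(1) id unfolding ideal_iff by simp
    qed
    then have "hom_part (i + j) (x * y) = hom_part i x * hom_part j y
      + (\<Sum>k\<in>{..N} - {i}. if k \<le> i + j then hom_part k x * hom_part (i + j - k) y else 0)"
      unfolding part by (subst sum.remove[of _ i]) auto
    moreover have "(\<Sum>k\<in>{..N} - {i}. if k \<le> i + j then hom_part k x * hom_part (i + j - k) y else 0) \<in> I"
    proof (rule ideal_sum[OF id])
      fix k assume k: "k \<in> {..N} - {i}"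
      show "(if k \<le> i + j then hom_part k x * hom_part (i + j - k) y else 0) \<in> I"
      proof (cases "k > i")
        case True
        then have "hom_part k x \<in> I" using i(2) by blast
        then have "hom_part (i + j - k) y * hom_part k x \<in> I" and "0 \<in> I"
          using id unfolding ideal_iff by blast+
        then show ?thesis by (simp add: mult.commute)
      next
        case False
        then have "i + j - k > j" using k by auto
        then show ?thesis using j(2) id unfolding ideal_iff by simp
      qed
    qed
    moreover have "hom_part (i + j) (x * y) \<in> I" using I(1) xy by (simp add: hom_ideal_def)
    moreover have "p \<in> I" if "q = p + s" "s \<in> I" "q \<in> I" for p q s
      using ideal_diff[OF id that(3,2)] that(1) by simp
    ultimately have "hom_part i x * hom_part j y \<in> I" by blast
    then show False using hom[OF hom_part_in hom_part_in] i(1) j(1) by blast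
  qed
qed

lemma G_1_sub_imp_irrelevant:
  assumes "hom_ideal I" "G 1 \<subseteq> I" "res x = 0"
  shows "x \<in> I"
proof -
  obtain a where a: "x = (\<Sum>i<edim. var i * a i)"
    by (rule irrelevant_eq_var_combination[OF assms(3)])
  have "a i * var i \<in> I" if "i < edim" for i
    using assms(1,2) var_in_G1[OF that] unfolding hom_ideal_def ideal_iff by blast
  then show ?thesis
    unfolding a by (intro ideal_sum hom_ideal_ideal assms(1)) (simp add: mult.commute)
qed

lemma hom_ideal_irrelevant: "hom_ideal {x. res x = 0}"
  unfolding hom_ideal_def ideal_iff
proof (intro conjI ballI allI)
  fix x j assume "x \<in> {x. res x = 0}"
  then show "hom_part j x \<in> {x. res x = 0}"
    using residue_G[OF hom_part_in[of j x]] residue_eq_0_iff by (cases j) auto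
qed (auto simp: residue_add residue_mult)

lemma prime_irrelevant: "prime_ideal {x. res x = 0}"
  unfolding prime_ideal_def using hom_ideal_irrelevant
  by (auto simp: hom_ideal_def residue_mult)

text \<open>
  Noetherian induction on homogeneous ideals. If \<open>I\<close> is not prime, the Hilbert series of the
  quotient is the sum of those for two larger ideals, one of them shifted; if it is prime, dividing by a form of
  degree one outside \<open>I\<close> multiplies the series by \<open>1 - z\<close> and lowers the dimension.
\<close>

lemma hilbert_serre:
  assumes "hom_ideal I" "\<And>l (P :: nat \<Rightarrow> 'r set). prime_chain l P \<Longrightarrow> I \<subseteq> P 0 \<Longrightarrow> l \<le> D"
  shows "\<exists>h. quotient_hilbert I * (1 - fps_X) ^ D = fps_of_poly h"
  using wf_hom_ideal assms
proof (induction I arbitrary: D rule: wf_induct_rule)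
  case (less I)
  have id: "module.subspace (*) I" by (rule hom_ideal_ideal[OF less.prems(1)])
  consider "1 \<in> I"
    | i j a b where "a \<in> G i" "b \<in> G j" "a * b \<in> I" "a \<notin> I" "b \<notin> I"
    | "prime_ideal I" "G 1 \<subseteq> I"
    | x where "prime_ideal I" "x \<in> G 1" "x \<notin> I"
    using prime_ideal_test[OF less.prems(1)] by blast
  then show ?case
  proof cases
    case 1
    have "x \<in> I" for x
    proof -
      have "x * 1 \<in> I" using id 1 unfolding ideal_iff by blast
      then show ?thesis by simp
    qed
    then have "I = UNIV" by blast
    then have "quotient_hilbert I = 0"
      unfolding quotient_hilbert_def by (intro fps_ext) simp
    then show ?thesis by (intro exI[of _ 0]) simp
  next
    case (2 i j a b)
    let ?I1 = "adjoin I a" and ?I2 = "colon I a"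
    have h1: "hom_ideal ?I1" by (rule hom_ideal_adjoin[OF less.prems(1) 2(1)])
    have h2: "hom_ideal ?I2" by (rule hom_ideal_colon[OF less.prems(1) 2(1)])
    have s1: "I \<subset> ?I1" using subset_adjoin mem_adjoin[OF less.prems(1)] 2(4) by blast
    have "I \<subseteq> ?I2" using id unfolding colon_def ideal_iff by blast
    then have s2: "I \<subset> ?I2" using 2(3,5) by (auto simp: colon_def)
    obtain h' where h': "quotient_hilbert ?I1 * (1 - fps_X) ^ D = fps_of_poly h'"
      using less.IH[of ?I1 D] h1 s1 less.prems by blast
    obtain h'' where h'': "quotient_hilbert ?I2 * (1 - fps_X) ^ D = fps_of_poly h''"
      using less.IH[of ?I2 D] h2 s2 less.prems by blast
    have "quotient_hilbert I * (1 - fps_X) ^ D = quotient_hilbert ?I1 * (1 - fps_X) ^ D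
        + fps_X ^ i * (quotient_hilbert ?I2 * (1 - fps_X) ^ D)"
      unfolding quotient_hilbert_adjoin[OF less.prems(1) 2(1)] by (simp add: distrib_right mult.assoc)
    also have "\<dots> = fps_of_poly (h' + monom 1 i * h'')"
      unfolding h' h'' by (simp add: fps_of_poly_add fps_of_poly_mult fps_of_poly_monom')
    finally show ?thesis by blast
  next
    case 3
    have one: "1 \<notin> I" using 3(1) by (simp add: prime_ideal_def)
    have "I \<inter> G 0 = {0}"
    proof -
      have "x = 0" if x: "x \<in> I" "x \<in> G 0" for x
      proof (rule ccontr)
        assume "x \<noteq> 0"
        then have c: "res x \<noteq> 0" using G_0_eq_residue[OF x(2)] by auto
        have "scale (inverse (res x)) 1 * x \<in> I" using id x(1) unfolding ideal_iff by blast
        then have "scale (inverse (res x)) (scale (res x) 1) \<in> I"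
          using G_0_eq_residue[OF x(2)] by (simp add: scale_1_mult)
        then show False using one c by simp
      qed
      then show ?thesis using id by (auto simp: ideal_iff)
    qed
    then have d0: "local.dim (I \<inter> G 0) = 0" using dim_le_card[of "{0}" "{}"] by simp
    have "I \<inter> G j = G j" if "j > 0" for j
      using G_1_sub_imp_irrelevant[OF less.prems(1) 3(2)] residue_G that by blast
    then have "quotient_hilbert I = 1"
      unfolding quotient_hilbert_def using d0 by (intro fps_ext) (simp add: dim_G_0)
    then have "quotient_hilbert I * (1 - fps_X) ^ D = fps_of_poly ([:1, -1:] ^ D)"
      by (simp add: fps_of_poly_power fps_of_poly_pCons)
    then show ?thesis by blast
  next
    case (4 x)
    let ?I' = "adjoin I x"
    have h': "hom_ideal ?I'" by (rule hom_ideal_adjoin[OF less.prems(1) 4(2)])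
    have s: "I \<subset> ?I'" using subset_adjoin mem_adjoin[OF less.prems(1)] 4(3) by blast
    have longer: "Suc l \<le> D" if l: "prime_chain l P" "?I' \<subseteq> P 0" for l and P :: "nat \<Rightarrow> 'r set"
    proof (rule less.prems(2))
      show "prime_chain (Suc l) (case_nat I P)"
        unfolding prime_chain_def
      proof (intro conjI allI impI)
        fix i
        show "i \<le> Suc l \<Longrightarrow> prime_ideal (case_nat I P i)"
          using l(1) 4(1) by (cases i) (auto simp: prime_chain_def)
        show "i < Suc l \<Longrightarrow> case_nat I P i \<subset> case_nat I P (Suc i)"
          using l s by (cases i) (auto simp: prime_chain_def)
      qed
      show "I \<subseteq> case_nat I P 0" by simp
    qed
    have "1 \<le> D"
    proof -
      have "?I' \<subseteq> {x. res x = 0}"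
      proof -
        have "res u = 0" if "u \<in> I" for u
        proof (rule ccontr)
          assume u: "res u \<noteq> 0"
          have "hom_part 0 u \<in> I" using less.prems(1) that by (simp add: hom_ideal_def)
          then have "scale (inverse (res u)) 1 * hom_part 0 u \<in> I"
            using id unfolding ideal_iff by blast
          then have "1 \<in> I" using u by (simp add: hom_part_0_eq_residue scale_1_mult)
          then show False using 4(1) by (simp add: prime_ideal_def)
        qed
        then show ?thesis
          using residue_G[OF 4(2)] by (auto simp: adjoin_def residue_add residue_mult)
      qed
      moreover have "prime_chain 0 (\<lambda>_. {x. res x = 0})"
        by (simp add: prime_chain_def prime_irrelevant)
      ultimately have "Suc 0 \<le> D" by (rule longer[rotated])
      then show ?thesis by simp
    qed
    then obtain D' where D': "D = Suc D'" by (cases D) auto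
    have "(?I', I) \<in> {(I', I). hom_ideal I \<and> hom_ideal I' \<and> I \<subset> I'}"
      using less.prems(1) h' s by simp
    then obtain h where h: "quotient_hilbert ?I' * (1 - fps_X) ^ D' = fps_of_poly h"
      using less.IH[of ?I' D'] h' longer D' by auto
    have "colon I x = I"
      using 4 id unfolding colon_def prime_ideal_def ideal_iff by blast
    then have "quotient_hilbert I = quotient_hilbert ?I' + fps_X * quotient_hilbert I"
      using quotient_hilbert_adjoin[OF less.prems(1) 4(2)] by simp
    then have "quotient_hilbert I * (1 - fps_X) = quotient_hilbert ?I'"
      by (simp add: algebra_simps)
    then have "quotient_hilbert I * (1 - fps_X) ^ D = fps_of_poly h"
      unfolding D' power_Suc using h by (simp add: mult.assoc[symmetric])
    then show ?thesis by blast
  qed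
qed

lemma krull_dim_eq: "krull_dim TYPE('r) = Sup {l. \<exists>P :: nat \<Rightarrow> 'r set. prime_chain l P}"
  unfolding krull_dim_def prime_chain_def ..

lemma prime_chain_le_edim:
  assumes "prime_chain l (P :: nat \<Rightarrow> 'r set)"
  shows "l \<le> edim"
proof (rule prime_chain_bound[OF assms])
  show "int (a_dim j) \<le> fps_nth (monomial_series edim) j" for j
    using dim_rel[of j] by (simp add: monomial_series_def)
  show "monomial_series edim * (1 - fps_X) ^ edim = fps_of_poly 1"
    by (simp add: monomial_series)
qed

lemma prime_chain_le_krull_dim:
  assumes "prime_chain l (P :: nat \<Rightarrow> 'r set)"
  shows "l \<le> krull_dim TYPE('r)"
  unfolding krull_dim_eq
proof (rule cSup_upper)
  show "bdd_above {l. \<exists>P :: nat \<Rightarrow> 'r set. prime_chain l P}"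
    using prime_chain_le_edim by (intro bdd_aboveI[of _ edim]) blast
qed (use assms in blast)

lemma krull_dim_le:
  assumes "\<And>j. int (a_dim j) \<le> fps_nth S j" "S * (1 - fps_X) ^ p = fps_of_poly h"
  shows "krull_dim TYPE('r) \<le> p"
  unfolding krull_dim_eq
proof (rule cSup_least)
  have "prime_chain 0 (\<lambda>_. {x. res x = 0})"
    by (simp add: prime_chain_def prime_irrelevant)
  then show "{l. \<exists>P :: nat \<Rightarrow> 'r set. prime_chain l P} \<noteq> {}" by blast
qed (use prime_chain_bound[OF _ assms] in blast)

text \<open>
  The \<open>THE\<close> in the definition of the \<open>h\<close>-polynomial is justified: it exists by \<open>hilbert_serre\<close> for
  the zero ideal.
\<close>

lemma h_polynomial: "hilbert_series scale G * (1 - fps_X) ^ krull_dim TYPE('r) = fps_of_poly (h_polynomial scale G)"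
proof -
  have zero: "hom_ideal {0}"
    by (auto simp: hom_ideal_def ideal_iff)
  have "local.dim {0} = 0" using dim_le_card[of "{0}" "{}"] by simp
  moreover have "{0} \<inter> G j = {0}" for j by auto
  ultimately have "quotient_hilbert {0} = hilbert_series scale G"
    unfolding quotient_hilbert_def hilbert_series_def by simp
  moreover have "\<exists>h. quotient_hilbert {0} * (1 - fps_X) ^ krull_dim TYPE('r) = fps_of_poly h"
    by (rule hilbert_serre[OF zero prime_chain_le_krull_dim])
  ultimately obtain h where h: "hilbert_series scale G * (1 - fps_X) ^ krull_dim TYPE('r) = fps_of_poly h"
    by auto
  show ?thesis
    unfolding h_polynomial_def
    by (rule theI'[of "\<lambda>h. hilbert_series scale G * (1 - fps_X) ^ krull_dim TYPE('r) = fps_of_poly h"])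
      (use h in \<open>auto simp: fps_of_poly_eq_iff\<close>)
qed

end


section \<open>Changing the sign of the variable\<close>

text \<open>
  The substitution of \<open>-z\<close> for \<open>z\<close>.
\<close>

definition alt :: "int fps \<Rightarrow> rat fps" where
  "alt f = Abs_fps (\<lambda>i. (-1) ^ i * of_int (fps_nth f i))"

lemma alt_nth [simp]: "fps_nth (alt f) i = (-1) ^ i * of_int (fps_nth f i)"
  by (simp add: alt_def)

lemma alt_mult: "alt (f * g) = alt f * alt g"
proof (rule fps_ext)
  fix n
  have "fps_nth (alt f * alt g) n = (\<Sum>i=0..n. (-1) ^ n * (of_int (fps_nth f i) * of_int (fps_nth g (n - i))))"
    unfolding fps_mult_nth
  proof (rule sum.cong[OF refl])
    fix i assume "i \<in> {0..n}"
    then have "(-1 :: rat) ^ n = (-1) ^ i * (-1) ^ (n - i)"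
      by (simp add: power_add[symmetric])
    then show "fps_nth (alt f) i * fps_nth (alt g) (n - i)
      = (-1) ^ n * (of_int (fps_nth f i) * of_int (fps_nth g (n - i)))"
      by simp
  qed
  then show "fps_nth (alt (f * g)) n = fps_nth (alt f * alt g) n"
    by (simp add: fps_mult_nth sum_distrib_left)
qed

lemma alt_1 [simp]: "alt 1 = 1"
  by (rule fps_ext) simp

lemma alt_power: "alt (f ^ n) = alt f ^ n"
  by (induction n) (simp_all add: alt_mult)

lemma alt_one_minus_X: "alt (1 - fps_X) = 1 + fps_X"
  by (rule fps_ext) (auto simp: fps_X_nth)

lemma alt_one_minus_X2: "alt (1 - fps_X ^ 2) = 1 - fps_X ^ 2"
  by (rule fps_ext) (auto simp: fps_X_power_nth)

lemma coeff_pcompose_uminus: "coeff (pcompose h [:0, -1:]) i = (-1) ^ i * coeff h i"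
  for h :: "int poly"
proof (induction h arbitrary: i)
  case (pCons a h)
  show ?case
  proof (cases i)
    case (Suc k)
    then show ?thesis by (simp add: pcompose_pCons pCons.IH)
  qed (simp add: pcompose_pCons)
qed simp

lemma alt_fps_of_poly:
  "alt (fps_of_poly h) = fps_of_poly (map_poly of_int (pcompose h [:0, -1:]))"
  by (rule fps_ext) (simp add: coeff_map_poly coeff_pcompose_uminus)


section \<open>The numerical argument\<close>

lemma even_series_power_nonneg: "0 \<le> fps_nth (even_series ^ e :: rat fps) j"
  by (rule fps_power_nonneg) (simp add: even_series_def)

text \<open>
  Passing from \<open>e\<close> to \<open>e + 1\<close> adds \<open>e z\<^sup>4 / (1 - z\<^sup>2)\<^bsup>e+1\<^esup>\<close>.
\<close>

lemma one_minus_linear_over_power_nonneg: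
  "0 \<le> fps_nth (1 - (1 - of_nat e * fps_X ^ 2) * even_series ^ e :: rat fps) j"
proof (induction e)
  case (Suc e)
  let ?U = "even_series :: rat fps"
  have "(1 - of_nat (Suc e) * fps_X ^ 2 :: rat fps)
    = (1 - fps_X ^ 2) * (1 - of_nat e * fps_X ^ 2) - of_nat e * fps_X ^ 4"
    by (simp add: algebra_simps power_add[symmetric])
  then have "(1 - of_nat (Suc e) * fps_X ^ 2) * ?U ^ Suc e
    = (1 - of_nat e * fps_X ^ 2) * ?U ^ e * (?U * (1 - fps_X ^ 2)) - of_nat e * fps_X ^ 4 * ?U ^ Suc e"
    by (simp add: algebra_simps)
  then have eq: "1 - (1 - of_nat (Suc e) * fps_X ^ 2) * ?U ^ Suc e
    = (1 - (1 - of_nat e * fps_X ^ 2) * ?U ^ e) + of_nat e * fps_X ^ 4 * ?U ^ Suc e"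
    unfolding even_series by simp
  have "0 \<le> fps_nth (of_nat e * fps_X ^ 4 * ?U ^ Suc e) j"
    by (rule fps_mult_nonneg[OF _ even_series_power_nonneg])
      (simp add: fps_of_nat[symmetric] fps_X_power_nth)
  then show ?case unfolding eq fps_add_nth by (intro add_nonneg_nonneg Suc)
qed simp

text \<open>
  Dividing \<open>1 - E\<close> by \<open>(1 - z\<^sup>2)\<^sup>e\<close> keeps the signs of the coefficients as long as \<open>E\<close> has at
  least the term \<open>e z\<^sup>2\<close>.
\<close>

lemma one_minus_quotient_nonneg:
  fixes E :: "rat fps"
  assumes "\<And>j. 0 \<le> fps_nth E j" "of_nat e \<le> fps_nth E 2"
  shows "0 \<le> fps_nth (1 - (1 - E) * even_series ^ e) j"
proof -
  define B where "B = E - of_nat e * fps_X ^ 2"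
  have "0 \<le> fps_nth B i" for i
    using assms unfolding B_def by (simp add: fps_of_nat[symmetric] fps_X_power_nth)
  then have "0 \<le> fps_nth (B * even_series ^ e) j"
    by (rule fps_mult_nonneg[OF _ even_series_power_nonneg])
  moreover have eq: "1 - (1 - E) * even_series ^ e
    = (1 - (1 - of_nat e * fps_X ^ 2) * even_series ^ e) + B * even_series ^ e"
    unfolding B_def by (simp add: algebra_simps)
  ultimately show ?thesis
    unfolding eq fps_add_nth by (intro add_nonneg_nonneg one_minus_linear_over_power_nonneg)
qed


section \<open>Golod morphisms from complete intersections\<close>

context std_graded_algebra
begin

text \<open>
  For Koszul algebras this is the Hilbert series of the quadratic dual.
\<close>

definition koszul_dual_series :: "rat fps" where
  "koszul_dual_series = Abs_fps (\<lambda>i. of_nat (diagonal_betti i))"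

lemma koszul_dual_series:
  assumes "koszul scale G"
  shows "koszul_dual_series * alt (hilbert_series scale G) = 1"
proof -
  have "alt (Abs_fps (\<lambda>i. (-1) ^ i * int (diagonal_betti i))) = koszul_dual_series"
    unfolding koszul_dual_series_def by (rule fps_ext) (simp add: power_mult_distrib[symmetric])
  then show ?thesis
    using koszul_hilbert_series[OF assms] by (metis alt_mult alt_1)
qed

end

lemma nested_mult_nth:
  "fps_nth (fps_nth (f * g) i) j
    = (\<Sum>a=0..i. \<Sum>b=0..j. fps_nth (fps_nth f a) b * fps_nth (fps_nth g (i - a)) (j - b))"
  for f g :: "'a::comm_ring_1 fps fps"
  by (simp add: fps_mult_nth fps_sum_nth)

locale graded_surjection = Q: std_graded_algebra sQ GQ + R: std_graded_algebra sR GR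
  for sQ :: "'k::field \<Rightarrow> 'q::comm_ring_1 \<Rightarrow> 'q" and GQ
    and sR :: "'k \<Rightarrow> 'r::comm_ring_1 \<Rightarrow> 'r" and GR +
  fixes \<phi> :: "'q \<Rightarrow> 'r"
  assumes hom: "graded_algebra_hom sQ GQ sR GR \<phi>" and surj: "surj \<phi>"
begin

lemma \<phi>_linear: "Vector_Spaces.linear sQ sR \<phi>"
  using hom by (simp add: graded_algebra_hom_def)

lemma \<phi>_1: "\<phi> 1 = 1" and \<phi>_mult: "\<phi> (x * y) = \<phi> x * \<phi> y"
  using hom by (simp_all add: graded_algebra_hom_def)

lemma \<phi>_G: "x \<in> GQ i \<Longrightarrow> \<phi> x \<in> GR i"
  using hom unfolding graded_algebra_hom_def by blast

sublocale QR: vector_space_pair sQ sR ..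

lemma \<phi>_scale_1: "\<phi> (sQ a 1) = sR a 1"
  using QR.linear_scale[OF \<phi>_linear, of a 1] by (simp add: \<phi>_1)

lemma \<phi>_image_G: "\<phi> ` GQ j = GR j"
proof (intro subset_antisym subsetI)
  fix y assume y: "y \<in> GR j"
  obtain x where x: "y = \<phi> x" using surj by (metis surjD)
  obtain N where N: "(\<Sum>i\<le>N. Q.hom_part i x) = x" "\<forall>i>N. Q.hom_part i x = 0"
    using Q.hom_part_bound by blast
  have "y = R.hom_part j y" using y R.hom_part_eqI[of y j j] by simp
  also have "\<dots> = (\<Sum>i\<le>N. R.hom_part j (\<phi> (Q.hom_part i x)))"
    unfolding x by (subst N(1)[symmetric]) (simp add: QR.linear_sum[OF \<phi>_linear] R.hom_part_sum)
  also have "\<dots> = (\<Sum>i\<le>N. if i = j then \<phi> (Q.hom_part i x) else 0)"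
    by (intro sum.cong) (auto simp: R.hom_part_eqI[OF \<phi>_G[OF Q.hom_part_in]])
  also have "\<dots> = \<phi> (Q.hom_part j x)"
    using N(2) QR.linear_0[OF \<phi>_linear] by (cases "j \<le> N") (simp_all add: sum.delta)
  finally show "y \<in> \<phi> ` GQ j" by blast
qed (use \<phi>_G in blast)

lemma a_dim_le: "R.a_dim j \<le> Q.a_dim j"
  using QR.rank_nullity[OF \<phi>_linear Q.subspace_G Q.fin_dim_G, of j] unfolding \<phi>_image_G by simp

lemma graded_module_R: "graded_module sQ GQ (\<lambda>x y. \<phi> x * y) GR"
proof
  show "\<phi> x * (y + z) = \<phi> x * y + \<phi> x * z" for x y z by (rule distrib_left)
  show "\<phi> (x + x') * y = \<phi> x * y + \<phi> x' * y" for x x' y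
    by (simp add: QR.linear_add[OF \<phi>_linear] distrib_right)
  show "\<phi> x * (\<phi> x' * y) = \<phi> (x * x') * y" for x x' y by (simp add: \<phi>_mult mult.assoc)
  show "\<phi> 1 * y = y" for y by (simp add: \<phi>_1)
  show "\<phi> x * m \<in> GR (i + j)" if "x \<in> GQ i" "m \<in> GR j" for x m i j
    using that by (intro R.G_mult \<phi>_G)
  show "0 \<in> GR j" for j by simp
  show "m + m' \<in> GR j" if "m \<in> GR j" "m' \<in> GR j" for m m' j
    by (rule R.subspace_add[OF R.subspace_G that])
  show "\<exists>N f. (\<forall>i. f i \<in> GR i) \<and> m = (\<Sum>i\<le>N. f i)" for m
    using R.hom_part_bound[of m] by (metis R.hom_part_in)
  show "f i = 0" if "finite A" "\<And>i. i \<in> A \<Longrightarrow> f i \<in> GR i" "sum f A = 0" "i \<in> A" for A f i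
  proof -
    have "R.hom_part i (sum f A) = (\<Sum>k\<in>A. if k = i then f k else 0)"
      unfolding R.hom_part_sum by (intro sum.cong refl) (auto simp: R.hom_part_eqI[OF that(2)])
    then show ?thesis using that(1,3,4) by (simp add: sum.delta)
  qed
  show "\<exists>B. finite B \<and> GR j \<subseteq> module.span (\<lambda>a y. \<phi> (sQ a 1) * y) B" for j
    using R.fin_dim_G[of j] unfolding R.fin_dim_def \<phi>_scale_1 R.scale_1_mult .
qed

text \<open>
  The degree zero part of the first remainder in \<open>betti_excess\<close>: the module \<open>R\<close> is not zero in
  degree zero, so it needs a generator there.
\<close>

lemma betti_00_pos: "1 \<le> betti sQ GQ (\<lambda>x y. \<phi> x * y) GR 0 0"
proof -
  interpret M: graded_module sQ GQ "\<lambda>x y. \<phi> x * y" GR by (rule graded_module_R)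
  obtain e where e: "\<And>i j. 0 \<le> fps_nth (e i) j"
    "e 0 = betti_series sQ GQ (\<lambda>x y. \<phi> x * y) GR 0 * hilbert_series sQ GQ
      - Abs_fps (\<lambda>j. int (M.M.dim (GR j)))"
    "\<And>i. e (Suc i) + e i = betti_series sQ GQ (\<lambda>x y. \<phi> x * y) GR (Suc i) * hilbert_series sQ GQ"
    using M.betti_excess by metis
  have "M.M.dim (GR 0) = R.a_dim 0"
    unfolding \<phi>_scale_1 R.scale_1_mult ..
  then have "1 \<le> int (betti sQ GQ (\<lambda>x y. \<phi> x * y) GR 0 0)"
    using e(1)[of 0 0] unfolding e(2)
    by (simp add: betti_series_def Q.hilbert_series_nth Q.dim_G_0 R.dim_G_0)
  then show ?thesis by simp
qed

text \<open>
  The Golod equation makes the Poincare series of \<open>k\<close> over \<open>Q\<close> a lower bound for that over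
  \<open>R\<close>; hence \<open>Q\<close> inherits the Koszul property, and the equation only concerns the diagonal.
\<close>

lemma golod_koszul:
  assumes golod: "golod_equation
       (poincare_series sR GR (residue_smul sR GR) residue_grading)
       (poincare_series sQ GQ (residue_smul sQ GQ) residue_grading)
       (poincare_series sQ GQ (\<lambda>x y. \<phi> x * y) GR)"
    and koszul: "koszul sR GR"
  obtains E where "koszul sQ GQ" "\<forall>j. 0 \<le> fps_nth E j" "fps_nth E 0 = 0"
    "R.koszul_dual_series * (1 - E) = Q.koszul_dual_series"
proof -
  let ?PR = "poincare_series sR GR (residue_smul sR GR) residue_grading"
  let ?PQ = "poincare_series sQ GQ (residue_smul sQ GQ) residue_grading"
  let ?P = "poincare_series sQ GQ (\<lambda>x y. \<phi> x * y) GR"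
  define Y where "Y = fps_X * (?P - 1)"
  have nth: "fps_nth (fps_nth (poincare_series s G smul GM) i) j = of_nat (betti s G smul GM i j)"
    for s :: "'k \<Rightarrow> 'x::comm_ring_1 \<Rightarrow> 'x" and G smul GM i j
    by (simp add: poincare_series_def)
  have Y: "0 \<le> fps_nth (fps_nth Y i) j" for i j
    using betti_00_pos unfolding Y_def by (cases i) (auto simp: nth split: nat.splits)
  have eq: "?PR = ?PQ + ?PR * Y"
    using golod unfolding golod_equation_iff Y_def[symmetric] by (simp add: algebra_simps)
  have prod: "0 \<le> fps_nth (fps_nth (?PR * Y) i) j" for i j
    unfolding nested_mult_nth by (intro sum_nonneg mult_nonneg_nonneg Y) (simp add: nth)
  have "koszul sQ GQ"
    unfolding koszul_def
  proof (intro allI impI)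
    fix i j :: nat assume "i \<noteq> j"
    then have "fps_nth (fps_nth ?PR i) j = 0"
      using koszul by (simp add: nth koszul_def)
    then have "fps_nth (fps_nth ?PQ i) j \<le> 0"
      using prod[of i j] arg_cong[OF eq, of "\<lambda>f. fps_nth (fps_nth f i) j"] by simp
    then show "betti sQ GQ (residue_smul sQ GQ) residue_grading i j = 0"
      by (simp add: nth)
  qed
  moreover define E where "E = Abs_fps (\<lambda>i. fps_nth (fps_nth Y i) i)"
  have "R.koszul_dual_series = Q.koszul_dual_series + R.koszul_dual_series * E"
  proof (rule fps_ext)
    fix i
    have off: "fps_nth (fps_nth ?PR a) b = 0" if "b \<noteq> a" for a b
      using koszul that by (simp add: nth koszul_def)
    have "fps_nth (fps_nth (?PR * Y) i) i
      = (\<Sum>a=0..i. \<Sum>b=0..i. if b = a then fps_nth (fps_nth ?PR a) a * fps_nth (fps_nth Y (i - a)) (i - a) else 0)"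
      unfolding nested_mult_nth using off by (intro sum.cong) auto
    also have "\<dots> = fps_nth (R.koszul_dual_series * E) i"
      by (simp add: sum.delta fps_mult_nth E_def R.koszul_dual_series_def nth R.diagonal_betti_def)
    finally show "fps_nth R.koszul_dual_series i = fps_nth (Q.koszul_dual_series + R.koszul_dual_series * E) i"
      using arg_cong[OF eq, of "\<lambda>f. fps_nth (fps_nth f i) i"]
      by (simp add: nth R.koszul_dual_series_def Q.koszul_dual_series_def R.diagonal_betti_def Q.diagonal_betti_def)
  qed
  then have "R.koszul_dual_series * (1 - E) = Q.koszul_dual_series"
    by (simp add: algebra_simps)
  moreover have "\<forall>j. 0 \<le> fps_nth E j" by (simp add: E_def Y)
  moreover have "fps_nth E 0 = 0" by (simp add: E_def Y_def)
  ultimately show thesis using that[of E] by blast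
qed

text \<open>
  With \<open>1 - E = H\<^sub>R(-z) / H\<^sub>Q(-z)\<close> and \<open>H\<^sub>Q = (1 - z\<^sup>2)\<^sup>m / (1 - z)\<^sup>n\<close>, the coefficients of \<open>E\<close> in degrees
  one and two are differences of embedding dimensions and of numbers of quadrics, and the bounds
  on the Krull dimension turn the latter into \<open>E\<^sub>2 \<ge> c - m \<ge> 0\<close>.
\<close>

lemma koszul_backelin_roos:
  assumes ci: "complete_intersection sQ GQ" and koszul: "koszul sR GR"
    and golod: "golod_equation
       (poincare_series sR GR (residue_smul sR GR) residue_grading)
       (poincare_series sQ GQ (residue_smul sQ GQ) residue_grading)
       (poincare_series sQ GQ (\<lambda>x y. \<phi> x * y) GR)"
  shows "0 \<le> fps_nth
    (1 - fps_of_poly (map_poly of_int (pcompose (h_polynomial sR GR) [:0, -1:]))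
           / (1 - fps_X) ^ codim sR GR :: rat fps) j"
proof -
  obtain E where kQ: "koszul sQ GQ" and E: "\<forall>j. 0 \<le> fps_nth E j" "fps_nth E 0 = 0"
    and BE: "R.koszul_dual_series * (1 - E) = Q.koszul_dual_series"
    by (rule golod_koszul[OF golod koszul])
  let ?HQ = "hilbert_series sQ GQ" and ?HR = "hilbert_series sR GR"
  obtain m where m: "?HQ * (1 - fps_X) ^ Q.edim = (1 - fps_X ^ 2) ^ m" "m \<le> Q.edim"
    by (rule Q.koszul_complete_intersection[OF kQ ci])
  let ?D = "krull_dim TYPE('r)" and ?h = "h_polynomial sR GR"
  let ?hh = "fps_of_poly (map_poly of_int (pcompose ?h [:0, -1:])) :: rat fps"
  have hh: "alt ?HR * (1 + fps_X) ^ ?D = ?hh"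
    unfolding alt_fps_of_poly[symmetric] R.h_polynomial[symmetric]
    by (simp add: alt_mult alt_power alt_one_minus_X)
  have HQ: "alt ?HQ * (1 + fps_X) ^ Q.edim = (1 - fps_X ^ 2) ^ m"
    using arg_cong[OF m(1), of alt] by (simp add: alt_mult alt_power alt_one_minus_X alt_one_minus_X2)
  have M: "alt (monomial_series Q.edim) * (1 + fps_X) ^ Q.edim = 1"
    using arg_cong[OF monomial_series, of alt Q.edim] by (simp add: alt_mult alt_power alt_one_minus_X)
  have main: "(1 - E) * (1 - fps_X ^ 2) ^ m = alt ?HR * (1 + fps_X) ^ Q.edim"
  proof -
    have "1 - E = (R.koszul_dual_series * (1 - E)) * alt ?HR"
      using R.koszul_dual_series[OF koszul] by (simp add: mult_ac)
    then have "1 - E = Q.koszul_dual_series * alt ?HR" unfolding BE .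
    then have "(1 - E) * (1 - fps_X ^ 2) ^ m
      = (Q.koszul_dual_series * alt ?HQ) * (alt ?HR * (1 + fps_X) ^ Q.edim)"
      unfolding HQ[symmetric] by (simp only: mult_ac)
    then show ?thesis using Q.koszul_dual_series[OF kQ] by simp
  qed
  have low: "(1 - E) * alt ((1 - fps_X ^ 2) ^ m * monomial_series Q.edim) = alt ?HR"
  proof -
    have "(1 - E) * alt ((1 - fps_X ^ 2) ^ m * monomial_series Q.edim)
      = ((1 - E) * (1 - fps_X ^ 2) ^ m) * alt (monomial_series Q.edim)"
      by (simp add: alt_mult alt_power alt_one_minus_X2 mult.assoc)
    also have "\<dots> = alt ?HR * (alt (monomial_series Q.edim) * (1 + fps_X) ^ Q.edim)"
      unfolding main by (simp only: mult_ac)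
    finally show ?thesis unfolding M by simp
  qed
  have M1: "card (monomials Q.edim (Suc 0)) = Q.edim"
    using Q.dim_rel[of 1] Q.rel_1 P.dim_le_card[of "{0 :: 'k mpoly}" "{}"] Q.a_dim_1 by simp
  \<comment> \<open>the terms of degree one: \<open>Q\<close> and \<open>R\<close> have the same embedding dimension\<close>
  have E1: "of_nat (R.edim) = fps_nth E (Suc 0) + of_nat Q.edim"
    using arg_cong[OF low, of "\<lambda>f. fps_nth f (Suc 0)"]
    by (simp add: fps_mult_nth_012 one_minus_X2_power_nth E(2) monomial_series_def M1
      monomials_0_degree R.hilbert_series_nth R.a_dim_1)
  have "R.edim \<le> Q.edim" using a_dim_le[of 1] by (simp add: R.edim_def Q.edim_def)
  moreover have "(of_nat Q.edim :: rat) \<le> of_nat R.edim"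
    using E1 E(1)[rule_format, of "Suc 0"] by simp
  ultimately have n: "R.edim = Q.edim" by simp
  with E1 have E1': "fps_nth E (Suc 0) = 0" by simp
  \<comment> \<open>the terms of degree two: \<open>E\<^sub>2\<close> counts the quadrics of the kernel\<close>
  have E2: "fps_nth E 2 + of_nat (m + R.a_dim 2) = of_nat (card (monomials Q.edim 2))"
    using arg_cong[OF low, of "\<lambda>f. fps_nth f 2"]
    by (simp add: fps_mult_nth_012 one_minus_X2_power_nth E(2) E1' monomial_series_def M1
      monomials_0_degree R.hilbert_series_nth)
  have pole: "Q.edim + R.a_dim 2 \<le> ?D + card (monomials Q.edim 2)"
    using R.koszul_pole_order[OF koszul R.h_polynomial] n by simp
  have D_le: "?D \<le> Q.edim - m"
  proof (rule R.krull_dim_le)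
    show "int (R.a_dim j) \<le> fps_nth ?HQ j" for j
      using a_dim_le by (simp add: Q.hilbert_series_nth)
    have nz: "(1 - fps_X :: int fps) ^ m \<noteq> 0"
      using one_minus_X_power_nth(1)[of m] by (metis fps_zero_nth zero_neq_one)
    have "(1 - fps_X) ^ m * (?HQ * (1 - fps_X) ^ (Q.edim - m))
      = ?HQ * ((1 - fps_X) ^ m * (1 - fps_X) ^ (Q.edim - m))"
      by (simp only: mult_ac)
    also have "\<dots> = (1 - fps_X ^ 2) ^ m"
      unfolding power_add[symmetric] using m by simp
    also have "\<dots> = (1 - fps_X) ^ m * (1 + fps_X) ^ m"
      unfolding power_mult_distrib[symmetric] by (simp add: algebra_simps power2_eq_square)
    finally have "?HQ * (1 - fps_X) ^ (Q.edim - m) = (1 + fps_X) ^ m"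
      using nz mult_cancel_left by blast
    then show "?HQ * (1 - fps_X) ^ (Q.edim - m) = fps_of_poly ([:1, 1:] ^ m)"
      by (simp add: fps_of_poly_power fps_of_poly_pCons)
  qed
  have c: "codim sR GR = Q.edim - ?D"
    unfolding codim_def n[symmetric] R.edim_def ..
  define c where "c = codim sR GR"
  have cD: "c + ?D = Q.edim" and mc: "m \<le> c"
    using D_le m(2) unfolding c_def c by linarith+
  define e where "e = c - m"
  have "of_nat e \<le> fps_nth E 2"
  proof -
    have "c + m + R.a_dim 2 \<le> m + card (monomials Q.edim 2)" using pole cD by linarith
    then have "e + (m + R.a_dim 2) \<le> card (monomials Q.edim 2)"
      using mc unfolding e_def by linarith
    then have "(of_nat (e + (m + R.a_dim 2)) :: rat) \<le> of_nat (card (monomials Q.edim 2))"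
      by (rule of_nat_mono)
    then show ?thesis using E2 by simp
  qed
  then have nonneg: "0 \<le> fps_nth (1 - (1 - E) * even_series ^ e) j"
    using one_minus_quotient_nonneg E(1) by blast
  \<comment> \<open>\<open>h(-z) / (1 - z)\<^sup>c = (1 - E) / (1 - z\<^sup>2)\<^sup>e\<close>\<close>
  let ?V = "(1 + fps_X) * even_series"
  have V: "(1 - fps_X) * ?V = 1"
    using even_series by (simp add: algebra_simps power2_eq_square)
  have "?hh * ?V ^ c = (alt ?HR * (1 + fps_X) ^ Q.edim) * even_series ^ c"
    unfolding hh[symmetric] cD[symmetric] power_add power_mult_distrib by (simp only: mult_ac)
  also have "\<dots> = (1 - E) * (even_series * (1 - fps_X ^ 2)) ^ m * even_series ^ e"
  proof -
    have "(even_series :: rat fps) ^ c = even_series ^ m * even_series ^ e"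
      using mc by (simp add: e_def power_add[symmetric])
    then show ?thesis unfolding main[symmetric] power_mult_distrib by (simp only: mult_ac)
  qed
  finally have hV: "?hh * ?V ^ c = (1 - E) * even_series ^ e"
    unfolding even_series by simp
  have "(1 - fps_X) ^ c * ?V ^ c = 1"
    unfolding power_mult_distrib[symmetric] V by simp
  moreover have "fps_nth ((1 - fps_X :: rat fps) ^ c) 0 \<noteq> 0"
    by (simp add: fps_power_zeroth)
  ultimately have "?hh / (1 - fps_X) ^ c = ?hh * ?V ^ c"
    by (metis fps_divide_unit fps_inverse_unique)
  then show ?thesis
    using nonneg unfolding hV c_def[symmetric] by simp
qed

end

theorem proposition3p12:
  fixes scale :: "'k::field \<Rightarrow> 'r::comm_ring_1 \<Rightarrow> 'r"
    and G :: "nat \<Rightarrow> 'r set"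
  assumes "std_graded_algebra scale G"
    and "koszul scale G"
    and "backelin_roos TYPE('q::comm_ring_1) scale G"
  shows "\<forall>n. 0 \<le> fps_nth
    (1 - fps_of_poly (map_poly of_int (pcompose (h_polynomial scale G) [:0, -1:]))
           / (1 - fps_X) ^ codim scale G :: rat fps) n"
proof -
  obtain sQ :: "'k \<Rightarrow> 'q \<Rightarrow> 'q" and GQ \<phi>
    where ci: "complete_intersection sQ GQ" and golod: "surjective_golod sQ GQ scale G \<phi>"
    using assms(3) unfolding backelin_roos_def by blast
  have "graded_surjection sQ GQ scale G \<phi>"
    using ci golod assms(1)
    unfolding graded_surjection_def graded_surjection_axioms_def complete_intersection_def surjective_golod_def
    by blast
  then show ?thesis
    using graded_surjection.koszul_backelin_roos[OF _ ci assms(2)] golod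
    unfolding surjective_golod_def by blast
qed

end
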